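(* Let $\mathbb{D}$ be a derivator and let $v\colon L\to M$ be a functor between small categories. The morphism of derivators $v^\ast\colon\mathbb{D}^M\to\mathbb{D}^L$ preserves homotopy Kan extensions (both left and right, along all functors between small categories). In particular, this is the case for the evaluation morphisms $m^\ast\colon\mathbb{D}^M\to\mathbb{D}$, for $m\in M$.
   Context: $\mathsf{Cat}$ is the 2-category of small categories, $\mathsf{CAT}$ that of not necessarily small categories, $e$ the terminal category. A prederivator is a strict 2-functor $\mathbb{D}\colon\mathsf{Cat}^{op}\to\mathsf{CAT}$ (contravariant on functors, covariant on natural transformations). Write $u^\ast=\mathbb{D}(u)\colon\mathbb{D}(K)\to\mathbb{D}(J)$ for $u\colon J\to K$, and $\alpha^\ast=\mathbb{D}(\alpha)$. For $k\in K$, viewed as $k\colon e\to K$, write $X_k=k^\ast X\in\mathbb{D}(e)$, $f_k=k^\ast f$. $\mathbb{D}$ is a derivator if: (Der1) for all $J_1,J_2$ the functor $\mathbb{D}(J_1\sqcup J_2)\to\mathbb{D}(J_1)\times\mathbb{D}(J_2)$ induced by the inclusions is an equivalence, and $\mathbb{D}(\emptyset)$ is not the empty category; (Der2) a morphism $f$ in $\mathbb{D}(J)$ is an isomorphism iff $f_j$ is an isomorphism in $\mathbb{D}(e)$ for all $j\in J$; (Der3) every $u^\ast$ has a left adjoint $u_!$ and a right adjoint $u_\ast$ (homotopy left/right Kan extension); (Der4) for $u\colon J\to K$ and $k\in K$ let $J_{/k}$ be the category of pairs $(j,f\colon u(j)\to k)$ and $J_{k/}$ that of pairs $(j,f\colon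 k\to u(j))$, with projections $\mathrm{pr}$ to $J$ and $p$ to $e$, and let $\alpha\colon u\circ\mathrm{pr}\to k\circ p$, resp. $\alpha\colon k\circ p\to u\circ\mathrm{pr}$, be the transformation with components $f$. Then the maps $p_!\mathrm{pr}^\ast\xrightarrow{\eta}p_!\mathrm{pr}^\ast u^\ast u_!\xrightarrow{\alpha^\ast}p_!p^\ast k^\ast u_!\xrightarrow{\epsilon}k^\ast u_!$ and $k^\ast u_\ast\xrightarrow{\eta}p_\ast p^\ast k^\ast u_\ast\xrightarrow{\alpha^\ast}p_\ast\mathrm{pr}^\ast u^\ast u_\ast\xrightarrow{\epsilon}p_\ast\mathrm{pr}^\ast$ are isomorphisms. For a derivator $\mathbb{D}$ and a small category $M$, $\mathbb{D}^M\colon K\mapsto\mathbb{D}(M\times K)$, $u\mapsto(\mathrm{id}_M\times u)^\ast$, is again a derivator. A morphism of derivators $F\colon\mathbb{D}\to\mathbb{D}'$ is a pseudo-natural transformation: functors $F_J\colon\mathbb{D}(J)\to\mathbb{D}'(J)$ and natural isomorphisms $\gamma_u\colon u^\ast F_K\to F_Ju^\ast$ for $u\colon J\to K$, compatible with identities, composition and natural transformations. $F$ preserves homotopy left (resp. right) Kan extensions along $u\colon J\to K$ if the composite $u_!F_J\xrightarrow{\eta}u_!F_Ju^\ast u_!\xrightarrow{\gamma_u^{-1}}u_!u^\ast F_Ku_!\xrightarrow{\epsilon}F_Ku_!$ (resp. $F_Ku_\ast\xrightarrow{\eta}u_\ast u^\ast F_Ku_\ast\xrightarrow{\gamma_u}u_\ast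 F_Ju^\ast u_\ast\xrightarrow{\epsilon}u_\ast F_J$) is an isomorphism. The morphism $v^\ast\colon\mathbb{D}^M\to\mathbb{D}^L$ has components $(v\times\mathrm{id}_K)^\ast\colon\mathbb{D}(M\times K)\to\mathbb{D}(L\times K)$ and identity coherence isomorphisms $\gamma_u$. For $m\in M$, the evaluation morphism $m^\ast\colon\mathbb{D}^M\to\mathbb{D}^e\cong\mathbb{D}$ is the case $v=m\colon e\to M$. *)

theory Defs
  imports "HOL-Library.Equipollence" "HOL-Library.FuncSet"
begin

section \<open>Categories, functors, natural transformations\<close>

text \<open>All structure maps are undefined outside their domains, so that equality of records is
  equality of categories, functors and natural transformations. This is needed to state strict
  2-functoriality as plain equations. Composition is written in applicative order:
  \<open>Comp C g f\<close> is \<open>g\<close> after \<open>f\<close>.\<close>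

record ('o, 'a) category =
  Obj :: "'o set"
  Arr :: "'a set"
  Dom :: "'a \<Rightarrow> 'o"
  Cod :: "'a \<Rightarrow> 'o"
  Id :: "'o \<Rightarrow> 'a"
  Comp :: "'a \<Rightarrow> 'a \<Rightarrow> 'a"

locale is_category =
  fixes C :: "('o, 'a) category"
  assumes Dom_Obj: "f \<in> Arr C \<Longrightarrow> Dom C f \<in> Obj C"
    and Cod_Obj: "f \<in> Arr C \<Longrightarrow> Cod C f \<in> Obj C"
    and Id_Arr: "x \<in> Obj C \<Longrightarrow> Id C x \<in> Arr C"
    and Dom_Id: "x \<in> Obj C \<Longrightarrow> Dom C (Id C x) = x"
    and Cod_Id: "x \<in> Obj C \<Longrightarrow> Cod C (Id C x) = x"
    and Comp_Arr: "\<lbrakk>g \<in> Arr C; f \<in> Arr C; Dom C g = Cod C f\<rbrakk> \<Longrightarrow> Comp C g f \<in> Arr C"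
    and Dom_Comp: "\<lbrakk>g \<in> Arr C; f \<in> Arr C; Dom C g = Cod C f\<rbrakk> \<Longrightarrow> Dom C (Comp C g f) = Dom C f"
    and Cod_Comp: "\<lbrakk>g \<in> Arr C; f \<in> Arr C; Dom C g = Cod C f\<rbrakk> \<Longrightarrow> Cod C (Comp C g f) = Cod C g"
    and Comp_Id: "f \<in> Arr C \<Longrightarrow> Comp C f (Id C (Dom C f)) = f"
    and Id_Comp: "f \<in> Arr C \<Longrightarrow> Comp C (Id C (Cod C f)) f = f"
    and Comp_assoc: "\<lbrakk>h \<in> Arr C; g \<in> Arr C; f \<in> Arr C; Dom C h = Cod C g; Dom C g = Cod C f\<rbrakk>
      \<Longrightarrow> Comp C h (Comp C g f) = Comp C (Comp C h g) f"
    and Dom_ext: "Dom C \<in> extensional (Arr C)"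
    and Cod_ext: "Cod C \<in> extensional (Arr C)"
    and Id_ext: "Id C \<in> extensional (Obj C)"
    and Comp_ext: "\<not> (g \<in> Arr C \<and> f \<in> Arr C \<and> Dom C g = Cod C f) \<Longrightarrow> Comp C g f = undefined"

definition mk_category ::
    "'o set \<Rightarrow> 'a set \<Rightarrow> ('a \<Rightarrow> 'o) \<Rightarrow> ('a \<Rightarrow> 'o) \<Rightarrow> ('o \<Rightarrow> 'a) \<Rightarrow> ('a \<Rightarrow> 'a \<Rightarrow> 'a) \<Rightarrow> ('o, 'a) category" where
  "mk_category X A d c i m =
    \<lparr>Obj = X, Arr = A, Dom = restrict d A, Cod = restrict c A, Id = restrict i X,
     Comp = (\<lambda>g f. if g \<in> A \<and> f \<in> A \<and> d g = c f then m g f else undefined)\<rparr>"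

definition iso_arr :: "('o, 'a) category \<Rightarrow> 'a \<Rightarrow> bool" where
  "iso_arr C f \<longleftrightarrow> f \<in> Arr C \<and>
    (\<exists>g\<in>Arr C. Dom C g = Cod C f \<and> Cod C g = Dom C f \<and>
      Comp C g f = Id C (Dom C f) \<and> Comp C f g = Id C (Cod C f))"

definition inv_arr :: "('o, 'a) category \<Rightarrow> 'a \<Rightarrow> 'a" where
  "inv_arr C f = (THE g. g \<in> Arr C \<and> Dom C g = Cod C f \<and> Cod C g = Dom C f \<and>
    Comp C g f = Id C (Dom C f) \<and> Comp C f g = Id C (Cod C f))"

record ('o, 'a, 'p, 'b) cat_functor =
  Src :: "('o, 'a) category"
  Tgt :: "('p, 'b) category"
  MapO :: "'o \<Rightarrow> 'p"
  MapA :: "'a \<Rightarrow> 'b"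

locale is_functor =
  fixes F :: "('o, 'a, 'p, 'b) cat_functor"
  assumes Src_category: "is_category (Src F)"
    and Tgt_category: "is_category (Tgt F)"
    and MapO_PiE: "MapO F \<in> Obj (Src F) \<rightarrow>\<^sub>E Obj (Tgt F)"
    and MapA_PiE: "MapA F \<in> Arr (Src F) \<rightarrow>\<^sub>E Arr (Tgt F)"
    and MapA_Dom: "f \<in> Arr (Src F) \<Longrightarrow> Dom (Tgt F) (MapA F f) = MapO F (Dom (Src F) f)"
    and MapA_Cod: "f \<in> Arr (Src F) \<Longrightarrow> Cod (Tgt F) (MapA F f) = MapO F (Cod (Src F) f)"
    and MapA_Id: "x \<in> Obj (Src F) \<Longrightarrow> MapA F (Id (Src F) x) = Id (Tgt F) (MapO F x)"
    and MapA_Comp: "\<lbrakk>g \<in> Arr (Src F); f \<in> Arr (Src F); Dom (Src F) g = Cod (Src F) f\<rbrakk>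
      \<Longrightarrow> MapA F (Comp (Src F) g f) = Comp (Tgt F) (MapA F g) (MapA F f)"

definition mk_functor ::
    "('o, 'a) category \<Rightarrow> ('p, 'b) category \<Rightarrow> ('o \<Rightarrow> 'p) \<Rightarrow> ('a \<Rightarrow> 'b) \<Rightarrow> ('o, 'a, 'p, 'b) cat_functor" where
  "mk_functor C C' fo fa =
    \<lparr>Src = C, Tgt = C', MapO = restrict fo (Obj C), MapA = restrict fa (Arr C)\<rparr>"

definition idF :: "('o, 'a) category \<Rightarrow> ('o, 'a, 'o, 'a) cat_functor" where
  "idF C = mk_functor C C (\<lambda>x. x) (\<lambda>f. f)"

definition compF ::
    "('p, 'b, 'q, 'c) cat_functor \<Rightarrow> ('o, 'a, 'p, 'b) cat_functor \<Rightarrow> ('o, 'a, 'q, 'c) cat_functor"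
    (infixl "\<odot>" 75) where
  "G \<odot> F = mk_functor (Src F) (Tgt G) (\<lambda>x. MapO G (MapO F x)) (\<lambda>f. MapA G (MapA F f))"

record ('o, 'a, 'p, 'b) nat_transf =
  DomF :: "('o, 'a, 'p, 'b) cat_functor"
  CodF :: "('o, 'a, 'p, 'b) cat_functor"
  At :: "'o \<Rightarrow> 'b"

locale is_nat_transf =
  fixes \<alpha> :: "('o, 'a, 'p, 'b) nat_transf"
  assumes DomF_functor: "is_functor (DomF \<alpha>)"
    and CodF_functor: "is_functor (CodF \<alpha>)"
    and Src_eq: "Src (CodF \<alpha>) = Src (DomF \<alpha>)"
    and Tgt_eq: "Tgt (CodF \<alpha>) = Tgt (DomF \<alpha>)"
    and At_PiE: "At \<alpha> \<in> Obj (Src (DomF \<alpha>)) \<rightarrow>\<^sub>E Arr (Tgt (DomF \<alpha>))"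
    and At_Dom: "x \<in> Obj (Src (DomF \<alpha>)) \<Longrightarrow> Dom (Tgt (DomF \<alpha>)) (At \<alpha> x) = MapO (DomF \<alpha>) x"
    and At_Cod: "x \<in> Obj (Src (DomF \<alpha>)) \<Longrightarrow> Cod (Tgt (DomF \<alpha>)) (At \<alpha> x) = MapO (CodF \<alpha>) x"
    and naturality: "f \<in> Arr (Src (DomF \<alpha>)) \<Longrightarrow>
      Comp (Tgt (DomF \<alpha>)) (MapA (CodF \<alpha>) f) (At \<alpha> (Dom (Src (DomF \<alpha>)) f)) =
      Comp (Tgt (DomF \<alpha>)) (At \<alpha> (Cod (Src (DomF \<alpha>)) f)) (MapA (DomF \<alpha>) f)"

definition mk_nat ::
    "('o, 'a, 'p, 'b) cat_functor \<Rightarrow> ('o, 'a, 'p, 'b) cat_functor \<Rightarrow> ('o \<Rightarrow> 'b) \<Rightarrow> ('o, 'a, 'p, 'b) nat_transf" where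
  "mk_nat F G t = \<lparr>DomF = F, CodF = G, At = restrict t (Obj (Src F))\<rparr>"

definition nat_trans ::
    "('o, 'a, 'p, 'b) nat_transf \<Rightarrow> ('o, 'a, 'p, 'b) cat_functor \<Rightarrow> ('o, 'a, 'p, 'b) cat_functor \<Rightarrow> bool" where
  "nat_trans \<alpha> F G \<longleftrightarrow> is_nat_transf \<alpha> \<and> DomF \<alpha> = F \<and> CodF \<alpha> = G"

definition nat_iso ::
    "('o, 'a, 'p, 'b) nat_transf \<Rightarrow> ('o, 'a, 'p, 'b) cat_functor \<Rightarrow> ('o, 'a, 'p, 'b) cat_functor \<Rightarrow> bool" where
  "nat_iso \<alpha> F G \<longleftrightarrow> nat_trans \<alpha> F G \<and> (\<forall>x\<in>Obj (Src F). iso_arr (Tgt F) (At \<alpha> x))"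

definition idN :: "('o, 'a, 'p, 'b) cat_functor \<Rightarrow> ('o, 'a, 'p, 'b) nat_transf" where
  "idN F = mk_nat F F (\<lambda>x. Id (Tgt F) (MapO F x))"

definition invN :: "('o, 'a, 'p, 'b) nat_transf \<Rightarrow> ('o, 'a, 'p, 'b) nat_transf" where
  "invN \<alpha> = mk_nat (CodF \<alpha>) (DomF \<alpha>) (\<lambda>x. inv_arr (Tgt (DomF \<alpha>)) (At \<alpha> x))"

text \<open>Vertical composition \<open>\<beta> \<bullet> \<alpha>\<close> and horizontal composition \<open>\<beta> \<star> \<alpha>\<close>. Whiskering with a functor
  \<open>F\<close> is horizontal composition with \<open>idN F\<close>.\<close>

definition vcomp ::
    "('o, 'a, 'p, 'b) nat_transf \<Rightarrow> ('o, 'a, 'p, 'b) nat_transf \<Rightarrow> ('o, 'a, 'p, 'b) nat_transf"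
    (infixl "\<bullet>" 65) where
  "\<beta> \<bullet> \<alpha> = mk_nat (DomF \<alpha>) (CodF \<beta>) (\<lambda>x. Comp (Tgt (DomF \<alpha>)) (At \<beta> x) (At \<alpha> x))"

definition hcomp ::
    "('p, 'b, 'q, 'c) nat_transf \<Rightarrow> ('o, 'a, 'p, 'b) nat_transf \<Rightarrow> ('o, 'a, 'q, 'c) nat_transf"
    (infixl "\<star>" 70) where
  "\<beta> \<star> \<alpha> = mk_nat (DomF \<beta> \<odot> DomF \<alpha>) (CodF \<beta> \<odot> CodF \<alpha>)
    (\<lambda>x. Comp (Tgt (DomF \<beta>)) (At \<beta> (MapO (CodF \<alpha>) x)) (MapA (DomF \<beta>) (At \<alpha> x)))"

definition equivalence :: "('o, 'a, 'p, 'b) cat_functor \<Rightarrow> bool" where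
  "equivalence F \<longleftrightarrow> is_functor F \<and>
    (\<exists>G \<theta> \<theta>'. is_functor G \<and> Src G = Tgt F \<and> Tgt G = Src F \<and>
      nat_iso \<theta> (idF (Src F)) (G \<odot> F) \<and> nat_iso \<theta>' (F \<odot> G) (idF (Tgt F)))"

text \<open>\<open>L\<close> is left adjoint to \<open>R\<close> with unit \<open>\<eta>\<close> and counit \<open>\<epsilon>\<close>.\<close>

definition adjunction ::
    "('o, 'a, 'p, 'b) cat_functor \<Rightarrow> ('p, 'b, 'o, 'a) cat_functor \<Rightarrow>
     ('o, 'a, 'o, 'a) nat_transf \<Rightarrow> ('p, 'b, 'p, 'b) nat_transf \<Rightarrow> bool" where
  "adjunction L R \<eta> \<epsilon> \<longleftrightarrow>
    is_functor L \<and> is_functor R \<and> Src R = Tgt L \<and> Tgt R = Src L \<and>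
    nat_trans \<eta> (idF (Src L)) (R \<odot> L) \<and> nat_trans \<epsilon> (L \<odot> R) (idF (Tgt L)) \<and>
    (\<epsilon> \<star> idN L) \<bullet> (idN L \<star> \<eta>) = idN L \<and>
    (idN R \<star> \<epsilon>) \<bullet> (\<eta> \<star> idN R) = idN R"

definition has_left_adjoint :: "('o, 'a, 'p, 'b) cat_functor \<Rightarrow> bool" where
  "has_left_adjoint R \<longleftrightarrow> (\<exists>L \<eta> \<epsilon>. adjunction L R \<eta> \<epsilon>)"

definition has_right_adjoint :: "('o, 'a, 'p, 'b) cat_functor \<Rightarrow> bool" where
  "has_right_adjoint L \<longleftrightarrow> (\<exists>R \<eta> \<epsilon>. adjunction L R \<eta> \<epsilon>)"

section \<open>Constructions on categories\<close>

definition unit_cat :: "(unit, unit) category" where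
  "unit_cat = mk_category UNIV UNIV (\<lambda>_. ()) (\<lambda>_. ()) (\<lambda>_. ()) (\<lambda>_ _. ())"

definition prod_cat :: "('o, 'a) category \<Rightarrow> ('p, 'b) category \<Rightarrow> ('o \<times> 'p, 'a \<times> 'b) category" where
  "prod_cat C C' = mk_category (Obj C \<times> Obj C') (Arr C \<times> Arr C')
    (\<lambda>f. (Dom C (fst f), Dom C' (snd f)))
    (\<lambda>f. (Cod C (fst f), Cod C' (snd f)))
    (\<lambda>x. (Id C (fst x), Id C' (snd x)))
    (\<lambda>g f. (Comp C (fst g) (fst f), Comp C' (snd g) (snd f)))"

definition prod_functor ::
    "('o, 'a, 'p, 'b) cat_functor \<Rightarrow> ('o', 'a', 'p', 'b') cat_functor \<Rightarrow>
     ('o \<times> 'o', 'a \<times> 'a', 'p \<times> 'p', 'b \<times> 'b') cat_functor" where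
  "prod_functor F F' = mk_functor (prod_cat (Src F) (Src F')) (prod_cat (Tgt F) (Tgt F'))
    (map_prod (MapO F) (MapO F')) (map_prod (MapA F) (MapA F'))"

definition prod_nat ::
    "('o, 'a, 'p, 'b) nat_transf \<Rightarrow> ('o', 'a', 'p', 'b') nat_transf \<Rightarrow>
     ('o \<times> 'o', 'a \<times> 'a', 'p \<times> 'p', 'b \<times> 'b') nat_transf" where
  "prod_nat \<alpha> \<alpha>' = mk_nat (prod_functor (DomF \<alpha>) (DomF \<alpha>')) (prod_functor (CodF \<alpha>) (CodF \<alpha>'))
    (map_prod (At \<alpha>) (At \<alpha>'))"

definition pairing ::
    "('o, 'a, 'p, 'b) cat_functor \<Rightarrow> ('o, 'a, 'q, 'c) cat_functor \<Rightarrow>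
     ('o, 'a, 'p \<times> 'q, 'b \<times> 'c) cat_functor" where
  "pairing F G = mk_functor (Src F) (prod_cat (Tgt F) (Tgt G))
    (\<lambda>x. (MapO F x, MapO G x)) (\<lambda>f. (MapA F f, MapA G f))"

definition sum_cat :: "('o, 'a) category \<Rightarrow> ('p, 'b) category \<Rightarrow> ('o + 'p, 'a + 'b) category" where
  "sum_cat C C' = mk_category (Obj C <+> Obj C') (Arr C <+> Arr C')
    (map_sum (Dom C) (Dom C')) (map_sum (Cod C) (Cod C')) (map_sum (Id C) (Id C'))
    (\<lambda>g f. case (g, f) of
        (Inl g', Inl f') \<Rightarrow> Inl (Comp C g' f')
      | (Inr g', Inr f') \<Rightarrow> Inr (Comp C' g' f')
      | _ \<Rightarrow> undefined)"

text \<open>For \<open>u : J \<rightarrow> K\<close> and an object \<open>k\<close> of \<open>K\<close>: the category of pairs \<open>(j, f : u j \<rightarrow> k)\<close> and the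
  category of pairs \<open>(j, f : k \<rightarrow> u j)\<close>. An arrow is stored as (source, underlying arrow of \<open>J\<close>,
  target), since the underlying arrow alone does not determine source and target.\<close>

definition over_obj :: "('o, 'a, 'p, 'b) cat_functor \<Rightarrow> 'p \<Rightarrow> ('o \<times> 'b) set" where
  "over_obj u k = {(j, f). j \<in> Obj (Src u) \<and> f \<in> Arr (Tgt u) \<and>
    Dom (Tgt u) f = MapO u j \<and> Cod (Tgt u) f = k}"

definition over_cat ::
    "('o, 'a, 'p, 'b) cat_functor \<Rightarrow> 'p \<Rightarrow> ('o \<times> 'b, ('o \<times> 'b) \<times> 'a \<times> ('o \<times> 'b)) category" where
  "over_cat u k = mk_category (over_obj u k)
    {(x, g, y). x \<in> over_obj u k \<and> y \<in> over_obj u k \<and> g \<in> Arr (Src u) \<and>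
      Dom (Src u) g = fst x \<and> Cod (Src u) g = fst y \<and>
      Comp (Tgt u) (snd y) (MapA u g) = snd x}
    (\<lambda>(x, g, y). x) (\<lambda>(x, g, y). y) (\<lambda>x. (x, Id (Src u) (fst x), x))
    (\<lambda>(x', g', y') (x, g, y). (x, Comp (Src u) g' g, y'))"

definition under_obj :: "('o, 'a, 'p, 'b) cat_functor \<Rightarrow> 'p \<Rightarrow> ('o \<times> 'b) set" where
  "under_obj u k = {(j, f). j \<in> Obj (Src u) \<and> f \<in> Arr (Tgt u) \<and>
    Dom (Tgt u) f = k \<and> Cod (Tgt u) f = MapO u j}"

definition under_cat ::
    "('o, 'a, 'p, 'b) cat_functor \<Rightarrow> 'p \<Rightarrow> ('o \<times> 'b, ('o \<times> 'b) \<times> 'a \<times> ('o \<times> 'b)) category" where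
  "under_cat u k = mk_category (under_obj u k)
    {(x, g, y). x \<in> under_obj u k \<and> y \<in> under_obj u k \<and> g \<in> Arr (Src u) \<and>
      Dom (Src u) g = fst x \<and> Cod (Src u) g = fst y \<and>
      Comp (Tgt u) (MapA u g) (snd x) = snd y}
    (\<lambda>(x, g, y). x) (\<lambda>(x, g, y). y) (\<lambda>x. (x, Id (Src u) (fst x), x))
    (\<lambda>(x', g', y') (x, g, y). (x, Comp (Src u) g' g, y'))"

section \<open>Small categories\<close>

text \<open>The universe of small categories is given by an infinite type \<open>'u\<close>: a set is small if it has
  fewer elements than \<open>'u\<close>, and the objects and arrows of small categories are taken from \<open>'u\<close>.
  If \<open>'u\<close> has the cardinality of a Grothendieck universe, then these are, up to isomorphism,
  exactly the small categories with respect to that universe; no closure property of \<open>'u\<close> beyond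
  infinity is needed for the constructions below.\<close>

type_synonym 'u small_category = "('u, 'u) category"
type_synonym 'u small_functor = "('u, 'u, 'u, 'u) cat_functor"
type_synonym 'u small_nat_transf = "('u, 'u, 'u, 'u) nat_transf"

definition small_cat :: "'u small_category \<Rightarrow> bool" where
  "small_cat C \<longleftrightarrow> is_category C \<and> Obj C \<prec> (UNIV :: 'u set) \<and> Arr C \<prec> (UNIV :: 'u set)"

definition small_fun :: "'u small_functor \<Rightarrow> bool" where
  "small_fun F \<longleftrightarrow> is_functor F \<and> small_cat (Src F) \<and> small_cat (Tgt F)"

definition small_nat :: "'u small_nat_transf \<Rightarrow> bool" where
  "small_nat \<alpha> \<longleftrightarrow> is_nat_transf \<alpha> \<and> small_fun (DomF \<alpha>) \<and> small_fun (CodF \<alpha>)"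

text \<open>The constructions above lead to other types, such as \<open>'u \<times> 'u\<close>. Their results are carried
  back to \<open>'u\<close> along a fixed injection, which exists for all types used below because \<open>'u\<close> is
  infinite. \<open>encF C\<close> and \<open>decF C\<close> are the mutually inverse isomorphisms between \<open>C\<close> and its
  copy \<open>encode C\<close>.\<close>

definition enc :: "'x \<Rightarrow> 'u" where
  "enc = (SOME f. inj f)"

definition encode :: "('o, 'a) category \<Rightarrow> 'u small_category" where
  "encode C = mk_category (enc ` Obj C) (enc ` Arr C)
    (\<lambda>f. enc (Dom C (inv enc f)))
    (\<lambda>f. enc (Cod C (inv enc f)))
    (\<lambda>x. enc (Id C (inv enc x)))
    (\<lambda>g f. enc (Comp C (inv enc g) (inv enc f)))"

definition encF :: "('o, 'a) category \<Rightarrow> ('o, 'a, 'u, 'u) cat_functor" where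
  "encF C = mk_functor C (encode C) enc enc"

definition decF :: "('o, 'a) category \<Rightarrow> ('u, 'u, 'o, 'a) cat_functor" where
  "decF C = mk_functor (encode C) C (inv enc) (inv enc)"

definition terminal :: "'u small_category" where
  "terminal = encode unit_cat"

definition empty :: "'u small_category" where
  "empty = mk_category {} {} undefined undefined undefined undefined"

definition to_terminal :: "'u small_category \<Rightarrow> 'u small_functor" where
  "to_terminal C = mk_functor C terminal (\<lambda>_. enc ()) (\<lambda>_. enc ())"

definition point :: "'u small_category \<Rightarrow> 'u \<Rightarrow> 'u small_functor" where
  "point K k = mk_functor terminal K (\<lambda>_. k) (\<lambda>_. Id K k)"

definition times :: "'u small_category \<Rightarrow> 'u small_category \<Rightarrow> 'u small_category"
    (infixl "\<otimes>" 80) where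
  "M \<otimes> K = encode (prod_cat M K)"

definition timesF :: "'u small_functor \<Rightarrow> 'u small_functor \<Rightarrow> 'u small_functor"
    (infixl "\<otimes>\<^sub>F" 80) where
  "v \<otimes>\<^sub>F u = encF (prod_cat (Tgt v) (Tgt u)) \<odot>
    (prod_functor v u \<odot> decF (prod_cat (Src v) (Src u)))"

definition timesN :: "'u small_nat_transf \<Rightarrow> 'u small_nat_transf \<Rightarrow> 'u small_nat_transf"
    (infixl "\<otimes>\<^sub>N" 80) where
  "\<beta> \<otimes>\<^sub>N \<alpha> = idN (encF (prod_cat (Tgt (DomF \<beta>)) (Tgt (DomF \<alpha>)))) \<star>
    (prod_nat \<beta> \<alpha> \<star> idN (decF (prod_cat (Src (DomF \<beta>)) (Src (DomF \<alpha>)))))"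

definition left_unitor :: "'u small_category \<Rightarrow> 'u small_functor" where
  "left_unitor K = encF (prod_cat terminal K) \<odot> pairing (to_terminal K) (idF K)"

definition coprod :: "'u small_category \<Rightarrow> 'u small_category \<Rightarrow> 'u small_category" where
  "coprod J1 J2 = encode (sum_cat J1 J2)"

definition incl1 :: "'u small_category \<Rightarrow> 'u small_category \<Rightarrow> 'u small_functor" where
  "incl1 J1 J2 = encF (sum_cat J1 J2) \<odot> mk_functor J1 (sum_cat J1 J2) Inl Inl"

definition incl2 :: "'u small_category \<Rightarrow> 'u small_category \<Rightarrow> 'u small_functor" where
  "incl2 J1 J2 = encF (sum_cat J1 J2) \<odot> mk_functor J2 (sum_cat J1 J2) Inr Inr"

definition over :: "'u small_functor \<Rightarrow> 'u \<Rightarrow> 'u small_category" where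
  "over u k = encode (over_cat u k)"

definition over_pr :: "'u small_functor \<Rightarrow> 'u \<Rightarrow> 'u small_functor" where
  "over_pr u k = mk_functor (over_cat u k) (Src u) fst (\<lambda>(x, g, y). g) \<odot> decF (over_cat u k)"

definition over_cell :: "'u small_functor \<Rightarrow> 'u \<Rightarrow> 'u small_nat_transf" where
  "over_cell u k = mk_nat (u \<odot> over_pr u k) (point (Tgt u) k \<odot> to_terminal (over u k))
    (\<lambda>x. snd (inv enc x :: 'u \<times> 'u))"

definition under :: "'u small_functor \<Rightarrow> 'u \<Rightarrow> 'u small_category" where
  "under u k = encode (under_cat u k)"

definition under_pr :: "'u small_functor \<Rightarrow> 'u \<Rightarrow> 'u small_functor" where
  "under_pr u k = mk_functor (under_cat u k) (Src u) fst (\<lambda>(x, g, y). g) \<odot> decF (under_cat u k)"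

definition under_cell :: "'u small_functor \<Rightarrow> 'u \<Rightarrow> 'u small_nat_transf" where
  "under_cell u k = mk_nat (point (Tgt u) k \<odot> to_terminal (under u k)) (u \<odot> under_pr u k)
    (\<lambda>x. snd (inv enc x :: 'u \<times> 'u))"

section \<open>Derivators\<close>

text \<open>\<open>D0\<close>, \<open>D1\<close>, \<open>D2\<close> are the actions on small categories, functors and natural transformations.
  The categories \<open>D0 D K\<close> need not be small: \<open>'o\<close> and \<open>'a\<close> are arbitrary types.\<close>

record ('u, 'o, 'a) prederivator =
  D0 :: "'u small_category \<Rightarrow> ('o, 'a) category"
  D1 :: "'u small_functor \<Rightarrow> ('o, 'a, 'o, 'a) cat_functor"
  D2 :: "'u small_nat_transf \<Rightarrow> ('o, 'a, 'o, 'a) nat_transf"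

locale is_prederivator =
  fixes D :: "('u, 'o, 'a) prederivator"
  assumes D0_category: "small_cat K \<Longrightarrow> is_category (D0 D K)"
    and D1_functor: "small_fun u \<Longrightarrow> is_functor (D1 D u)"
    and D1_Src: "small_fun u \<Longrightarrow> Src (D1 D u) = D0 D (Tgt u)"
    and D1_Tgt: "small_fun u \<Longrightarrow> Tgt (D1 D u) = D0 D (Src u)"
    and D2_nat_trans: "small_nat \<alpha> \<Longrightarrow> nat_trans (D2 D \<alpha>) (D1 D (DomF \<alpha>)) (D1 D (CodF \<alpha>))"
    and D1_idF: "small_cat K \<Longrightarrow> D1 D (idF K) = idF (D0 D K)"
    and D1_compF: "\<lbrakk>small_fun v; small_fun u; Src v = Tgt u\<rbrakk> \<Longrightarrow> D1 D (v \<odot> u) = D1 D u \<odot> D1 D v"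
    and D2_idN: "small_fun u \<Longrightarrow> D2 D (idN u) = idN (D1 D u)"
    and D2_vcomp: "\<lbrakk>small_nat \<beta>; small_nat \<alpha>; DomF \<beta> = CodF \<alpha>\<rbrakk>
      \<Longrightarrow> D2 D (\<beta> \<bullet> \<alpha>) = D2 D \<beta> \<bullet> D2 D \<alpha>"
    and D2_hcomp: "\<lbrakk>small_nat \<beta>; small_nat \<alpha>; Src (DomF \<beta>) = Tgt (DomF \<alpha>)\<rbrakk>
      \<Longrightarrow> D2 D (\<beta> \<star> \<alpha>) = D2 D \<alpha> \<star> D2 D \<beta>"

text \<open>The base change maps \<open>p\<^sub>! pr\<^sup>* \<rightarrow> k\<^sup>* u\<^sub>!\<close> and \<open>k\<^sup>* u\<^sub>* \<rightarrow> p\<^sub>* pr\<^sup>*\<close>, for given choices of the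
  adjoints: \<open>u_l\<close>, \<open>u_r\<close> are adjoint to \<open>u\<^sup>*\<close> and \<open>p_l\<close>, \<open>p_r\<close> are adjoint to \<open>p\<^sup>*\<close>. Since adjoints are
  unique up to unique isomorphism compatible with units and counits, it does not depend on the
  choices whether these maps are isomorphisms.\<close>

definition base_change_left ::
    "('u, 'o, 'a) prederivator \<Rightarrow> 'u small_functor \<Rightarrow> 'u \<Rightarrow>
     ('o, 'a, 'o, 'a) cat_functor \<Rightarrow> ('o, 'a, 'o, 'a) nat_transf \<Rightarrow>
     ('o, 'a, 'o, 'a) cat_functor \<Rightarrow> ('o, 'a, 'o, 'a) nat_transf \<Rightarrow> ('o, 'a, 'o, 'a) nat_transf" where
  "base_change_left D u k u_l \<eta> p_l \<epsilon> =
    (\<epsilon> \<star> idN (D1 D (point (Tgt u) k) \<odot> u_l)) \<bullet>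
    (idN p_l \<star> D2 D (over_cell u k) \<star> idN u_l) \<bullet>
    (idN (p_l \<odot> D1 D (over_pr u k)) \<star> \<eta>)"

definition base_change_right ::
    "('u, 'o, 'a) prederivator \<Rightarrow> 'u small_functor \<Rightarrow> 'u \<Rightarrow>
     ('o, 'a, 'o, 'a) cat_functor \<Rightarrow> ('o, 'a, 'o, 'a) nat_transf \<Rightarrow>
     ('o, 'a, 'o, 'a) cat_functor \<Rightarrow> ('o, 'a, 'o, 'a) nat_transf \<Rightarrow> ('o, 'a, 'o, 'a) nat_transf" where
  "base_change_right D u k u_r \<epsilon> p_r \<eta> =
    (idN (p_r \<odot> D1 D (under_pr u k)) \<star> \<epsilon>) \<bullet>
    (idN p_r \<star> D2 D (under_cell u k) \<star> idN u_r) \<bullet>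
    (\<eta> \<star> idN (D1 D (point (Tgt u) k) \<odot> u_r))"

locale derivator = is_prederivator D for D :: "('u, 'o, 'a) prederivator" +
  assumes Der1_coprod: "\<lbrakk>small_cat J1; small_cat J2\<rbrakk>
      \<Longrightarrow> equivalence (pairing (D1 D (incl1 J1 J2)) (D1 D (incl2 J1 J2)))"
    and Der1_empty: "Obj (D0 D empty) \<noteq> {}"
    and Der2: "\<lbrakk>small_cat J; f \<in> Arr (D0 D J)\<rbrakk>
      \<Longrightarrow> iso_arr (D0 D J) f \<longleftrightarrow> (\<forall>j\<in>Obj J. iso_arr (D0 D terminal) (MapA (D1 D (point J j)) f))"
    and Der3_left: "small_fun u \<Longrightarrow> has_left_adjoint (D1 D u)"
    and Der3_right: "small_fun u \<Longrightarrow> has_right_adjoint (D1 D u)"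
    and Der4_left: "\<lbrakk>small_fun u; k \<in> Obj (Tgt u); adjunction u_l (D1 D u) \<eta> \<epsilon>;
        adjunction p_l (D1 D (to_terminal (over u k))) \<eta>' \<epsilon>'\<rbrakk>
      \<Longrightarrow> nat_iso (base_change_left D u k u_l \<eta> p_l \<epsilon>')
            (p_l \<odot> D1 D (over_pr u k)) (D1 D (point (Tgt u) k) \<odot> u_l)"
    and Der4_right: "\<lbrakk>small_fun u; k \<in> Obj (Tgt u); adjunction (D1 D u) u_r \<eta> \<epsilon>;
        adjunction (D1 D (to_terminal (under u k))) p_r \<eta>' \<epsilon>'\<rbrakk>
      \<Longrightarrow> nat_iso (base_change_right D u k u_r \<epsilon> p_r \<eta>')
            (D1 D (point (Tgt u) k) \<odot> u_r) (p_r \<odot> D1 D (under_pr u k))"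

definition shift :: "('u, 'o, 'a) prederivator \<Rightarrow> 'u small_category \<Rightarrow> ('u, 'o, 'a) prederivator" where
  "shift D M = \<lparr>D0 = (\<lambda>K. D0 D (M \<otimes> K)),
                D1 = (\<lambda>u. D1 D (idF M \<otimes>\<^sub>F u)),
                D2 = (\<lambda>\<alpha>. D2 D (idN (idF M) \<otimes>\<^sub>N \<alpha>))\<rparr>"

section \<open>Morphisms of derivators\<close>

text \<open>\<open>Fun F J\<close> is the component at \<open>J\<close>, and \<open>Coh F u\<close> is the coherence isomorphism
  \<open>\<gamma>\<^sub>u : u\<^sup>* F\<^sub>K \<rightarrow> F\<^sub>J u\<^sup>*\<close>.\<close>

record ('u, 'o, 'a, 'p, 'b) morphism =
  Fun :: "'u small_category \<Rightarrow> ('o, 'a, 'p, 'b) cat_functor"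
  Coh :: "'u small_functor \<Rightarrow> ('o, 'a, 'p, 'b) nat_transf"

locale pseudonatural = D: is_prederivator D + D': is_prederivator D'
  for D :: "('u, 'o, 'a) prederivator" and D' :: "('u, 'p, 'b) prederivator" +
  fixes F :: "('u, 'o, 'a, 'p, 'b) morphism"
  assumes Fun_functor: "small_cat J \<Longrightarrow> is_functor (Fun F J)"
    and Fun_Src: "small_cat J \<Longrightarrow> Src (Fun F J) = D0 D J"
    and Fun_Tgt: "small_cat J \<Longrightarrow> Tgt (Fun F J) = D0 D' J"
    and Coh_nat_iso: "small_fun u
      \<Longrightarrow> nat_iso (Coh F u) (D1 D' u \<odot> Fun F (Tgt u)) (Fun F (Src u) \<odot> D1 D u)"
    and Coh_idF: "small_cat K \<Longrightarrow> Coh F (idF K) = idN (Fun F K)"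
    and Coh_compF: "\<lbrakk>small_fun v; small_fun u; Src v = Tgt u\<rbrakk>
      \<Longrightarrow> Coh F (v \<odot> u) = (Coh F u \<star> idN (D1 D v)) \<bullet> (idN (D1 D' u) \<star> Coh F v)"
    and Coh_natural: "small_nat \<alpha>
      \<Longrightarrow> (idN (Fun F (Src (DomF \<alpha>))) \<star> D2 D \<alpha>) \<bullet> Coh F (DomF \<alpha>) =
          Coh F (CodF \<alpha>) \<bullet> (D2 D' \<alpha> \<star> idN (Fun F (Tgt (DomF \<alpha>))))"

text \<open>As for (Der4), the choice of adjoints does not matter. That adjoints exist at all, which is
  automatic between derivators, is made part of the definition.\<close>

definition preserves_left_Kan ::
    "('u, 'o, 'a) prederivator \<Rightarrow> ('u, 'p, 'b) prederivator \<Rightarrow> ('u, 'o, 'a, 'p, 'b) morphism \<Rightarrow>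
     'u small_functor \<Rightarrow> bool" where
  "preserves_left_Kan D D' F u \<longleftrightarrow>
    has_left_adjoint (D1 D u) \<and> has_left_adjoint (D1 D' u) \<and>
    (\<forall>l \<eta> \<epsilon> l' \<eta>' \<epsilon>'. adjunction l (D1 D u) \<eta> \<epsilon> \<longrightarrow> adjunction l' (D1 D' u) \<eta>' \<epsilon>' \<longrightarrow>
      nat_iso
        ((\<epsilon>' \<star> idN (Fun F (Tgt u) \<odot> l)) \<bullet>
         (idN l' \<star> invN (Coh F u) \<star> idN l) \<bullet>
         (idN (l' \<odot> Fun F (Src u)) \<star> \<eta>))
        (l' \<odot> Fun F (Src u)) (Fun F (Tgt u) \<odot> l))"

definition preserves_right_Kan ::
    "('u, 'o, 'a) prederivator \<Rightarrow> ('u, 'p, 'b) prederivator \<Rightarrow> ('u, 'o, 'a, 'p, 'b) morphism \<Rightarrow>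
     'u small_functor \<Rightarrow> bool" where
  "preserves_right_Kan D D' F u \<longleftrightarrow>
    has_right_adjoint (D1 D u) \<and> has_right_adjoint (D1 D' u) \<and>
    (\<forall>r \<eta> \<epsilon> r' \<eta>' \<epsilon>'. adjunction (D1 D u) r \<eta> \<epsilon> \<longrightarrow> adjunction (D1 D' u) r' \<eta>' \<epsilon>' \<longrightarrow>
      nat_iso
        ((idN (r' \<odot> Fun F (Src u)) \<star> \<epsilon>) \<bullet>
         (idN r' \<star> Coh F u \<star> idN r) \<bullet>
         (\<eta>' \<star> idN (Fun F (Tgt u) \<odot> r)))
        (Fun F (Tgt u) \<odot> r) (r' \<odot> Fun F (Src u)))"

text \<open>The morphism with the given components and identity coherence isomorphisms.\<close>

definition strict_morphism ::
    "('u, 'p, 'b) prederivator \<Rightarrow> ('u small_category \<Rightarrow> ('o, 'a, 'p, 'b) cat_functor) \<Rightarrow>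
     ('u, 'o, 'a, 'p, 'b) morphism" where
  "strict_morphism D' G = \<lparr>Fun = G, Coh = (\<lambda>u. idN (D1 D' u \<odot> G (Tgt u)))\<rparr>"

definition pullback :: "('u, 'o, 'a) prederivator \<Rightarrow> 'u small_functor \<Rightarrow> ('u, 'o, 'a, 'o, 'a) morphism" where
  "pullback D v = strict_morphism (shift D (Src v)) (\<lambda>K. D1 D (v \<otimes>\<^sub>F idF K))"

text \<open>Evaluation at \<open>m\<close> is the pullback along \<open>m : e \<rightarrow> M\<close> followed by the isomorphism from
  \<open>shift D e\<close> to \<open>D\<close> given by restriction along \<open>K \<cong> e \<times> K\<close>.\<close>

definition evaluation ::
    "('u, 'o, 'a) prederivator \<Rightarrow> 'u small_category \<Rightarrow> 'u \<Rightarrow> ('u, 'o, 'a, 'o, 'a) morphism" where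
  "evaluation D M m =
    strict_morphism D (\<lambda>K. D1 D (left_unitor K) \<odot> Fun (pullback D (point M m)) K)"

end

theory Submission
  imports Defs
begin

text \<open>
  The statement is about mates of identity squares, but the argument takes place at the level of
  universal arrows. If \<open>l\<close> is left adjoint to \<open>u\<^sup>*\<close>, then \<open>\<eta> X : X \<rightarrow> u\<^sup>* (l X)\<close> is universal from \<open>X\<close>
  to \<open>u\<^sup>*\<close>, and an arrow \<open>f : X \<rightarrow> u\<^sup>* Y\<close> is universal if and only if its transpose \<open>l X \<rightarrow> Y\<close> is
  invertible. The mate of a morphism \<open>G\<close> with identity coherence is, at \<open>X\<close>, the transpose of
  \<open>G (\<eta> X)\<close>. So \<open>G\<close> preserves left Kan extensions if it carries the universal arrows \<open>\<eta> X\<close> to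
  universal arrows. In the same way (Der4) says that
  \<open>\<eta> X\<close>, restricted to the slice of \<open>u\<close> over \<open>k\<close> and composed with the comma cell, is universal from
  \<open>pr\<^sup>* X\<close> to the constant diagrams, with value \<open>k\<^sup>* (l X)\<close>.

  Evaluation at an object \<open>m\<close> of \<open>M\<close> is restriction along \<open>J \<rightarrow> M \<times> J\<close>, \<open>j \<mapsto> (m, j)\<close>. For \<open>X\<close> in
  \<open>D (M \<times> J)\<close> compare the universal arrow from \<open>m\<^sup>* X\<close> to \<open>u\<^sup>*\<close> with \<open>m\<^sup>* (\<eta> X)\<close>. By (Der2) it is enough to
  compare the values at every \<open>k\<close> in \<open>K\<close>. By (Der4) the value of the former is universal for diagrams
  on the slice of \<open>u\<close> over \<open>k\<close>, and the value of the latter is universal for diagrams on the slice of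
  \<open>id \<times> u\<close> over \<open>(m, k)\<close>. The objects of the second slice are pairs of arrows \<open>m' \<rightarrow> m\<close> and \<open>u j \<rightarrow> k\<close>;
  those whose first component is \<open>id\<close> form a copy of the first slice, and this copy is a reflective
  subcategory, because \<open>id\<close> is terminal over \<open>m\<close>. Restriction along the right adjoint of a
  reflection preserves universal arrows to constant diagrams (\<open>universal_arrow_section\<close>; this is the
  instance of homotopy finality that is needed). Hence both values solve the same universal problem
  (\<open>insertion_universal_arrow\<close>).

  For a general functor \<open>v : L \<rightarrow> M\<close>, evaluation at \<open>x\<close> after \<open>v\<^sup>*\<close> is evaluation at \<open>v x\<close>. Both this
  evaluation and the evaluation at \<open>x\<close> on \<open>D\<^sup>L\<close> preserve the universal arrows, and the evaluations at
  all \<open>x\<close> in \<open>L\<close> detect isomorphisms together, so that \<open>v\<^sup>*\<close> preserves them, too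
  (\<open>pullback_universal_arrow\<close>). Both comparisons are instances of one lemma,
  \<open>universal_arrow_pointwise\<close>.

  Right Kan extensions are treated by replacing every category \<open>D K\<close> by its opposite while the shapes
  \<open>K\<close> are kept. The abstract lemmas on universal arrows then apply as they stand, and only the slices
  over an object have to be exchanged for the slices under an object.
\<close>

section \<open>Functors and natural transformations as extensional records\<close>

lemma mk_category_simps [simp]:
  "Obj (mk_category X A d c i m) = X"
  "Arr (mk_category X A d c i m) = A"
  "f \<in> A \<Longrightarrow> Dom (mk_category X A d c i m) f = d f"
  "f \<in> A \<Longrightarrow> Cod (mk_category X A d c i m) f = c f"
  "x \<in> X \<Longrightarrow> Id (mk_category X A d c i m) x = i x"
  "\<lbrakk>g \<in> A; f \<in> A; d g = c f\<rbrakk> \<Longrightarrow> Comp (mk_category X A d c i m) g f = m g f"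
  by (auto simp: mk_category_def)

lemma is_category_mk:
  assumes "\<And>f. f \<in> A \<Longrightarrow> d f \<in> X \<and> c f \<in> X"
    and "\<And>x. x \<in> X \<Longrightarrow> i x \<in> A \<and> d (i x) = x \<and> c (i x) = x"
    and "\<And>g f. \<lbrakk>g \<in> A; f \<in> A; d g = c f\<rbrakk> \<Longrightarrow> m g f \<in> A \<and> d (m g f) = d f \<and> c (m g f) = c g"
    and "\<And>f. f \<in> A \<Longrightarrow> m f (i (d f)) = f \<and> m (i (c f)) f = f"
    and "\<And>h g f. \<lbrakk>h \<in> A; g \<in> A; f \<in> A; d h = c g; d g = c f\<rbrakk> \<Longrightarrow> m h (m g f) = m (m h g) f"
  shows "is_category (mk_category X A d c i m)"
  by unfold_locales (use assms in \<open>auto simp: mk_category_def\<close>)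

lemma mk_functor_simps [simp]:
  "Src (mk_functor A B fo fa) = A"
  "Tgt (mk_functor A B fo fa) = B"
  "x \<in> Obj A \<Longrightarrow> MapO (mk_functor A B fo fa) x = fo x"
  "f \<in> Arr A \<Longrightarrow> MapA (mk_functor A B fo fa) f = fa f"
  by (auto simp: mk_functor_def)

lemma is_functor_mk:
  assumes "is_category A" "is_category B"
    and "\<And>x. x \<in> Obj A \<Longrightarrow> fo x \<in> Obj B"
    and "\<And>f. f \<in> Arr A \<Longrightarrow> fa f \<in> Arr B \<and> Dom B (fa f) = fo (Dom A f) \<and> Cod B (fa f) = fo (Cod A f)"
    and "\<And>x. x \<in> Obj A \<Longrightarrow> fa (Id A x) = Id B (fo x)"
    and "\<And>g f. \<lbrakk>g \<in> Arr A; f \<in> Arr A; Dom A g = Cod A f\<rbrakk> \<Longrightarrow> fa (Comp A g f) = Comp B (fa g) (fa f)"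
  shows "is_functor (mk_functor A B fo fa)"
  by (rule is_functor.intro)
    (use assms in \<open>auto simp: mk_functor_def is_category.Dom_Obj is_category.Cod_Obj
      is_category.Id_Arr is_category.Comp_Arr\<close>)

lemma functor_eqI:
  assumes "is_functor F" "is_functor G" "Src F = Src G" "Tgt F = Tgt G"
    and "\<And>x. x \<in> Obj (Src G) \<Longrightarrow> MapO F x = MapO G x"
    and "\<And>f. f \<in> Arr (Src G) \<Longrightarrow> MapA F f = MapA G f"
  shows "F = G"
proof -
  have "MapO F = MapO G"
    using assms is_functor.MapO_PiE[of F] is_functor.MapO_PiE[of G]
    by (metis PiE_ext)
  moreover have "MapA F = MapA G"
    using assms is_functor.MapA_PiE[of F] is_functor.MapA_PiE[of G]
    by (metis PiE_ext)
  ultimately show ?thesis using assms(3,4) by simp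
qed

text \<open>The premises of the form \<open>Tgt F = B\<close> let the simplifier use these rules after it has
  evaluated sources and targets.\<close>

lemma category_simps [simp]:
  assumes "is_category C"
  shows "f \<in> Arr C \<Longrightarrow> Dom C f \<in> Obj C"
    and "f \<in> Arr C \<Longrightarrow> Cod C f \<in> Obj C"
    and "x \<in> Obj C \<Longrightarrow> Id C x \<in> Arr C"
    and "x \<in> Obj C \<Longrightarrow> Dom C (Id C x) = x"
    and "x \<in> Obj C \<Longrightarrow> Cod C (Id C x) = x"
    and "\<lbrakk>g \<in> Arr C; f \<in> Arr C; Dom C g = Cod C f\<rbrakk> \<Longrightarrow> Comp C g f \<in> Arr C"
    and "\<lbrakk>g \<in> Arr C; f \<in> Arr C; Dom C g = Cod C f\<rbrakk> \<Longrightarrow> Dom C (Comp C g f) = Dom C f"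
    and "\<lbrakk>g \<in> Arr C; f \<in> Arr C; Dom C g = Cod C f\<rbrakk> \<Longrightarrow> Cod C (Comp C g f) = Cod C g"
    and "\<lbrakk>f \<in> Arr C; Dom C f = x\<rbrakk> \<Longrightarrow> Comp C f (Id C x) = f"
    and "\<lbrakk>f \<in> Arr C; Cod C f = x\<rbrakk> \<Longrightarrow> Comp C (Id C x) f = f"
  using assms by (auto simp: is_category_def)

lemma functor_simps [simp]:
  assumes "is_functor F"
  shows "is_category (Src F)"
    and "is_category (Tgt F)"
    and "\<lbrakk>Tgt F = B; x \<in> Obj (Src F)\<rbrakk> \<Longrightarrow> MapO F x \<in> Obj B"
    and "\<lbrakk>Tgt F = B; f \<in> Arr (Src F)\<rbrakk> \<Longrightarrow> MapA F f \<in> Arr B"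
    and "\<lbrakk>Tgt F = B; f \<in> Arr (Src F)\<rbrakk> \<Longrightarrow> Dom B (MapA F f) = MapO F (Dom (Src F) f)"
    and "\<lbrakk>Tgt F = B; f \<in> Arr (Src F)\<rbrakk> \<Longrightarrow> Cod B (MapA F f) = MapO F (Cod (Src F) f)"
    and "\<lbrakk>Src F = A; x \<in> Obj A\<rbrakk> \<Longrightarrow> MapA F (Id A x) = Id (Tgt F) (MapO F x)"
    and "\<lbrakk>Src F = A; g \<in> Arr A; f \<in> Arr A; Dom A g = Cod A f\<rbrakk>
      \<Longrightarrow> MapA F (Comp A g f) = Comp (Tgt F) (MapA F g) (MapA F f)"
  using assms
  by (auto simp: is_functor.Src_category is_functor.Tgt_category is_functor.MapA_Dom
      is_functor.MapA_Cod is_functor.MapA_Id is_functor.MapA_Comp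
      dest: is_functor.MapO_PiE is_functor.MapA_PiE)

lemma idF_simps [simp]:
  "Src (idF C) = C" "Tgt (idF C) = C"
  "x \<in> Obj C \<Longrightarrow> MapO (idF C) x = x" "f \<in> Arr C \<Longrightarrow> MapA (idF C) f = f"
  by (auto simp: idF_def)

lemma is_functor_idF [simp]: "is_category C \<Longrightarrow> is_functor (idF C)"
  unfolding idF_def by (rule is_functor_mk) auto

lemma compF_simps [simp]:
  "Src (G \<odot> F) = Src F" "Tgt (G \<odot> F) = Tgt G"
  "x \<in> Obj (Src F) \<Longrightarrow> MapO (G \<odot> F) x = MapO G (MapO F x)"
  "f \<in> Arr (Src F) \<Longrightarrow> MapA (G \<odot> F) f = MapA G (MapA F f)"
  by (auto simp: compF_def)

lemma is_functor_compF [simp]: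
  assumes "is_functor G" "is_functor F" "Src G = Tgt F"
  shows "is_functor (G \<odot> F)"
  unfolding compF_def by (rule is_functor_mk) (use assms in auto)

lemma compF_assoc:
  assumes "is_functor H" "is_functor G" "is_functor F" "Src H = Tgt G" "Src G = Tgt F"
  shows "H \<odot> G \<odot> F = H \<odot> (G \<odot> F)"
  by (rule functor_eqI) (use assms in auto)

lemma compF_idF [simp]:
  assumes "is_functor F"
  shows "Src F = A \<Longrightarrow> F \<odot> idF A = F" and "Tgt F = B \<Longrightarrow> idF B \<odot> F = F"
  by (rule functor_eqI; use assms in auto)+

lemma mk_nat_simps [simp]:
  "DomF (mk_nat F G t) = F" "CodF (mk_nat F G t) = G"
  "x \<in> Obj (Src F) \<Longrightarrow> At (mk_nat F G t) x = t x"
  by (auto simp: mk_nat_def)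

lemma nat_transf_simps [simp]:
  assumes "is_nat_transf \<alpha>"
  shows "is_functor (DomF \<alpha>)"
    and "is_functor (CodF \<alpha>)"
    and "Src (CodF \<alpha>) = Src (DomF \<alpha>)"
    and "Tgt (CodF \<alpha>) = Tgt (DomF \<alpha>)"
    and "\<lbrakk>Tgt (DomF \<alpha>) = B; x \<in> Obj (Src (DomF \<alpha>))\<rbrakk> \<Longrightarrow> At \<alpha> x \<in> Arr B"
    and "\<lbrakk>Tgt (DomF \<alpha>) = B; x \<in> Obj (Src (DomF \<alpha>))\<rbrakk> \<Longrightarrow> Dom B (At \<alpha> x) = MapO (DomF \<alpha>) x"
    and "\<lbrakk>Tgt (DomF \<alpha>) = B; x \<in> Obj (Src (DomF \<alpha>))\<rbrakk> \<Longrightarrow> Cod B (At \<alpha> x) = MapO (CodF \<alpha>) x"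
  using assms
  by (auto simp: is_nat_transf.At_Dom is_nat_transf.At_Cod is_nat_transf.DomF_functor
      is_nat_transf.CodF_functor is_nat_transf.Src_eq is_nat_transf.Tgt_eq dest: is_nat_transf.At_PiE)

lemma nat_trans_mk:
  assumes "is_functor F" "is_functor G" "Src G = Src F" "Tgt G = Tgt F"
    and "\<And>x. x \<in> Obj (Src F) \<Longrightarrow>
      t x \<in> Arr (Tgt F) \<and> Dom (Tgt F) (t x) = MapO F x \<and> Cod (Tgt F) (t x) = MapO G x"
    and "\<And>f. f \<in> Arr (Src F) \<Longrightarrow>
      Comp (Tgt F) (MapA G f) (t (Dom (Src F) f)) = Comp (Tgt F) (t (Cod (Src F) f)) (MapA F f)"
  shows "nat_trans (mk_nat F G t) F G"
  unfolding nat_trans_def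
  by (intro conjI, rule is_nat_transf.intro) (use assms in \<open>auto simp: mk_nat_def\<close>)

lemma nat_eqI:
  assumes "is_nat_transf \<alpha>" "is_nat_transf \<beta>" "DomF \<alpha> = DomF \<beta>" "CodF \<alpha> = CodF \<beta>"
    and "\<And>x. x \<in> Obj (Src (DomF \<beta>)) \<Longrightarrow> At \<alpha> x = At \<beta> x"
  shows "\<alpha> = \<beta>"
proof -
  have "At \<alpha> = At \<beta>"
    using assms is_nat_transf.At_PiE[of \<alpha>] is_nat_transf.At_PiE[of \<beta>]
    by (metis PiE_ext)
  then show ?thesis using assms(3,4) by simp
qed

lemma nat_trans_simps:
  assumes "nat_trans \<alpha> F G"
  shows "is_nat_transf \<alpha>" "DomF \<alpha> = F" "CodF \<alpha> = G" "is_functor F" "is_functor G"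
    "Src G = Src F" "Tgt G = Tgt F"
  using assms by (auto simp: nat_trans_def)

lemma comp_assoc:
  assumes "is_category C" "h \<in> Arr C" "g \<in> Arr C" "f \<in> Arr C" "Dom C h = Cod C g" "Dom C g = Cod C f"
  shows "Comp C (Comp C h g) f = Comp C h (Comp C g f)"
  using is_category.Comp_assoc[OF assms] by simp

lemma nat_trans_idN: "is_functor F \<Longrightarrow> nat_trans (idN F) F F"
  unfolding idN_def by (rule nat_trans_mk) auto

lemma idN_simps [simp]:
  "DomF (idN F) = F" "CodF (idN F) = F"
  "x \<in> Obj (Src F) \<Longrightarrow> At (idN F) x = Id (Tgt F) (MapO F x)"
  "is_functor F \<Longrightarrow> is_nat_transf (idN F)"
  using nat_trans_idN[of F] by (auto simp: idN_def nat_trans_def)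

lemma nat_trans_vcomp:
  assumes "nat_trans \<beta> G H" "nat_trans \<alpha> F G"
  shows "nat_trans (\<beta> \<bullet> \<alpha>) F H"
proof -
  note [simp] = nat_trans_simps[OF assms(1)] nat_trans_simps[OF assms(2)]
  show ?thesis unfolding vcomp_def
  proof (subst (1 2) nat_trans_simps(2,3)[OF assms(2)], subst nat_trans_simps(3)[OF assms(1)],
      rule nat_trans_mk, simp_all, goal_cases)
    case (1 f)
    show ?case
      using 1 is_nat_transf.naturality[of \<alpha> f] is_nat_transf.naturality[of \<beta> f]
      by (simp add: comp_assoc[symmetric]) (simp add: comp_assoc)
  qed
qed

lemma nat_trans_hcomp:
  assumes "nat_trans \<beta> H K" "nat_trans \<alpha> F G" "Src H = Tgt F"
  shows "nat_trans (\<beta> \<star> \<alpha>) (H \<odot> F) (K \<odot> G)"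
proof -
  note b = nat_trans_simps[OF assms(1)] and a = nat_trans_simps[OF assms(2)]
  note [simp] = a(1,4-) b(1,4-) assms(3)
  have "nat_trans (mk_nat (H \<odot> F) (K \<odot> G) (\<lambda>x. Comp (Tgt H) (At \<beta> (MapO G x)) (MapA H (At \<alpha> x))))
    (H \<odot> F) (K \<odot> G)"
  proof (rule nat_trans_mk, simp_all add: a(2,3) b(2,3), goal_cases)
    case (1 f)
    have n\<beta>: "Comp (Tgt H) (MapA K (MapA G f)) (At \<beta> (MapO G (Dom (Src F) f))) =
        Comp (Tgt H) (At \<beta> (MapO G (Cod (Src F) f))) (MapA H (MapA G f))"
      using is_nat_transf.naturality[of \<beta> "MapA G f"] 1 by (simp add: b(2,3))
    have "Comp (Tgt H) (MapA H (MapA G f)) (MapA H (At \<alpha> (Dom (Src F) f))) =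
        Comp (Tgt H) (MapA H (At \<alpha> (Cod (Src F) f))) (MapA H (MapA F f))"
      using is_nat_transf.naturality[of \<alpha> f] functor_simps(8)[of H "Tgt F"] 1
      by (simp add: a(2,3) b(2,3) del: functor_simps(8)) (simp flip: functor_simps(8) add: a(2,3))
    with n\<beta> show ?case
      using 1 by (simp add: a(2,3) b(2,3) comp_assoc[symmetric]) (simp add: a(2,3) b(2,3) comp_assoc)
  qed
  then show ?thesis by (simp add: hcomp_def a(2,3) b(2,3))
qed

lemma vcomp_simps [simp]:
  "DomF (\<beta> \<bullet> \<alpha>) = DomF \<alpha>" "CodF (\<beta> \<bullet> \<alpha>) = CodF \<beta>"
  "x \<in> Obj (Src (DomF \<alpha>)) \<Longrightarrow> At (\<beta> \<bullet> \<alpha>) x = Comp (Tgt (DomF \<alpha>)) (At \<beta> x) (At \<alpha> x)"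
  "\<lbrakk>is_nat_transf \<beta>; is_nat_transf \<alpha>; DomF \<beta> = CodF \<alpha>\<rbrakk> \<Longrightarrow> is_nat_transf (\<beta> \<bullet> \<alpha>)"
  using nat_trans_vcomp[of \<beta> "DomF \<beta>" "CodF \<beta>" \<alpha> "DomF \<alpha>"] by (auto simp: vcomp_def nat_trans_def)

lemma hcomp_simps [simp]:
  "DomF (\<beta> \<star> \<alpha>) = DomF \<beta> \<odot> DomF \<alpha>" "CodF (\<beta> \<star> \<alpha>) = CodF \<beta> \<odot> CodF \<alpha>"
  "x \<in> Obj (Src (DomF \<alpha>)) \<Longrightarrow>
    At (\<beta> \<star> \<alpha>) x = Comp (Tgt (DomF \<beta>)) (At \<beta> (MapO (CodF \<alpha>) x)) (MapA (DomF \<beta>) (At \<alpha> x))"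
  "\<lbrakk>is_nat_transf \<beta>; is_nat_transf \<alpha>; Src (DomF \<beta>) = Tgt (DomF \<alpha>)\<rbrakk> \<Longrightarrow> is_nat_transf (\<beta> \<star> \<alpha>)"
  using nat_trans_hcomp[of \<beta> "DomF \<beta>" "CodF \<beta>" \<alpha> "DomF \<alpha>" "CodF \<alpha>"]
  by (auto simp: hcomp_def nat_trans_def)

lemma naturalityD:
  assumes "is_nat_transf \<alpha>" "f \<in> Arr (Src (DomF \<alpha>))"
    "Dom (Src (DomF \<alpha>)) f = x" "Cod (Src (DomF \<alpha>)) f = y"
  shows "Comp (Tgt (DomF \<alpha>)) (MapA (CodF \<alpha>) f) (At \<alpha> x) = Comp (Tgt (DomF \<alpha>)) (At \<alpha> y) (MapA (DomF \<alpha>) f)"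
  using is_nat_transf.naturality[of \<alpha> f] assms by simp

section \<open>Products and encodings of categories\<close>

lemma prod_cat_simps [simp]:
  "Obj (prod_cat C C') = Obj C \<times> Obj C'" "Arr (prod_cat C C') = Arr C \<times> Arr C'"
  "\<lbrakk>f \<in> Arr C; f' \<in> Arr C'\<rbrakk> \<Longrightarrow> Dom (prod_cat C C') (f, f') = (Dom C f, Dom C' f')"
  "\<lbrakk>f \<in> Arr C; f' \<in> Arr C'\<rbrakk> \<Longrightarrow> Cod (prod_cat C C') (f, f') = (Cod C f, Cod C' f')"
  "\<lbrakk>x \<in> Obj C; x' \<in> Obj C'\<rbrakk> \<Longrightarrow> Id (prod_cat C C') (x, x') = (Id C x, Id C' x')"
  "\<lbrakk>g \<in> Arr C; g' \<in> Arr C'; f \<in> Arr C; f' \<in> Arr C'; Dom C g = Cod C f; Dom C' g' = Cod C' f'\<rbrakk>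
    \<Longrightarrow> Comp (prod_cat C C') (g, g') (f, f') = (Comp C g f, Comp C' g' f')"
  by (auto simp: prod_cat_def)

lemma is_category_prod [simp]:
  assumes "is_category C" "is_category C'"
  shows "is_category (prod_cat C C')"
  unfolding prod_cat_def
  by (rule is_category_mk) (use assms in \<open>auto simp: comp_assoc\<close>)

lemma prod_functor_simps [simp]:
  "Src (prod_functor F F') = prod_cat (Src F) (Src F')"
  "Tgt (prod_functor F F') = prod_cat (Tgt F) (Tgt F')"
  "\<lbrakk>x \<in> Obj (Src F); x' \<in> Obj (Src F')\<rbrakk> \<Longrightarrow> MapO (prod_functor F F') (x, x') = (MapO F x, MapO F' x')"
  "\<lbrakk>f \<in> Arr (Src F); f' \<in> Arr (Src F')\<rbrakk> \<Longrightarrow> MapA (prod_functor F F') (f, f') = (MapA F f, MapA F' f')"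
  by (auto simp: prod_functor_def)

lemma is_functor_prod [simp]:
  "\<lbrakk>is_functor F; is_functor F'\<rbrakk> \<Longrightarrow> is_functor (prod_functor F F')"
  unfolding prod_functor_def by (rule is_functor_mk) auto

lemma nat_trans_prod:
  assumes "is_nat_transf \<alpha>" "is_nat_transf \<alpha>'"
  shows "nat_trans (prod_nat \<alpha> \<alpha>') (prod_functor (DomF \<alpha>) (DomF \<alpha>')) (prod_functor (CodF \<alpha>) (CodF \<alpha>'))"
  unfolding prod_nat_def
  by (rule nat_trans_mk)
    (use assms is_nat_transf.naturality[OF assms(1)] is_nat_transf.naturality[OF assms(2)] in auto)

lemma prod_nat_simps [simp]:
  "DomF (prod_nat \<alpha> \<alpha>') = prod_functor (DomF \<alpha>) (DomF \<alpha>')"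
  "CodF (prod_nat \<alpha> \<alpha>') = prod_functor (CodF \<alpha>) (CodF \<alpha>')"
  "\<lbrakk>x \<in> Obj (Src (DomF \<alpha>)); x' \<in> Obj (Src (DomF \<alpha>'))\<rbrakk> \<Longrightarrow> At (prod_nat \<alpha> \<alpha>') (x, x') = (At \<alpha> x, At \<alpha>' x')"
  "\<lbrakk>is_nat_transf \<alpha>; is_nat_transf \<alpha>'\<rbrakk> \<Longrightarrow> is_nat_transf (prod_nat \<alpha> \<alpha>')"
  using nat_trans_prod[of \<alpha> \<alpha>'] by (auto simp: prod_nat_def nat_trans_def)

lemma inj_enc: "\<exists>f :: 'x \<Rightarrow> 'u. inj f \<Longrightarrow> inj (enc :: 'x \<Rightarrow> 'u)"
  unfolding enc_def by (rule someI_ex[where P = inj])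

lemma encode_simps [simp]:
  fixes C :: "('o, 'a) category"
  assumes "inj (enc :: 'o \<Rightarrow> 'u)" "inj (enc :: 'a \<Rightarrow> 'u)"
  shows "Obj (encode C :: 'u small_category) = enc ` Obj C"
    and "Arr (encode C :: 'u small_category) = enc ` Arr C"
    and "f \<in> Arr C \<Longrightarrow> Dom (encode C :: 'u small_category) (enc f) = enc (Dom C f)"
    and "f \<in> Arr C \<Longrightarrow> Cod (encode C :: 'u small_category) (enc f) = enc (Cod C f)"
    and "x \<in> Obj C \<Longrightarrow> Id (encode C :: 'u small_category) (enc x) = enc (Id C x)"
    and "\<lbrakk>g \<in> Arr C; f \<in> Arr C; Dom C g = Cod C f\<rbrakk>
      \<Longrightarrow> Comp (encode C :: 'u small_category) (enc g) (enc f) = enc (Comp C g f)"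
  using assms by (auto simp: encode_def)

lemma is_category_encode [simp]:
  fixes C :: "('o, 'a) category"
  assumes "inj (enc :: 'o \<Rightarrow> 'u)" "inj (enc :: 'a \<Rightarrow> 'u)" "is_category C"
  shows "is_category (encode C :: 'u small_category)"
  unfolding encode_def
  by (rule is_category_mk) (use assms in \<open>auto simp: comp_assoc inj_eq\<close>)

lemma encF_simps [simp]:
  "Src (encF C) = C" "Tgt (encF C) = encode C"
  "x \<in> Obj C \<Longrightarrow> MapO (encF C) x = enc x" "f \<in> Arr C \<Longrightarrow> MapA (encF C) f = enc f"
  by (auto simp: encF_def)

lemma is_functor_encF [simp]:
  fixes C :: "('o, 'a) category"
  assumes "inj (enc :: 'o \<Rightarrow> 'u)" "inj (enc :: 'a \<Rightarrow> 'u)" "is_category C"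
  shows "is_functor (encF C :: ('o, 'a, 'u, 'u) cat_functor)"
  unfolding encF_def by (rule is_functor_mk) (use assms in auto)

lemma decF_simps [simp]:
  fixes C :: "('o, 'a) category"
  assumes "inj (enc :: 'o \<Rightarrow> 'u)" "inj (enc :: 'a \<Rightarrow> 'u)"
  shows "Src (decF C :: ('u, 'u, 'o, 'a) cat_functor) = encode C"
    and "Tgt (decF C :: ('u, 'u, 'o, 'a) cat_functor) = C"
    and "x \<in> Obj C \<Longrightarrow> MapO (decF C) (enc x :: 'u) = x"
    and "f \<in> Arr C \<Longrightarrow> MapA (decF C) (enc f :: 'u) = f"
  using assms by (auto simp: decF_def)

lemma is_functor_decF [simp]:
  fixes C :: "('o, 'a) category"
  assumes "inj (enc :: 'o \<Rightarrow> 'u)" "inj (enc :: 'a \<Rightarrow> 'u)" "is_category C"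
  shows "is_functor (decF C :: ('u, 'u, 'o, 'a) cat_functor)"
  unfolding decF_def by (rule is_functor_mk) (use assms in \<open>auto simp: inj_eq\<close>)

section \<open>Small categories\<close>

text \<open>Any two sets are comparable, so the results on cardinals can be used for \<open>\<prec>\<close>.\<close>

lemma lesspoll_iff_ordLess: "A \<prec> B \<longleftrightarrow> (card_of A, card_of B) \<in> ordLess"
proof -
  have "A \<prec> B \<longleftrightarrow> \<not> B \<lesssim> A"
  proof
    show "A \<prec> B \<Longrightarrow> \<not> B \<lesssim> A"
      by (auto simp: lesspoll_def dest: lepoll_antisym)
    show "A \<prec> B" if "\<not> B \<lesssim> A"
    proof -
      have "(card_of A, card_of B) \<in> ordLess" using that card_of_ordLess unfolding lepoll_def by blast
      then have "A \<lesssim> B" using ordLess_imp_ordLeq card_of_ordLeq unfolding lepoll_def by blast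
      with that show ?thesis by (metis lesspoll_def eqpoll_imp_lepoll eqpoll_sym)
    qed
  qed
  then show ?thesis using card_of_ordLess unfolding lepoll_def by blast
qed

text \<open>A product of nonempty sets, one of them infinite, has the cardinality of the larger factor. So
  products and slices of small categories are small in every infinite universe.\<close>

lemma lesspoll_Times:
  assumes "infinite C" "A \<prec> C" "B \<prec> C"
  shows "A \<times> B \<prec> C"
proof (cases "A = {} \<or> B = {} \<or> finite A \<and> finite B")
  case True
  then have "finite (A \<times> B)" by auto
  then show ?thesis using assms(1) by (rule finite_lesspoll_infinite[rotated])
next
  case False
  have "(card_of A, card_of B) \<in> ordLeq \<or> (card_of B, card_of A) \<in> ordLeq"
    by (intro ordLeq_total card_of_Well_order)
  moreover have "infinite A" if "(card_of B, card_of A) \<in> ordLeq"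
    using that False card_of_ordLeq_infinite[of B A] by blast
  moreover have "infinite B" if "(card_of A, card_of B) \<in> ordLeq"
    using that False card_of_ordLeq_infinite[of A B] by blast
  ultimately have "(card_of (A \<times> B), card_of A) \<in> ordIso \<or> (card_of (A \<times> B), card_of B) \<in> ordIso"
    using False card_of_Times_infinite[of A B] card_of_Times_infinite[of B A] by blast
  then show ?thesis using assms(2,3) unfolding lesspoll_iff_ordLess
    by (elim disjE) (rule ordIso_ordLess_trans; assumption)+
qed

text \<open>The parameter \<open>U\<close> fixes the type \<open>'u\<close> of the universe for the whole locale.\<close>

locale universe =
  fixes U :: "'u itself"
  assumes infinite_UNIV: "infinite (UNIV :: 'u set)"
begin

lemma inj_enc_pair [simp]: "inj (enc :: 'u \<times> 'u \<Rightarrow> 'u)"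
proof (rule inj_enc)
  have "\<exists>f. inj_on f (UNIV \<times> UNIV :: ('u \<times> 'u) set) \<and> f ` (UNIV \<times> UNIV) \<subseteq> (UNIV :: 'u set)"
    using card_of_Times_same_infinite[OF infinite_UNIV] ordIso_iff_ordLeq card_of_ordLeq by blast
  then show "\<exists>f :: 'u \<times> 'u \<Rightarrow> 'u. inj f" by auto
qed

lemma inj_enc_arrow [simp]: "inj (enc :: ('u \<times> 'u) \<times> 'u \<times> ('u \<times> 'u) \<Rightarrow> 'u)"
proof (rule inj_enc)
  let ?e = "enc :: 'u \<times> 'u \<Rightarrow> 'u"
  have "inj (\<lambda>(x, g, y). ?e (?e x, ?e (g, ?e y)))"
    by (rule injI) (auto simp: inj_eq)
  then show "\<exists>f :: ('u \<times> 'u) \<times> 'u \<times> ('u \<times> 'u) \<Rightarrow> 'u. inj f" by blast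
qed

lemma inj_enc_unit [simp]: "inj (enc :: unit \<Rightarrow> 'u)"
  by (rule injI) simp

lemma enc_eq_iff [simp]:
  "(enc (a :: 'u \<times> 'u) :: 'u) = enc b \<longleftrightarrow> a = b"
  "(enc (c :: ('u \<times> 'u) \<times> 'u \<times> ('u \<times> 'u)) :: 'u) = enc d \<longleftrightarrow> c = d"
  by (simp_all add: inj_eq)

lemma small_cat_encode:
  fixes C :: "('x, 'y) category"
  assumes "inj (enc :: 'x \<Rightarrow> 'u)" "inj (enc :: 'y \<Rightarrow> 'u)" "is_category C"
    and "Obj C \<prec> (UNIV :: 'u set)" "Arr C \<prec> (UNIV :: 'u set)"
  shows "small_cat (encode C :: 'u small_category)"
  using assms(1-3) lesspoll_trans1[OF image_lepoll[of enc] assms(4)]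
    lesspoll_trans1[OF image_lepoll[of enc] assms(5)]
  by (simp add: small_cat_def)

lemma small_cat_imp_category [simp]: "small_cat K \<Longrightarrow> is_category K"
  by (simp add: small_cat_def)

lemma small_fun_simps [simp]:
  assumes "small_fun F"
  shows "is_functor F" "small_cat (Src F)" "small_cat (Tgt F)"
  using assms by (auto simp: small_fun_def)

lemma small_funI: "\<lbrakk>is_functor F; small_cat (Src F); small_cat (Tgt F)\<rbrakk> \<Longrightarrow> small_fun F"
  unfolding small_fun_def by blast

lemma small_natI: "\<lbrakk>nat_trans \<alpha> F G; small_fun F; small_fun G\<rbrakk> \<Longrightarrow> small_nat \<alpha>"
  unfolding small_nat_def nat_trans_def by blast

lemma small_nat_simps [simp]:
  assumes "small_nat \<alpha>"
  shows "is_nat_transf \<alpha>" "small_fun (DomF \<alpha>)" "small_fun (CodF \<alpha>)"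
  using assms unfolding small_nat_def by blast+

lemma small_fun_idF [simp]: "small_cat K \<Longrightarrow> small_fun (idF K)"
  by (rule small_funI) simp_all

lemma small_fun_compF [simp]: "\<lbrakk>small_fun v; small_fun u; Src v = Tgt u\<rbrakk> \<Longrightarrow> small_fun (v \<odot> u)"
  by (rule small_funI) simp_all

lemma small_nat_idN [simp]: "small_fun u \<Longrightarrow> small_nat (idN u)"
  by (rule small_natI[unfolded nat_trans_def]) auto

lemma small_nat_vcomp [simp]: "\<lbrakk>small_nat \<beta>; small_nat \<alpha>; DomF \<beta> = CodF \<alpha>\<rbrakk> \<Longrightarrow> small_nat (\<beta> \<bullet> \<alpha>)"
  by (rule small_natI[unfolded nat_trans_def]) auto

lemma small_nat_hcomp [simp]:
  "\<lbrakk>small_nat \<beta>; small_nat \<alpha>; Src (DomF \<beta>) = Tgt (DomF \<alpha>)\<rbrakk> \<Longrightarrow> small_nat (\<beta> \<star> \<alpha>)"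
  by (rule small_natI[unfolded nat_trans_def]) auto

lemma times_simps [simp]:
  fixes M K :: "'u small_category"
  shows "enc (x, y) \<in> Obj (M \<otimes> K) \<longleftrightarrow> x \<in> Obj M \<and> y \<in> Obj K"
    and "enc (f, g) \<in> Arr (M \<otimes> K) \<longleftrightarrow> f \<in> Arr M \<and> g \<in> Arr K"
    and "\<lbrakk>f \<in> Arr M; g \<in> Arr K\<rbrakk> \<Longrightarrow> Dom (M \<otimes> K) (enc (f, g)) = enc (Dom M f, Dom K g)"
    and "\<lbrakk>f \<in> Arr M; g \<in> Arr K\<rbrakk> \<Longrightarrow> Cod (M \<otimes> K) (enc (f, g)) = enc (Cod M f, Cod K g)"
    and "\<lbrakk>x \<in> Obj M; y \<in> Obj K\<rbrakk> \<Longrightarrow> Id (M \<otimes> K) (enc (x, y)) = enc (Id M x, Id K y)"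
    and "\<lbrakk>f' \<in> Arr M; g' \<in> Arr K; f \<in> Arr M; g \<in> Arr K; Dom M f' = Cod M f; Dom K g' = Cod K g\<rbrakk>
      \<Longrightarrow> Comp (M \<otimes> K) (enc (f', g')) (enc (f, g)) = enc (Comp M f' f, Comp K g' g)"
    and "\<lbrakk>is_category M; is_category K\<rbrakk> \<Longrightarrow> is_category (M \<otimes> K)"
  unfolding times_def by (auto simp: inj_image_mem_iff)

lemma Obj_timesE:
  assumes "z \<in> Obj (M \<otimes> K :: 'u small_category)"
  obtains x y where "z = enc (x, y)" "x \<in> Obj M" "y \<in> Obj K"
  using assms by (auto simp: times_def)

lemma Arr_timesE:
  assumes "h \<in> Arr (M \<otimes> K :: 'u small_category)"
  obtains f g where "h = enc (f, g)" "f \<in> Arr M" "g \<in> Arr K"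
  using assms by (auto simp: times_def)

lemma small_cat_times [simp]:
  "\<lbrakk>small_cat M; small_cat K\<rbrakk> \<Longrightarrow> small_cat (M \<otimes> K :: 'u small_category)"
  unfolding times_def
  by (rule small_cat_encode) (auto simp: small_cat_def intro!: lesspoll_Times infinite_UNIV)

lemma timesF_simps [simp]:
  fixes v u :: "'u small_functor"
  shows "Src (v \<otimes>\<^sub>F u) = Src v \<otimes> Src u" "Tgt (v \<otimes>\<^sub>F u) = Tgt v \<otimes> Tgt u"
    and "\<lbrakk>is_functor v; is_functor u; x \<in> Obj (Src v); y \<in> Obj (Src u)\<rbrakk>
      \<Longrightarrow> MapO (v \<otimes>\<^sub>F u) (enc (x, y)) = enc (MapO v x, MapO u y)"
    and "\<lbrakk>is_functor v; is_functor u; f \<in> Arr (Src v); g \<in> Arr (Src u)\<rbrakk>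
      \<Longrightarrow> MapA (v \<otimes>\<^sub>F u) (enc (f, g)) = enc (MapA v f, MapA u g)"
    and "\<lbrakk>is_functor v; is_functor u\<rbrakk> \<Longrightarrow> is_functor (v \<otimes>\<^sub>F u)"
  unfolding timesF_def times_def by simp_all

lemma small_fun_times [simp]:
  "\<lbrakk>small_fun v; small_fun u\<rbrakk> \<Longrightarrow> small_fun (v \<otimes>\<^sub>F u :: 'u small_functor)"
  by (rule small_funI) simp_all

lemma times_functor_eqI:
  fixes F G :: "('u, 'u, 'x, 'y) cat_functor"
  assumes "is_functor F" "is_functor G" "Src F = M \<otimes> K" "Src G = M \<otimes> K" "Tgt F = Tgt G"
    and "\<And>x y. \<lbrakk>x \<in> Obj M; y \<in> Obj K\<rbrakk> \<Longrightarrow> MapO F (enc (x, y)) = MapO G (enc (x, y))"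
    and "\<And>f g. \<lbrakk>f \<in> Arr M; g \<in> Arr K\<rbrakk> \<Longrightarrow> MapA F (enc (f, g)) = MapA G (enc (f, g))"
  shows "F = G"
  by (rule functor_eqI) (use assms in \<open>auto elim!: Obj_timesE Arr_timesE\<close>)

lemma timesN_simps [simp]:
  fixes \<beta> \<alpha> :: "'u small_nat_transf"
  assumes "is_nat_transf \<beta>" "is_nat_transf \<alpha>"
  shows "DomF (\<beta> \<otimes>\<^sub>N \<alpha>) = DomF \<beta> \<otimes>\<^sub>F DomF \<alpha>" "CodF (\<beta> \<otimes>\<^sub>N \<alpha>) = CodF \<beta> \<otimes>\<^sub>F CodF \<alpha>"
    and "is_nat_transf (\<beta> \<otimes>\<^sub>N \<alpha>)"
    and "\<lbrakk>x \<in> Obj (Src (DomF \<beta>)); y \<in> Obj (Src (DomF \<alpha>))\<rbrakk> \<Longrightarrow> At (\<beta> \<otimes>\<^sub>N \<alpha>) (enc (x, y)) = enc (At \<beta> x, At \<alpha> y)"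
  unfolding timesN_def timesF_def using assms by (simp_all add: inj_eq)

lemma small_nat_times [simp]:
  "\<lbrakk>small_nat \<beta>; small_nat \<alpha>\<rbrakk> \<Longrightarrow> small_nat (\<beta> \<otimes>\<^sub>N \<alpha> :: 'u small_nat_transf)"
  by (rule small_natI[unfolded nat_trans_def]) auto

lemma times_nat_eqI:
  fixes \<alpha> \<beta> :: "('u, 'u, 'x, 'y) nat_transf"
  assumes "is_nat_transf \<alpha>" "is_nat_transf \<beta>" "DomF \<alpha> = DomF \<beta>" "CodF \<alpha> = CodF \<beta>"
    and "Src (DomF \<beta>) = M \<otimes> K"
    and "\<And>x y. \<lbrakk>x \<in> Obj M; y \<in> Obj K\<rbrakk> \<Longrightarrow> At \<alpha> (enc (x, y)) = At \<beta> (enc (x, y))"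
  shows "\<alpha> = \<beta>"
  by (rule nat_eqI) (use assms in \<open>auto elim!: Obj_timesE\<close>)

end

section \<open>Universal arrows\<close>

definition arrow :: "('o, 'a) category \<Rightarrow> 'a \<Rightarrow> 'o \<Rightarrow> 'o \<Rightarrow> bool" where
  "arrow C f x y \<longleftrightarrow> f \<in> Arr C \<and> Dom C f = x \<and> Cod C f = y"

text \<open>\<open>(Y, e)\<close> is an initial object of the comma category of \<open>X\<close> and \<open>R\<close>.\<close>

definition universal_arrow ::
    "('p, 'b, 'o, 'a) cat_functor \<Rightarrow> 'o \<Rightarrow> 'p \<Rightarrow> 'a \<Rightarrow> bool" where
  "universal_arrow R X Y e \<longleftrightarrow> Y \<in> Obj (Src R) \<and> arrow (Tgt R) e X (MapO R Y) \<and>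
    (\<forall>Z\<in>Obj (Src R). \<forall>f. arrow (Tgt R) f X (MapO R Z) \<longrightarrow>
      (\<exists>!g. arrow (Src R) g Y Z \<and> Comp (Tgt R) (MapA R g) e = f))"

lemma universal_arrowD:
  assumes "universal_arrow R X Y e"
  shows "Y \<in> Obj (Src R)" "arrow (Tgt R) e X (MapO R Y)"
  using assms by (auto simp: universal_arrow_def)

lemma universal_arrow_factor:
  assumes "universal_arrow R X Y e" "Z \<in> Obj (Src R)" "arrow (Tgt R) f X (MapO R Z)"
  obtains g where "arrow (Src R) g Y Z" "Comp (Tgt R) (MapA R g) e = f"
  using assms unfolding universal_arrow_def by blast

lemma universal_arrow_unique:
  assumes "universal_arrow R X Y e" "is_functor R" "arrow (Src R) g Y Z" "arrow (Src R) h Y Z"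
    and "Comp (Tgt R) (MapA R g) e = Comp (Tgt R) (MapA R h) e"
  shows "g = h"
proof -
  have "Z \<in> Obj (Src R)" using assms(2,3) by (auto simp: arrow_def)
  moreover have "arrow (Tgt R) (Comp (Tgt R) (MapA R h) e) X (MapO R Z)"
    using assms(1,2,4) by (auto simp: arrow_def universal_arrow_def)
  ultimately show ?thesis using assms(1,3-5) unfolding universal_arrow_def by metis
qed

lemma iso_arrI:
  assumes "arrow C f x y" "arrow C g y x" "Comp C g f = Id C x" "Comp C f g = Id C y"
  shows "iso_arr C f"
  using assms unfolding iso_arr_def arrow_def by (auto intro!: bexI[of _ g])

lemma iso_arrE:
  assumes "iso_arr C f" "arrow C f x y"
  obtains g where "arrow C g y x" "Comp C g f = Id C x" "Comp C f g = Id C y"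
  using assms unfolding iso_arr_def arrow_def by auto

text \<open>Solutions of a universal problem are unique up to isomorphism, and being a solution is invariant
  under isomorphism. The equivalence serves to pass between universality of an arrow and invertibility
  of a comparison map.\<close>

lemma universal_arrow_iff_iso:
  assumes R: "is_functor R" and e: "universal_arrow R X Y e" and g: "arrow (Src R) g Y Y'"
  shows "universal_arrow R X Y' (Comp (Tgt R) (MapA R g) e) \<longleftrightarrow> iso_arr (Src R) g"
proof
  let ?e' = "Comp (Tgt R) (MapA R g) e"
  note [simp] = R
  have e_arr [simp]: "e \<in> Arr (Tgt R)" "Dom (Tgt R) e = X" "Cod (Tgt R) e = MapO R Y" "Y \<in> Obj (Src R)"
    using e by (auto simp: universal_arrow_def arrow_def)
  have g_arr [simp]: "g \<in> Arr (Src R)" "Dom (Src R) g = Y" "Cod (Src R) g = Y'"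
    using g by (auto simp: arrow_def)
  have Y' [simp]: "Y' \<in> Obj (Src R)" using category_simps(2)[of "Src R" g] by simp
  {
    assume u: "universal_arrow R X Y' ?e'"
    obtain h where h: "arrow (Src R) h Y' Y" "Comp (Tgt R) (MapA R h) ?e' = e"
      using universal_arrow_factor[OF u, of Y e] by (auto simp: arrow_def)
    note [simp] = h(1)[unfolded arrow_def]
    have "Comp (Src R) h g = Id (Src R) Y"
      by (rule universal_arrow_unique[OF e R]) (use h(2) in \<open>auto simp: arrow_def comp_assoc\<close>)
    moreover have "Comp (Src R) g h = Id (Src R) Y'"
      by (rule universal_arrow_unique[OF u R]) (use h(2) in \<open>auto simp: arrow_def comp_assoc\<close>)
    ultimately show "iso_arr (Src R) g" by (rule iso_arrI[OF g h(1)])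
  }
  {
    assume "iso_arr (Src R) g"
    then obtain h where h: "arrow (Src R) h Y' Y"
      and hg: "Comp (Src R) h g = Id (Src R) Y" and gh: "Comp (Src R) g h = Id (Src R) Y'"
      by (rule iso_arrE[OF _ g])
    note [simp] = h[unfolded arrow_def]
    have Rhg: "Comp (Tgt R) (MapA R h) (MapA R g) = Id (Tgt R) (MapO R Y)"
      using hg by (simp flip: functor_simps(8))
    show "universal_arrow R X Y' ?e'"
      unfolding universal_arrow_def
    proof (intro conjI ballI allI impI)
      fix Z f assume Z: "Z \<in> Obj (Src R)" and f: "arrow (Tgt R) f X (MapO R Z)"
      obtain k where k: "arrow (Src R) k Y Z" "Comp (Tgt R) (MapA R k) e = f"
        using universal_arrow_factor[OF e Z f] .
      note [simp] = k(1)[unfolded arrow_def]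
      show "\<exists>!g'. arrow (Src R) g' Y' Z \<and> Comp (Tgt R) (MapA R g') ?e' = f"
      proof (intro ex1I conjI)
        show "arrow (Src R) (Comp (Src R) k h) Y' Z" by (simp add: arrow_def)
        have "Comp (Tgt R) (MapA R h) ?e' = e"
          using Rhg by (simp flip: comp_assoc)
        then show "Comp (Tgt R) (MapA R (Comp (Src R) k h)) ?e' = f"
          using k(2) by (simp add: comp_assoc)
      next
        fix g' assume g': "arrow (Src R) g' Y' Z \<and> Comp (Tgt R) (MapA R g') ?e' = f"
        then have [simp]: "g' \<in> Arr (Src R)" "Dom (Src R) g' = Y'" "Cod (Src R) g' = Z"
          by (auto simp: arrow_def)
        have "Comp (Src R) g' g = k"
          by (rule universal_arrow_unique[OF e R, of _ Z])
            (use g' k(2) in \<open>auto simp: arrow_def comp_assoc\<close>)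
        then have "Comp (Src R) (Comp (Src R) g' g) h = Comp (Src R) k h" by simp
        then show "g' = Comp (Src R) k h" using gh by (simp add: comp_assoc)
      qed
    qed (auto simp: arrow_def)
  }
qed

lemma adjunction_simps:
  assumes "adjunction L R \<eta> \<epsilon>"
  shows "is_functor L" "is_functor R" "Src R = Tgt L" "Tgt R = Src L"
    and "is_nat_transf \<eta>" "DomF \<eta> = idF (Src L)" "CodF \<eta> = R \<odot> L"
    and "is_nat_transf \<epsilon>" "DomF \<epsilon> = L \<odot> R" "CodF \<epsilon> = idF (Tgt L)"
  using assms by (auto simp: adjunction_def nat_trans_def)

lemma adjunction_triangles:
  assumes "adjunction L R \<eta> \<epsilon>"
  shows "x \<in> Obj (Src L) \<Longrightarrow> Comp (Tgt L) (At \<epsilon> (MapO L x)) (MapA L (At \<eta> x)) = Id (Tgt L) (MapO L x)"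
    and "y \<in> Obj (Tgt L) \<Longrightarrow> Comp (Src L) (MapA R (At \<epsilon> y)) (At \<eta> (MapO R y)) = Id (Src L) (MapO R y)"
proof -
  note [simp] = adjunction_simps[OF assms]
  have "At ((\<epsilon> \<star> idN L) \<bullet> (idN L \<star> \<eta>)) x = At (idN L) x"
    "At ((idN R \<star> \<epsilon>) \<bullet> (\<eta> \<star> idN R)) y = At (idN R) y"
    using assms by (auto simp: adjunction_def)
  then show "x \<in> Obj (Src L) \<Longrightarrow> Comp (Tgt L) (At \<epsilon> (MapO L x)) (MapA L (At \<eta> x)) = Id (Tgt L) (MapO L x)"
    and "y \<in> Obj (Tgt L) \<Longrightarrow> Comp (Src L) (MapA R (At \<epsilon> y)) (At \<eta> (MapO R y)) = Id (Src L) (MapO R y)"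
    by simp_all
qed

lemma adjunction_transpose:
  assumes adj: "adjunction L R \<eta> \<epsilon>" and X: "X \<in> Obj (Src L)" and Y: "Y \<in> Obj (Tgt L)"
    and f: "arrow (Src L) f X (MapO R Y)"
  shows "arrow (Tgt L) (Comp (Tgt L) (At \<epsilon> Y) (MapA L f)) (MapO L X) Y"
    and "Comp (Src L) (MapA R (Comp (Tgt L) (At \<epsilon> Y) (MapA L f))) (At \<eta> X) = f"
proof -
  note [simp] = adjunction_simps[OF adj] X Y f[unfolded arrow_def]
  show "arrow (Tgt L) (Comp (Tgt L) (At \<epsilon> Y) (MapA L f)) (MapO L X) Y"
    by (simp add: arrow_def)
  have "Comp (Src L) (MapA R (MapA L f)) (At \<eta> X) = Comp (Src L) (At \<eta> (MapO R Y)) f"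
    using naturalityD[of \<eta> f X "MapO R Y"] by simp
  then have "Comp (Src L) (MapA R (Comp (Tgt L) (At \<epsilon> Y) (MapA L f))) (At \<eta> X) =
      Comp (Src L) (Comp (Src L) (MapA R (At \<epsilon> Y)) (At \<eta> (MapO R Y))) f"
    by (simp add: comp_assoc)
  then show "Comp (Src L) (MapA R (Comp (Tgt L) (At \<epsilon> Y) (MapA L f))) (At \<eta> X) = f"
    using adjunction_triangles(2)[OF adj Y] by simp
qed

lemma adjunction_universal_arrow:
  assumes adj: "adjunction L R \<eta> \<epsilon>" and X: "X \<in> Obj (Src L)"
  shows "universal_arrow R X (MapO L X) (At \<eta> X)"
  unfolding universal_arrow_def
proof (intro conjI ballI allI impI)
  note [simp] = adjunction_simps[OF adj] X
  show "MapO L X \<in> Obj (Src R)" "arrow (Tgt R) (At \<eta> X) X (MapO R (MapO L X))"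
    by (auto simp: arrow_def)
  fix Z f assume Z: "Z \<in> Obj (Src R)" and f: "arrow (Tgt R) f X (MapO R Z)"
  show "\<exists>!g. arrow (Src R) g (MapO L X) Z \<and> Comp (Tgt R) (MapA R g) (At \<eta> X) = f"
  proof (rule ex1I)
    show "arrow (Src R) (Comp (Tgt L) (At \<epsilon> Z) (MapA L f)) (MapO L X) Z \<and>
        Comp (Tgt R) (MapA R (Comp (Tgt L) (At \<epsilon> Z) (MapA L f))) (At \<eta> X) = f"
      using adjunction_transpose[OF adj X, of Z f] Z f by auto
    fix g assume g: "arrow (Src R) g (MapO L X) Z \<and> Comp (Tgt R) (MapA R g) (At \<eta> X) = f"
    then have [simp]: "g \<in> Arr (Tgt L)" "Dom (Tgt L) g = MapO L X" "Cod (Tgt L) g = Z"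
      by (auto simp: arrow_def)
    have nat: "Comp (Tgt L) g (At \<epsilon> (MapO L X)) = Comp (Tgt L) (At \<epsilon> Z) (MapA L (MapA R g))"
      using naturalityD[of \<epsilon> g "MapO L X" Z] by simp
    have "Comp (Tgt L) (At \<epsilon> Z) (MapA L f) =
        Comp (Tgt L) (Comp (Tgt L) (At \<epsilon> Z) (MapA L (MapA R g))) (MapA L (At \<eta> X))"
      using g Z by (auto simp: comp_assoc)
    also have "\<dots> = g"
      using adjunction_triangles(1)[OF adj X] by (simp flip: nat add: comp_assoc)
    finally show "g = Comp (Tgt L) (At \<epsilon> Z) (MapA L f)" by simp
  qed
qed

text \<open>The transpose of \<open>f\<close> is the comparison map from the unit \<open>\<eta> X\<close>, which is universal, to \<open>f\<close>. This
  translates the invertibility of base change maps and mates, which are transposes, into a property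
  that does not mention the left adjoint.\<close>

lemma universal_arrow_iff_iso_transpose:
  assumes adj: "adjunction L R \<eta> \<epsilon>" and X: "X \<in> Obj (Src L)" and Y: "Y \<in> Obj (Tgt L)"
    and f: "arrow (Src L) f X (MapO R Y)"
  shows "universal_arrow R X Y f \<longleftrightarrow> iso_arr (Tgt L) (Comp (Tgt L) (At \<epsilon> Y) (MapA L f))"
  using universal_arrow_iff_iso[OF _ adjunction_universal_arrow[OF adj X],
      of "Comp (Tgt L) (At \<epsilon> Y) (MapA L f)" Y]
    adjunction_transpose[OF assms] adjunction_simps[OF adj] by simp

lemma universal_arrow_imp_iso_transpose:
  assumes "adjunction L R \<eta> \<epsilon>" "X \<in> Obj (Src L)" "universal_arrow R X Y f"
  shows "iso_arr (Tgt L) (Comp (Tgt L) (At \<epsilon> Y) (MapA L f))"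
  using assms universal_arrow_iff_iso_transpose[OF assms(1,2), of Y f] adjunction_simps[OF assms(1)]
    universal_arrowD[OF assms(3)] by simp

text \<open>Let \<open>g : Z \<rightarrow> Y\<close> be the comparison map from \<open>e0\<close> to \<open>e\<close>. By naturality of \<open>a i\<close>, the map \<open>k i g\<close> is
  the comparison map between the pasted arrows \<open>r i X \<rightarrow> p i (k i Z)\<close> and \<open>r i X \<rightarrow> p i (k i Y)\<close>. Both
  are universal, so \<open>k i g\<close> is invertible for every \<open>i\<close>, and so is \<open>g\<close>. This is the
  cancellation rule for pasted squares with invertible mates, for a family \<open>k i\<close> of functors that
  detects isomorphisms.\<close>

lemma universal_arrow_pointwise:
  assumes R: "is_functor R" and e0: "universal_arrow R X Z e0"
    and Y: "Y \<in> Obj (Src R)" and e: "arrow (Tgt R) e X (MapO R Y)"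
    and k: "\<And>i. i \<in> I \<Longrightarrow> is_functor (k i) \<and> is_functor (r i) \<and> is_functor (p i) \<and>
      Src (k i) = Src R \<and> Src (r i) = Tgt R \<and> Src (p i) = Tgt (k i) \<and> Tgt (p i) = Tgt (r i)"
    and a: "\<And>i. i \<in> I \<Longrightarrow> nat_trans (a i) (r i \<odot> R) (p i \<odot> k i)"
    and u0: "\<And>i. i \<in> I \<Longrightarrow> universal_arrow (p i) (MapO (r i) X) (MapO (k i) Z)
      (Comp (Tgt (r i)) (At (a i) Z) (MapA (r i) e0))"
    and u: "\<And>i. i \<in> I \<Longrightarrow> universal_arrow (p i) (MapO (r i) X) (MapO (k i) Y)
      (Comp (Tgt (r i)) (At (a i) Y) (MapA (r i) e))"
    and cons: "\<And>g. \<lbrakk>g \<in> Arr (Src R); \<And>i. i \<in> I \<Longrightarrow> iso_arr (Tgt (k i)) (MapA (k i) g)\<rbrakk> \<Longrightarrow> iso_arr (Src R) g"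
  shows "universal_arrow R X Y e"
proof -
  note [simp] = R
  have [simp]: "Z \<in> Obj (Src R)" "e0 \<in> Arr (Tgt R)" "Dom (Tgt R) e0 = X" "Cod (Tgt R) e0 = MapO R Z"
    using universal_arrowD[OF e0] by (auto simp: arrow_def)
  obtain g where g: "arrow (Src R) g Z Y" and ge: "Comp (Tgt R) (MapA R g) e0 = e"
    using universal_arrow_factor[OF e0 Y e] .
  note [simp] = g[unfolded arrow_def]
  have "iso_arr (Src R) g"
  proof (rule cons)
    fix i assume i: "i \<in> I"
    note [simp] = k[OF i] nat_trans_simps(1,4-)[OF a[OF i]]
    note a' = nat_trans_simps(2,3)[OF a[OF i]]
    have nat: "Comp (Tgt (r i)) (MapA (p i) (MapA (k i) g)) (At (a i) Z) =
        Comp (Tgt (r i)) (At (a i) Y) (MapA (r i) (MapA R g))"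
      using naturalityD[of "a i" g Z Y] by (simp add: a')
    have "Comp (Tgt (r i)) (MapA (p i) (MapA (k i) g)) (Comp (Tgt (r i)) (At (a i) Z) (MapA (r i) e0)) =
        Comp (Tgt (r i)) (Comp (Tgt (r i)) (MapA (p i) (MapA (k i) g)) (At (a i) Z)) (MapA (r i) e0)"
      by (simp add: a' comp_assoc)
    also have "\<dots> = Comp (Tgt (r i)) (At (a i) Y) (MapA (r i) e)"
      unfolding nat ge[symmetric] by (simp add: a' Y comp_assoc)
    finally show "iso_arr (Tgt (k i)) (MapA (k i) g)"
      using universal_arrow_iff_iso[OF _ u0[OF i], of "MapA (k i) g" "MapO (k i) Y"] u[OF i]
      by (simp add: arrow_def)
  qed simp
  then show ?thesis using universal_arrow_iff_iso[OF R e0 g] ge by simp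
qed

text \<open>The hypotheses say that \<open>S\<close> is left adjoint to \<open>T\<close> with unit \<open>\<eta>\<close> and identity counit, in the form in
  which the adjunction arises by restriction along a reflection and the inclusion of the reflective
  subcategory. Transposition gives a bijection between arrows \<open>S X \<rightarrow> P Z\<close> and arrows
  \<open>X \<rightarrow> T (P Z)\<close>, natural in \<open>Z\<close>, so that the two universal problems have the same solutions. When \<open>P\<close>
  and \<open>T \<odot> P\<close> are the functors to constant diagrams, this says that restriction along the inclusion
  does not change the colimit.\<close>

lemma universal_arrow_section:
  assumes S: "is_functor S" and T: "is_functor T" and P: "is_functor P"
    and ty: "Src T = Tgt S" "Tgt T = Src S" "Tgt P = Tgt S"
    and \<eta>: "nat_trans \<eta> (idF (Src S)) (T \<odot> S)"
    and ST: "S \<odot> T = idF (Src T)"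
    and S\<eta>: "\<And>X. X \<in> Obj (Src S) \<Longrightarrow> MapA S (At \<eta> X) = Id (Tgt S) (MapO S X)"
    and \<eta>T: "\<And>Z. Z \<in> Obj (Src T) \<Longrightarrow> At \<eta> (MapO T Z) = Id (Src S) (MapO T Z)"
    and u: "universal_arrow (T \<odot> P) X W f"
  shows "universal_arrow P (MapO S X) W (MapA S f)"
proof -
  note [simp] = S T P ty
  note e = nat_trans_simps(1-3)[OF \<eta>]
  have [simp]: "is_nat_transf \<eta>" by (rule e)
  have STo: "MapO S (MapO T x) = x" if "x \<in> Obj (Tgt S)" for x
    using arg_cong[OF ST, of "\<lambda>F. MapO F x"] that by simp
  have STa: "MapA S (MapA T x) = x" if "x \<in> Arr (Tgt S)" for x
    using arg_cong[OF ST, of "\<lambda>F. MapA F x"] that by simp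
  have [simp]: "W \<in> Obj (Src P)" "f \<in> Arr (Src S)" "Dom (Src S) f = X" "Cod (Src S) f = MapO T (MapO P W)"
    using u by (auto simp: universal_arrow_def arrow_def)
  have X [simp]: "X \<in> Obj (Src S)" using category_simps(1)[of "Src S" f] by simp
  show ?thesis
    unfolding universal_arrow_def
  proof (intro conjI ballI allI impI)
    show "W \<in> Obj (Src P)" "arrow (Tgt P) (MapA S f) (MapO S X) (MapO P W)"
      by (auto simp: arrow_def STo)
    fix Z h assume Z [simp]: "Z \<in> Obj (Src P)" and h: "arrow (Tgt P) h (MapO S X) (MapO P Z)"
    note [simp] = h[unfolded arrow_def, simplified]
    \<comment> \<open>the transpose of \<open>h\<close>\<close>
    let ?h = "Comp (Src S) (MapA T h) (At \<eta> X)"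
    have "arrow (Src S) ?h X (MapO T (MapO P Z))" by (simp add: arrow_def e)
    then obtain g where g: "arrow (Src P) g W Z" and gf: "Comp (Src S) (MapA T (MapA P g)) f = ?h"
      using universal_arrow_factor[OF u, of Z ?h] by (auto simp: arrow_def)
    note [simp] = g[unfolded arrow_def]
    show "\<exists>!g. arrow (Src P) g W Z \<and> Comp (Tgt P) (MapA P g) (MapA S f) = h"
    proof (intro ex1I conjI)
      show "arrow (Src P) g W Z" by (rule g)
      \<comment> \<open>applying \<open>S\<close> undoes the transposition, since \<open>S \<odot> T\<close> and \<open>S \<eta>\<close> are identities\<close>
      have "MapA S (Comp (Src S) (MapA T (MapA P g)) f) = MapA S ?h" using gf by simp
      then show "Comp (Tgt P) (MapA P g) (MapA S f) = h" by (simp add: STa STo S\<eta> e)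
    next
      fix g' assume g': "arrow (Src P) g' W Z \<and> Comp (Tgt P) (MapA P g') (MapA S f) = h"
      then have [simp]: "g' \<in> Arr (Src P)" "Dom (Src P) g' = W" "Cod (Src P) g' = Z"
        by (auto simp: arrow_def)
      \<comment> \<open>the transpose of \<open>S f\<close> is \<open>f\<close>, because \<open>\<eta>\<close> is the identity on the image of \<open>T\<close>\<close>
      have "Comp (Src S) (MapA T (MapA S f)) (At \<eta> X) = Comp (Src S) (At \<eta> (MapO T (MapO P W))) f"
        using naturalityD[of \<eta> f X "MapO T (MapO P W)"] by (simp add: e)
      then have "Comp (Src S) (MapA T (MapA S f)) (At \<eta> X) = f" by (simp add: \<eta>T)
      moreover have "?h = Comp (Src S) (MapA T (Comp (Tgt S) (MapA P g') (MapA S f))) (At \<eta> X)"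
        using g' by auto
      ultimately have "?h = Comp (Src S) (MapA T (MapA P g')) f"
        by (simp add: STo comp_assoc e)
      then show "g' = g"
        by (intro universal_arrow_unique[OF u, of _ Z]) (use gf in \<open>auto simp: arrow_def\<close>)
    qed
  qed
qed

section \<open>Opposites\<close>

text \<open>Passing to opposites turns the counit of an adjunction into a universal arrow. Functors keep
  their direction, while natural transformations are reversed.\<close>

definition op_cat :: "('o, 'a) category \<Rightarrow> ('o, 'a) category" where
  "op_cat C = C\<lparr>Dom := Cod C, Cod := Dom C, Comp := (\<lambda>g f. Comp C f g)\<rparr>"

definition op_functor :: "('o, 'a, 'p, 'b) cat_functor \<Rightarrow> ('o, 'a, 'p, 'b) cat_functor" where
  "op_functor F = F\<lparr>Src := op_cat (Src F), Tgt := op_cat (Tgt F)\<rparr>"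

definition op_nat :: "('o, 'a, 'p, 'b) nat_transf \<Rightarrow> ('o, 'a, 'p, 'b) nat_transf" where
  "op_nat \<alpha> = \<lparr>DomF = op_functor (CodF \<alpha>), CodF = op_functor (DomF \<alpha>), At = At \<alpha>\<rparr>"

lemma op_simps [simp]:
  "Obj (op_cat C) = Obj C" "Arr (op_cat C) = Arr C" "Dom (op_cat C) = Cod C" "Cod (op_cat C) = Dom C"
  "Id (op_cat C) = Id C" "Comp (op_cat C) g f = Comp C f g"
  "Src (op_functor F) = op_cat (Src F)" "Tgt (op_functor F) = op_cat (Tgt F)"
  "MapO (op_functor F) = MapO F" "MapA (op_functor F) = MapA F"
  "DomF (op_nat \<alpha>) = op_functor (CodF \<alpha>)" "CodF (op_nat \<alpha>) = op_functor (DomF \<alpha>)" "At (op_nat \<alpha>) = At \<alpha>"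
  by (auto simp: op_cat_def op_functor_def op_nat_def)

lemma is_category_op [simp]: "is_category C \<Longrightarrow> is_category (op_cat C)"
  by (rule is_category.intro)
    (auto simp: comp_assoc is_category.Dom_ext is_category.Cod_ext is_category.Id_ext is_category.Comp_ext)

lemma is_functor_op [simp]: "is_functor F \<Longrightarrow> is_functor (op_functor F)"
  by (rule is_functor.intro) (auto simp: is_functor.MapO_PiE is_functor.MapA_PiE)

lemma op_idF: "op_functor (idF C) = idF (op_cat C)"
  by (simp add: op_functor_def idF_def mk_functor_def)

lemma op_compF: "op_functor (G \<odot> F) = op_functor G \<odot> op_functor F"
  by (simp add: op_functor_def compF_def mk_functor_def op_cat_def)

lemma nat_trans_op: "nat_trans \<alpha> F G \<Longrightarrow> nat_trans (op_nat \<alpha>) (op_functor G) (op_functor F)"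
  unfolding nat_trans_def
  by (intro conjI is_nat_transf.intro) (auto simp: is_nat_transf.naturality PiE_arb[OF is_nat_transf.At_PiE])

lemma is_nat_transf_op [simp]: "is_nat_transf \<alpha> \<Longrightarrow> is_nat_transf (op_nat \<alpha>)"
  using nat_trans_op[of \<alpha>] by (simp add: nat_trans_def)

lemma iso_arr_op [simp]: "iso_arr (op_cat C) f \<longleftrightarrow> iso_arr C f"
  by (auto simp: iso_arr_def)

lemma adjunction_op:
  assumes "adjunction L R \<eta> \<epsilon>"
  shows "adjunction (op_functor R) (op_functor L) (op_nat \<epsilon>) (op_nat \<eta>)"
proof -
  note [simp] = adjunction_simps[OF assms]
  note tri = adjunction_triangles[OF assms]
  show ?thesis
    unfolding adjunction_def
    by (intro conjI nat_eqI) (auto simp: nat_trans_def op_idF op_compF compF_assoc tri)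
qed

section \<open>Prederivators\<close>

locale prederivator_in_universe = universe U + is_prederivator D
  for U :: "'u itself" and D :: "('u, 'o, 'a) prederivator"
begin

declare D0_category [simp] D1_functor [simp] D1_Src [simp] D1_Tgt [simp] D1_idF [simp] D2_idN [simp]

lemma D2_simps [simp]:
  assumes "small_nat \<alpha>"
  shows "is_nat_transf (D2 D \<alpha>)" "DomF (D2 D \<alpha>) = D1 D (DomF \<alpha>)" "CodF (D2 D \<alpha>) = D1 D (CodF \<alpha>)"
  using D2_nat_trans[OF assms] by (auto simp: nat_trans_def)

text \<open>Read from left to right, iterated restrictions are collected into a restriction along one functor,
  which can then be rewritten by an equation between functors of small categories.\<close>

lemma D1_comp_simps:
  assumes "small_fun v" "small_fun u" "Src v = Tgt u"
  shows "X \<in> Obj (D0 D (Tgt v)) \<Longrightarrow> MapO (D1 D u) (MapO (D1 D v) X) = MapO (D1 D (v \<odot> u)) X"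
    and "f \<in> Arr (D0 D (Tgt v)) \<Longrightarrow> MapA (D1 D u) (MapA (D1 D v) f) = MapA (D1 D (v \<odot> u)) f"
  using assms by (simp_all add: D1_compF)

lemma At_D2_whisker_right:
  assumes "small_nat \<alpha>" "small_fun w" "Src (DomF \<alpha>) = Tgt w" "X \<in> Obj (D0 D (Tgt (DomF \<alpha>)))"
  shows "At (D2 D (\<alpha> \<star> idN w)) X = MapA (D1 D w) (At (D2 D \<alpha>) X)"
  using assms by (simp add: D2_hcomp)

lemma At_D2_whisker_left:
  assumes "small_nat \<alpha>" "small_fun w" "Src w = Tgt (DomF \<alpha>)" "X \<in> Obj (D0 D (Tgt w))"
  shows "At (D2 D (idN w \<star> \<alpha>)) X = At (D2 D \<alpha>) (MapO (D1 D w) X)"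
  using assms by (simp add: D2_hcomp)

lemma is_prederivator_shift:
  assumes M: "small_cat M"
  shows "is_prederivator (shift D M)"
proof -
  note [simp] = M
  have id: "idF M \<otimes>\<^sub>F idF K = idF (M \<otimes> K)" if "small_cat K" for K
    by (rule times_functor_eqI) (use that in auto)
  have comp: "idF M \<otimes>\<^sub>F (v \<odot> u) = (idF M \<otimes>\<^sub>F v) \<odot> (idF M \<otimes>\<^sub>F u)"
    if "small_fun v" "small_fun u" "Src v = Tgt u" for v u
    by (rule times_functor_eqI) (use that in auto)
  have idn: "idN (idF M) \<otimes>\<^sub>N idN u = idN (idF M \<otimes>\<^sub>F u)" if "small_fun u" for u
    by (rule times_nat_eqI) (use that in auto)
  have vc: "idN (idF M) \<otimes>\<^sub>N (\<beta> \<bullet> \<alpha>) = (idN (idF M) \<otimes>\<^sub>N \<beta>) \<bullet> (idN (idF M) \<otimes>\<^sub>N \<alpha>)"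
    if "small_nat \<beta>" "small_nat \<alpha>" "DomF \<beta> = CodF \<alpha>" for \<beta> \<alpha>
    by (rule times_nat_eqI) (use that in auto)
  have hc: "idN (idF M) \<otimes>\<^sub>N (\<beta> \<star> \<alpha>) = (idN (idF M) \<otimes>\<^sub>N \<beta>) \<star> (idN (idF M) \<otimes>\<^sub>N \<alpha>)"
    if "small_nat \<beta>" "small_nat \<alpha>" "Src (DomF \<beta>) = Tgt (DomF \<alpha>)" for \<beta> \<alpha>
    by (rule times_nat_eqI) (use that in \<open>auto simp: comp\<close>)
  show ?thesis
    by (rule is_prederivator.intro)
      (auto simp: shift_def id comp idn vc hc D1_compF D2_vcomp D2_hcomp nat_trans_def)
qed

end

lemma inv_arr_Id:
  assumes "is_category C" "x \<in> Obj C"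
  shows "inv_arr C (Id C x) = Id C x"
  unfolding inv_arr_def by (rule the_equality) (use assms in auto)

lemma iso_arr_Id: "\<lbrakk>is_category C; x \<in> Obj C\<rbrakk> \<Longrightarrow> iso_arr C (Id C x)"
  by (rule iso_arrI[where g = "Id C x"]) (auto simp: arrow_def)

lemma invN_idN:
  assumes "is_functor F"
  shows "invN (idN F) = idN F"
  unfolding invN_def using assms by (auto simp: idN_def mk_nat_def restrict_def inv_arr_Id)

lemma strict_morphism_simps [simp]:
  "Fun (strict_morphism D' G) = G" "Coh (strict_morphism D' G) u = idN (D1 D' u \<odot> G (Tgt u))"
  by (auto simp: strict_morphism_def)

text \<open>A family of functors that commutes strictly with all restrictions and with the transformations
  between them is a morphism with identity coherence. Its mates can then be computed componentwise.\<close>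

locale strict_transformation =
  universe U + D: prederivator_in_universe U D + D': prederivator_in_universe U D'
  for U :: "'u itself" and D :: "('u, 'o, 'a) prederivator" and D' :: "('u, 'p, 'b) prederivator" +
  fixes G :: "'u small_category \<Rightarrow> ('o, 'a, 'p, 'b) cat_functor"
  assumes G_functor [simp]: "small_cat K \<Longrightarrow> is_functor (G K)"
    and G_Src [simp]: "small_cat K \<Longrightarrow> Src (G K) = D0 D K"
    and G_Tgt [simp]: "small_cat K \<Longrightarrow> Tgt (G K) = D0 D' K"
    and commute: "small_fun u \<Longrightarrow> D1 D' u \<odot> G (Tgt u) = G (Src u) \<odot> D1 D u"
    and commute2: "small_nat \<alpha> \<Longrightarrow> X \<in> Obj (D0 D (Tgt (DomF \<alpha>))) \<Longrightarrow>
      MapA (G (Src (DomF \<alpha>))) (At (D2 D \<alpha>) X) = At (D2 D' \<alpha>) (MapO (G (Tgt (DomF \<alpha>))) X)"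
begin

lemma commute_compF: "\<lbrakk>small_fun u; is_functor l; Tgt l = D0 D (Tgt u)\<rbrakk> \<Longrightarrow>
    D1 D' u \<odot> (G (Tgt u) \<odot> l) = G (Src u) \<odot> (D1 D u \<odot> l)"
  by (simp add: commute flip: compF_assoc)

lemma commuteO: "\<lbrakk>small_fun u; X \<in> Obj (D0 D (Tgt u))\<rbrakk> \<Longrightarrow>
    MapO (G (Src u)) (MapO (D1 D u) X) = MapO (D1 D' u) (MapO (G (Tgt u)) X)"
  using arg_cong[OF commute, of u "\<lambda>F. MapO F X"] by simp

lemma pseudonatural: "pseudonatural D D' (strict_morphism D' G)"
proof (intro pseudonatural.intro pseudonatural_axioms.intro, goal_cases)
  case 1
  show ?case by (rule D.is_prederivator_axioms)
next
  case 2
  show ?case by (rule D'.is_prederivator_axioms)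
next
  case (6 u)
  then show ?case
    by (auto simp: nat_iso_def nat_trans_def commute iso_arr_Id)
next
  case (8 v u)
  show ?case
    by (rule nat_eqI)
      (use 8 in \<open>auto simp: D.D1_compF D'.D1_compF compF_assoc commute commute_compF commuteO\<close>)
next
  case (9 \<alpha>)
  show ?case
    by (rule nat_eqI)
      (use 9 commute[of "CodF \<alpha>"] commuteO[of "CodF \<alpha>"] in \<open>auto simp: commute compF_assoc commuteO commute2\<close>)
qed auto

text \<open>Since the coherence isomorphisms are identities, the mate at \<open>X\<close> is the transpose of \<open>G (\<eta> X)\<close>.\<close>

lemma preserves_left_Kan:
  assumes u: "small_fun u"
    and ex: "has_left_adjoint (D1 D u)" "has_left_adjoint (D1 D' u)"
    and univ: "\<And>l \<eta> \<epsilon> X. \<lbrakk>adjunction l (D1 D u) \<eta> \<epsilon>; X \<in> Obj (D0 D (Src u))\<rbrakk> \<Longrightarrow>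
      universal_arrow (D1 D' u) (MapO (G (Src u)) X) (MapO (G (Tgt u)) (MapO l X)) (MapA (G (Src u)) (At \<eta> X))"
  shows "preserves_left_Kan D D' (strict_morphism D' G) u"
  unfolding preserves_left_Kan_def
proof (intro conjI ex allI impI)
  fix l \<eta> \<epsilon> l' \<eta>' \<epsilon>'
  assume adj: "adjunction l (D1 D u) \<eta> \<epsilon>" and adj': "adjunction l' (D1 D' u) \<eta>' \<epsilon>'"
  note [simp] = u
  note a = adjunction_simps[OF adj] and a' = adjunction_simps[OF adj']
  have [simp]: "Tgt l = D0 D (Tgt u)" "Src l = D0 D (Src u)" "Tgt l' = D0 D' (Tgt u)" "Src l' = D0 D' (Src u)"
    using a(3,4) a'(3,4) by auto
  note [simp] = a(1,5-) a'(1,5-) invN_idN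
  let ?F = "strict_morphism D' G"
  let ?mate = "(\<epsilon>' \<star> idN (Fun ?F (Tgt u) \<odot> l)) \<bullet> (idN l' \<star> invN (Coh ?F u) \<star> idN l) \<bullet>
      (idN (l' \<odot> Fun ?F (Src u)) \<star> \<eta>)"
  have "nat_trans ?mate (l' \<odot> Fun ?F (Src u)) (Fun ?F (Tgt u) \<odot> l)"
    by (simp add: nat_trans_def compF_assoc commute commute_compF)
  moreover have "iso_arr (D0 D' (Tgt u)) (At ?mate X)" if X [simp]: "X \<in> Obj (D0 D (Src u))" for X
  proof -
    have "At ?mate X = Comp (D0 D' (Tgt u)) (At \<epsilon>' (MapO (G (Tgt u)) (MapO l X)))
        (MapA l' (MapA (G (Src u)) (At \<eta> X)))"
      by (simp add: commuteO)
    then show ?thesis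
      using universal_arrow_imp_iso_transpose[OF adj' _ univ[OF adj X]] by simp
  qed
  ultimately show "nat_iso ?mate (l' \<odot> Fun ?F (Src u)) (Fun ?F (Tgt u) \<odot> l)"
    by (simp add: nat_iso_def)
qed

text \<open>Here the mate at \<open>X\<close> is the transpose of \<open>G (\<epsilon> X)\<close>, read in the opposite categories.\<close>

lemma preserves_right_Kan:
  assumes u: "small_fun u"
    and ex: "has_right_adjoint (D1 D u)" "has_right_adjoint (D1 D' u)"
    and univ: "\<And>r \<eta> \<epsilon> X. \<lbrakk>adjunction (D1 D u) r \<eta> \<epsilon>; X \<in> Obj (D0 D (Src u))\<rbrakk> \<Longrightarrow>
      universal_arrow (op_functor (D1 D' u)) (MapO (G (Src u)) X) (MapO (G (Tgt u)) (MapO r X))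
        (MapA (G (Src u)) (At \<epsilon> X))"
  shows "preserves_right_Kan D D' (strict_morphism D' G) u"
  unfolding preserves_right_Kan_def
proof (intro conjI ex allI impI)
  fix r \<eta> \<epsilon> r' \<eta>' \<epsilon>'
  assume adj: "adjunction (D1 D u) r \<eta> \<epsilon>" and adj': "adjunction (D1 D' u) r' \<eta>' \<epsilon>'"
  note [simp] = u
  note a = adjunction_simps[OF adj] and a' = adjunction_simps[OF adj']
  have [simp]: "Tgt r = D0 D (Tgt u)" "Src r = D0 D (Src u)" "Tgt r' = D0 D' (Tgt u)" "Src r' = D0 D' (Src u)"
    using a(3,4) a'(3,4) by auto
  note [simp] = a(2,5-) a'(2,5-)
  let ?F = "strict_morphism D' G"
  let ?mate = "(idN (r' \<odot> Fun ?F (Src u)) \<star> \<epsilon>) \<bullet> (idN r' \<star> Coh ?F u \<star> idN r) \<bullet>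
      (\<eta>' \<star> idN (Fun ?F (Tgt u) \<odot> r))"
  have "nat_trans ?mate (Fun ?F (Tgt u) \<odot> r) (r' \<odot> Fun ?F (Src u))"
    by (simp add: nat_trans_def compF_assoc commute commute_compF)
  moreover have "iso_arr (D0 D' (Tgt u)) (At ?mate X)" if X [simp]: "X \<in> Obj (D0 D (Src u))" for X
  proof -
    have "At ?mate X = Comp (D0 D' (Tgt u)) (MapA r' (MapA (G (Src u)) (At \<epsilon> X)))
        (At \<eta>' (MapO (G (Tgt u)) (MapO r X)))"
      by (simp add: commuteO)
    then show ?thesis
      using universal_arrow_imp_iso_transpose[OF adjunction_op[OF adj'] _ univ[OF adj X]] by simp
  qed
  ultimately show "nat_iso ?mate (Fun ?F (Tgt u) \<odot> r) (r' \<odot> Fun ?F (Src u))"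
    by (simp add: nat_iso_def)
qed

end

section \<open>Slices\<close>

text \<open>The functor \<open>x \<mapsto> (m, x)\<close>, in the form in which it occurs in the evaluation morphism.\<close>

definition insertion :: "'u small_category \<Rightarrow> 'u \<Rightarrow> 'u small_category \<Rightarrow> 'u small_functor" where
  "insertion M m K = (point M m \<otimes>\<^sub>F idF K) \<odot> left_unitor K"

context universe
begin

lemma is_category_over_cat:
  assumes "is_functor u"
  shows "is_category (over_cat u k)"
  unfolding over_cat_def
proof (rule is_category_mk, goal_cases)
  case (3 a' a)
  obtain x' g' y' x g y where eq: "a' = (x', g', y')" "a = (x, g, y)" by (metis prod_cases3)
  have "Comp (Tgt u) (snd y') (Comp (Tgt u) (MapA u g') (MapA u g)) =
      Comp (Tgt u) (Comp (Tgt u) (snd y') (MapA u g')) (MapA u g)"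
    by (rule comp_assoc[symmetric]) (use 3 assms in \<open>auto simp: eq over_obj_def\<close>)
  then show ?case using 3 assms by (auto simp: eq)
next
  case (5 c b a)
  then show ?case using assms by (auto simp: comp_assoc)
qed (use assms in \<open>auto simp: over_obj_def\<close>)

lemma is_category_under_cat:
  assumes "is_functor u"
  shows "is_category (under_cat u k)"
  unfolding under_cat_def
proof (rule is_category_mk, goal_cases)
  case (3 a' a)
  obtain x' g' y' x g y where eq: "a' = (x', g', y')" "a = (x, g, y)" by (metis prod_cases3)
  have "Comp (Tgt u) (Comp (Tgt u) (MapA u g') (MapA u g)) (snd x) =
      Comp (Tgt u) (MapA u g') (Comp (Tgt u) (MapA u g) (snd x))"
    by (rule comp_assoc) (use 3 assms in \<open>auto simp: eq under_obj_def\<close>)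
  then show ?case using 3 assms by (auto simp: eq)
next
  case (5 c b a)
  then show ?case using assms by (auto simp: comp_assoc)
qed (use assms in \<open>auto simp: under_obj_def\<close>)

lemma over_cat_simps:
  shows "Obj (over_cat u k) = over_obj u k"
    and "(x, g, y) \<in> Arr (over_cat u k) \<longleftrightarrow> x \<in> over_obj u k \<and> y \<in> over_obj u k \<and> g \<in> Arr (Src u) \<and>
      Dom (Src u) g = fst x \<and> Cod (Src u) g = fst y \<and> Comp (Tgt u) (snd y) (MapA u g) = snd x"
    and "a \<in> Arr (over_cat u k) \<Longrightarrow> Dom (over_cat u k) a = fst a"
    and "a \<in> Arr (over_cat u k) \<Longrightarrow> Cod (over_cat u k) a = snd (snd a)"
    and "x \<in> over_obj u k \<Longrightarrow> Id (over_cat u k) x = (x, Id (Src u) (fst x), x)"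
    and "\<lbrakk>(x', g', y') \<in> Arr (over_cat u k); (x, g, x') \<in> Arr (over_cat u k)\<rbrakk>
      \<Longrightarrow> Comp (over_cat u k) (x', g', y') (x, g, x') = (x, Comp (Src u) g' g, y')"
  by (auto simp: over_cat_def split: prod.split)

lemma under_cat_simps:
  shows "Obj (under_cat u k) = under_obj u k"
    and "(x, g, y) \<in> Arr (under_cat u k) \<longleftrightarrow> x \<in> under_obj u k \<and> y \<in> under_obj u k \<and> g \<in> Arr (Src u) \<and>
      Dom (Src u) g = fst x \<and> Cod (Src u) g = fst y \<and> Comp (Tgt u) (MapA u g) (snd x) = snd y"
    and "a \<in> Arr (under_cat u k) \<Longrightarrow> Dom (under_cat u k) a = fst a"
    and "a \<in> Arr (under_cat u k) \<Longrightarrow> Cod (under_cat u k) a = snd (snd a)"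
    and "x \<in> under_obj u k \<Longrightarrow> Id (under_cat u k) x = (x, Id (Src u) (fst x), x)"
    and "\<lbrakk>(x', g', y') \<in> Arr (under_cat u k); (x, g, x') \<in> Arr (under_cat u k)\<rbrakk>
      \<Longrightarrow> Comp (under_cat u k) (x', g', y') (x, g, x') = (x, Comp (Src u) g' g, y')"
  by (auto simp: under_cat_def split: prod.split)

lemma over_objD:
  assumes "x \<in> over_obj u k"
  shows "fst x \<in> Obj (Src u)" "snd x \<in> Arr (Tgt u)" "Dom (Tgt u) (snd x) = MapO u (fst x)" "Cod (Tgt u) (snd x) = k"
  using assms by (auto simp: over_obj_def)

lemma under_objD:
  assumes "x \<in> under_obj u k"
  shows "fst x \<in> Obj (Src u)" "snd x \<in> Arr (Tgt u)" "Dom (Tgt u) (snd x) = k" "Cod (Tgt u) (snd x) = MapO u (fst x)"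
  using assms by (auto simp: under_obj_def)

lemma small_slice_sets:
  fixes u :: "'u small_functor"
  assumes "small_fun u" "X \<subseteq> Obj (Src u) \<times> Arr (Tgt u)" "A \<subseteq> X \<times> Arr (Src u) \<times> X"
  shows "X \<prec> (UNIV :: 'u set)" "A \<prec> (UNIV :: 'u set)"
proof -
  have sm: "Obj (Src u) \<prec> (UNIV :: 'u set)" "Arr (Src u) \<prec> (UNIV :: 'u set)" "Arr (Tgt u) \<prec> (UNIV :: 'u set)"
    using small_fun_simps(2,3)[OF assms(1)] unfolding small_cat_def by blast+
  show X: "X \<prec> (UNIV :: 'u set)"
    using subset_imp_lepoll[OF assms(2)] lesspoll_Times[OF infinite_UNIV sm(1) sm(3)] by (rule lesspoll_trans1)
  show "A \<prec> (UNIV :: 'u set)"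
    using subset_imp_lepoll[OF assms(3)] lesspoll_Times[OF infinite_UNIV X lesspoll_Times[OF infinite_UNIV sm(2) X]]
    by (rule lesspoll_trans1)
qed

lemma small_cat_over [simp]:
  fixes u :: "'u small_functor"
  assumes "small_fun u"
  shows "small_cat (over u k)"
  unfolding over_def
proof (rule small_cat_encode)
  have X: "over_obj u k \<subseteq> Obj (Src u) \<times> Arr (Tgt u)"
    by (auto simp: over_obj_def)
  have A: "Arr (over_cat u k) \<subseteq> over_obj u k \<times> Arr (Src u) \<times> over_obj u k"
    by (auto simp: over_cat_simps)
  show "Obj (over_cat u k) \<prec> (UNIV :: 'u set)" "Arr (over_cat u k) \<prec> (UNIV :: 'u set)"
    using small_slice_sets[OF assms X A] by (auto simp: over_cat_simps)
qed (use assms in \<open>simp_all add: is_category_over_cat\<close>)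

lemma small_cat_under [simp]:
  fixes u :: "'u small_functor"
  assumes "small_fun u"
  shows "small_cat (under u k)"
  unfolding under_def
proof (rule small_cat_encode)
  have X: "under_obj u k \<subseteq> Obj (Src u) \<times> Arr (Tgt u)"
    by (auto simp: under_obj_def)
  have A: "Arr (under_cat u k) \<subseteq> under_obj u k \<times> Arr (Src u) \<times> under_obj u k"
    by (auto simp: under_cat_simps)
  show "Obj (under_cat u k) \<prec> (UNIV :: 'u set)" "Arr (under_cat u k) \<prec> (UNIV :: 'u set)"
    using small_slice_sets[OF assms X A] by (auto simp: under_cat_simps)
qed (use assms in \<open>simp_all add: is_category_under_cat\<close>)

lemma Arr_over_iff:
  fixes u :: "'u small_functor"
  shows "enc a \<in> Arr (over u k) \<longleftrightarrow> a \<in> Arr (over_cat u k)"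
  by (simp add: over_def inj_image_mem_iff)

lemma over_simps [simp]:
  fixes u :: "'u small_functor" and x y x' y' :: "'u \<times> 'u"
  shows "enc x \<in> Obj (over u k) \<longleftrightarrow> x \<in> over_obj u k"
    and "enc (x, g, y) \<in> Arr (over u k) \<longleftrightarrow> x \<in> over_obj u k \<and> y \<in> over_obj u k \<and> g \<in> Arr (Src u) \<and>
      Dom (Src u) g = fst x \<and> Cod (Src u) g = fst y \<and> Comp (Tgt u) (snd y) (MapA u g) = snd x"
    and "enc (x, g, y) \<in> Arr (over u k) \<Longrightarrow> Dom (over u k) (enc (x, g, y)) = enc x"
    and "enc (x, g, y) \<in> Arr (over u k) \<Longrightarrow> Cod (over u k) (enc (x, g, y)) = enc y"
    and "x \<in> over_obj u k \<Longrightarrow> Id (over u k) (enc x) = enc (x, Id (Src u) (fst x), x)"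
    and "\<lbrakk>enc (x', g', y') \<in> Arr (over u k); enc (x, g, x') \<in> Arr (over u k)\<rbrakk>
      \<Longrightarrow> Comp (over u k) (enc (x', g', y')) (enc (x, g, x')) = enc (x, Comp (Src u) g' g, y')"
proof -
  note [simp] = Arr_over_iff
  show "enc x \<in> Obj (over u k) \<longleftrightarrow> x \<in> over_obj u k"
    by (simp add: over_def over_cat_simps(1) inj_image_mem_iff)
  show "x \<in> over_obj u k \<Longrightarrow> Id (over u k) (enc x) = enc (x, Id (Src u) (fst x), x)"
    by (simp add: over_def over_cat_simps(1,5))
  show "enc (x, g, y) \<in> Arr (over u k) \<longleftrightarrow> x \<in> over_obj u k \<and> y \<in> over_obj u k \<and> g \<in> Arr (Src u) \<and>
      Dom (Src u) g = fst x \<and> Cod (Src u) g = fst y \<and> Comp (Tgt u) (snd y) (MapA u g) = snd x"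
    by (simp add: over_cat_simps(2))
  show "enc (x, g, y) \<in> Arr (over u k) \<Longrightarrow> Dom (over u k) (enc (x, g, y)) = enc x"
    "enc (x, g, y) \<in> Arr (over u k) \<Longrightarrow> Cod (over u k) (enc (x, g, y)) = enc y"
    unfolding Arr_over_iff by (simp_all add: over_def over_cat_simps(3,4))
  show "\<lbrakk>enc (x', g', y') \<in> Arr (over u k); enc (x, g, x') \<in> Arr (over u k)\<rbrakk>
      \<Longrightarrow> Comp (over u k) (enc (x', g', y')) (enc (x, g, x')) = enc (x, Comp (Src u) g' g, y')"
    unfolding Arr_over_iff by (simp add: over_def over_cat_simps(3,4,6))
qed

lemma Arr_under_iff:
  fixes u :: "'u small_functor"
  shows "enc a \<in> Arr (under u k) \<longleftrightarrow> a \<in> Arr (under_cat u k)"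
  by (simp add: under_def inj_image_mem_iff)

lemma under_simps [simp]:
  fixes u :: "'u small_functor" and x y x' y' :: "'u \<times> 'u"
  shows "enc x \<in> Obj (under u k) \<longleftrightarrow> x \<in> under_obj u k"
    and "enc (x, g, y) \<in> Arr (under u k) \<longleftrightarrow> x \<in> under_obj u k \<and> y \<in> under_obj u k \<and> g \<in> Arr (Src u) \<and>
      Dom (Src u) g = fst x \<and> Cod (Src u) g = fst y \<and> Comp (Tgt u) (MapA u g) (snd x) = snd y"
    and "enc (x, g, y) \<in> Arr (under u k) \<Longrightarrow> Dom (under u k) (enc (x, g, y)) = enc x"
    and "enc (x, g, y) \<in> Arr (under u k) \<Longrightarrow> Cod (under u k) (enc (x, g, y)) = enc y"
    and "x \<in> under_obj u k \<Longrightarrow> Id (under u k) (enc x) = enc (x, Id (Src u) (fst x), x)"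
    and "\<lbrakk>enc (x', g', y') \<in> Arr (under u k); enc (x, g, x') \<in> Arr (under u k)\<rbrakk>
      \<Longrightarrow> Comp (under u k) (enc (x', g', y')) (enc (x, g, x')) = enc (x, Comp (Src u) g' g, y')"
proof -
  note [simp] = Arr_under_iff
  show "enc x \<in> Obj (under u k) \<longleftrightarrow> x \<in> under_obj u k"
    by (simp add: under_def under_cat_simps(1) inj_image_mem_iff)
  show "x \<in> under_obj u k \<Longrightarrow> Id (under u k) (enc x) = enc (x, Id (Src u) (fst x), x)"
    by (simp add: under_def under_cat_simps(1,5))
  show "enc (x, g, y) \<in> Arr (under u k) \<longleftrightarrow> x \<in> under_obj u k \<and> y \<in> under_obj u k \<and> g \<in> Arr (Src u) \<and>
      Dom (Src u) g = fst x \<and> Cod (Src u) g = fst y \<and> Comp (Tgt u) (MapA u g) (snd x) = snd y"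
    by (simp add: under_cat_simps(2))
  show "enc (x, g, y) \<in> Arr (under u k) \<Longrightarrow> Dom (under u k) (enc (x, g, y)) = enc x"
    "enc (x, g, y) \<in> Arr (under u k) \<Longrightarrow> Cod (under u k) (enc (x, g, y)) = enc y"
    unfolding Arr_under_iff by (simp_all add: under_def under_cat_simps(3,4))
  show "\<lbrakk>enc (x', g', y') \<in> Arr (under u k); enc (x, g, x') \<in> Arr (under u k)\<rbrakk>
      \<Longrightarrow> Comp (under u k) (enc (x', g', y')) (enc (x, g, x')) = enc (x, Comp (Src u) g' g, y')"
    unfolding Arr_under_iff by (simp add: under_def under_cat_simps(3,4,6))
qed

lemma Obj_overE:
  fixes u :: "'u small_functor"
  assumes "z \<in> Obj (over u k)" obtains x where "z = enc x" "x \<in> over_obj u k"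
  using assms by (auto simp: over_def over_cat_simps)

lemma Arr_overE:
  fixes u :: "'u small_functor"
  assumes "a \<in> Arr (over u k)"
      obtains x y :: "'u \<times> 'u" and g :: 'u where "a = enc (x, g, y)" "enc (x, g, y) \<in> Arr (over u k)"
proof -
  obtain b where b: "a = enc b" "b \<in> Arr (over_cat u k)" using assms by (auto simp: over_def)
  then show ?thesis using that by (cases b) (simp only: Arr_over_iff)
qed

lemma Obj_underE:
  fixes u :: "'u small_functor"
  assumes "z \<in> Obj (under u k)" obtains x where "z = enc x" "x \<in> under_obj u k"
  using assms by (auto simp: under_def under_cat_simps)

lemma Arr_underE:
  fixes u :: "'u small_functor"
  assumes "a \<in> Arr (under u k)"
      obtains x y :: "'u \<times> 'u" and g :: 'u where "a = enc (x, g, y)" "enc (x, g, y) \<in> Arr (under u k)"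
proof -
  obtain b where b: "a = enc b" "b \<in> Arr (under_cat u k)" using assms by (auto simp: under_def)
  then show ?thesis using that by (cases b) (simp only: Arr_under_iff)
qed

lemma small_cat_terminal [simp]: "small_cat (terminal :: 'u small_category)"
  unfolding terminal_def
  by (rule small_cat_encode)
    (auto simp: unit_cat_def intro!: is_category_mk finite_lesspoll_infinite infinite_UNIV)

lemma terminal_simps [simp]:
  "Obj (terminal :: 'u small_category) = {enc ()}" "Arr (terminal :: 'u small_category) = {enc ()}"
  "Dom (terminal :: 'u small_category) (enc ()) = enc ()" "Cod (terminal :: 'u small_category) (enc ()) = enc ()"
  "Id (terminal :: 'u small_category) (enc ()) = enc ()"
  "Comp (terminal :: 'u small_category) (enc ()) (enc ()) = enc ()"
  by (simp_all add: terminal_def unit_cat_def UNIV_unit)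

lemma to_terminal_simps [simp]:
  fixes C :: "'u small_category"
  shows "Src (to_terminal C) = C" "Tgt (to_terminal C) = terminal"
    and "x \<in> Obj C \<Longrightarrow> MapO (to_terminal C) x = enc ()" "f \<in> Arr C \<Longrightarrow> MapA (to_terminal C) f = enc ()"
    and "small_cat C \<Longrightarrow> small_fun (to_terminal C)"
  by (auto simp: to_terminal_def intro!: small_funI is_functor_mk)

lemma point_simps [simp]:
  fixes K :: "'u small_category"
  shows "Src (point K k) = terminal" "Tgt (point K k) = K"
    and "MapO (point K k) (enc ()) = k" "MapA (point K k) (enc ()) = Id K k"
    and "\<lbrakk>small_cat K; k \<in> Obj K\<rbrakk> \<Longrightarrow> small_fun (point K k)"
  by (auto simp: point_def intro!: small_funI is_functor_mk)

lemma to_terminal_compF: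
  fixes F :: "'u small_functor"
  assumes "small_fun F" "Tgt F = C"
  shows "to_terminal C \<odot> F = to_terminal (Src F)"
  by (rule functor_eqI) (use assms in auto)

lemma over_pr_simps [simp]:
  fixes u :: "'u small_functor" and x y :: "'u \<times> 'u"
  assumes "small_fun u"
  shows "Src (over_pr u k) = over u k" "Tgt (over_pr u k) = Src u"
    and "x \<in> over_obj u k \<Longrightarrow> MapO (over_pr u k) (enc x) = fst x"
    and "enc (x, g, y) \<in> Arr (over u k) \<Longrightarrow> MapA (over_pr u k) (enc (x, g, y)) = g"
    and "small_fun (over_pr u k)"
proof -
  let ?p = "mk_functor (over_cat u k) (Src u) fst (\<lambda>(x, g, y). g)"
  note [simp] = assms is_category_over_cat[of u]
  have p [simp]: "is_functor ?p"
    by (rule is_functor_mk) (auto simp: over_cat_simps over_obj_def)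
  show "Src (over_pr u k) = over u k" "Tgt (over_pr u k) = Src u"
    by (simp_all add: over_pr_def over_def)
  show "x \<in> over_obj u k \<Longrightarrow> MapO (over_pr u k) (enc x) = fst x"
    by (simp add: over_pr_def over_cat_simps)
  show "enc (x, g, y) \<in> Arr (over u k) \<Longrightarrow> MapA (over_pr u k) (enc (x, g, y)) = g"
    unfolding Arr_over_iff by (simp add: over_pr_def inj_image_mem_iff)
  show "small_fun (over_pr u k)"
    by (rule small_funI) (simp_all add: over_pr_def flip: over_def)
qed

lemma under_pr_simps [simp]:
  fixes u :: "'u small_functor" and x y :: "'u \<times> 'u"
  assumes "small_fun u"
  shows "Src (under_pr u k) = under u k" "Tgt (under_pr u k) = Src u"
    and "x \<in> under_obj u k \<Longrightarrow> MapO (under_pr u k) (enc x) = fst x"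
    and "enc (x, g, y) \<in> Arr (under u k) \<Longrightarrow> MapA (under_pr u k) (enc (x, g, y)) = g"
    and "small_fun (under_pr u k)"
proof -
  let ?p = "mk_functor (under_cat u k) (Src u) fst (\<lambda>(x, g, y). g)"
  note [simp] = assms is_category_under_cat[of u]
  have p [simp]: "is_functor ?p"
    by (rule is_functor_mk) (auto simp: under_cat_simps under_obj_def)
  show "Src (under_pr u k) = under u k" "Tgt (under_pr u k) = Src u"
    by (simp_all add: under_pr_def under_def)
  show "x \<in> under_obj u k \<Longrightarrow> MapO (under_pr u k) (enc x) = fst x"
    by (simp add: under_pr_def under_cat_simps)
  show "enc (x, g, y) \<in> Arr (under u k) \<Longrightarrow> MapA (under_pr u k) (enc (x, g, y)) = g"
    unfolding Arr_under_iff by (simp add: under_pr_def inj_image_mem_iff)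
  show "small_fun (under_pr u k)"
    by (rule small_funI) (simp_all add: under_pr_def flip: under_def)
qed

lemma over_cell_simps [simp]:
  fixes u :: "'u small_functor"
  assumes "small_fun u" "k \<in> Obj (Tgt u)"
  shows "DomF (over_cell u k) = u \<odot> over_pr u k"
    and "CodF (over_cell u k) = point (Tgt u) k \<odot> to_terminal (over u k)"
    and "x \<in> over_obj u k \<Longrightarrow> At (over_cell u k) (enc x) = snd x"
    and "small_nat (over_cell u k)"
proof -
  note [simp] = assms
  show "DomF (over_cell u k) = u \<odot> over_pr u k"
    and "CodF (over_cell u k) = point (Tgt u) k \<odot> to_terminal (over u k)"
    by (simp_all add: over_cell_def)
  show "x \<in> over_obj u k \<Longrightarrow> At (over_cell u k) (enc x) = snd x"
    by (simp add: over_cell_def)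
  show "small_nat (over_cell u k)"
    unfolding over_cell_def
  proof (rule small_natI[OF nat_trans_mk], goal_cases)
    case (5 z)
    then obtain x where "z = enc x" "x \<in> over_obj u k" by (auto elim: Obj_overE)
    with over_objD[OF this(2)] show ?case by simp
  next
    case (6 a)
    then obtain x y :: "'u \<times> 'u" and g :: 'u where "a = enc (x, g, y)" "enc (x, g, y) \<in> Arr (over u k)"
      by (auto elim: Arr_overE)
    with over_objD[of x u k] show ?case by simp
  qed simp_all
qed

lemma under_cell_simps [simp]:
  fixes u :: "'u small_functor"
  assumes "small_fun u" "k \<in> Obj (Tgt u)"
  shows "DomF (under_cell u k) = point (Tgt u) k \<odot> to_terminal (under u k)"
    and "CodF (under_cell u k) = u \<odot> under_pr u k"
    and "x \<in> under_obj u k \<Longrightarrow> At (under_cell u k) (enc x) = snd x"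
    and "small_nat (under_cell u k)"
proof -
  note [simp] = assms
  show "DomF (under_cell u k) = point (Tgt u) k \<odot> to_terminal (under u k)"
    and "CodF (under_cell u k) = u \<odot> under_pr u k"
    by (simp_all add: under_cell_def)
  show "x \<in> under_obj u k \<Longrightarrow> At (under_cell u k) (enc x) = snd x"
    by (simp add: under_cell_def)
  show "small_nat (under_cell u k)"
    unfolding under_cell_def
  proof (rule small_natI[OF nat_trans_mk], goal_cases)
    case (5 z)
    then obtain x where "z = enc x" "x \<in> under_obj u k" by (auto elim: Obj_underE)
    with under_objD[OF this(2)] show ?case by simp
  next
    case (6 a)
    then obtain x y :: "'u \<times> 'u" and g :: 'u where "a = enc (x, g, y)" "enc (x, g, y) \<in> Arr (under u k)"
      by (auto elim: Arr_underE)
    with under_objD[of x u k] under_objD[of y u k] show ?case by simp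
  qed simp_all
qed

lemma left_unitor_simps [simp]:
  fixes K :: "'u small_category"
  assumes "small_cat K"
  shows "Src (left_unitor K) = K" "Tgt (left_unitor K) = terminal \<otimes> K"
    and "x \<in> Obj K \<Longrightarrow> MapO (left_unitor K) x = enc (enc () :: 'u, x)"
    and "f \<in> Arr K \<Longrightarrow> MapA (left_unitor K) f = enc (enc () :: 'u, f)"
    and "small_fun (left_unitor K)"
proof -
  note [simp] = assms
  have [simp]: "is_functor (pairing (to_terminal K) (idF K))"
    unfolding pairing_def by (rule is_functor_mk) auto
  have [simp]: "Src (pairing (to_terminal K) (idF K)) = K"
    "Tgt (pairing (to_terminal K) (idF K)) = prod_cat terminal K"
    by (simp_all add: pairing_def)
  show "Src (left_unitor K) = K" "Tgt (left_unitor K) = terminal \<otimes> K"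
    "x \<in> Obj K \<Longrightarrow> MapO (left_unitor K) x = enc (enc () :: 'u, x)"
    "f \<in> Arr K \<Longrightarrow> MapA (left_unitor K) f = enc (enc () :: 'u, f)"
    by (simp_all add: left_unitor_def times_def) (simp_all add: pairing_def)
  show "small_fun (left_unitor K)"
    by (rule small_funI) (simp_all add: left_unitor_def flip: times_def)
qed

lemma insertion_simps [simp]:
  fixes M K :: "'u small_category"
  assumes "small_cat M" "small_cat K" "m \<in> Obj M"
  shows "Src (insertion M m K) = K" "Tgt (insertion M m K) = M \<otimes> K"
    and "x \<in> Obj K \<Longrightarrow> MapO (insertion M m K) x = enc (m, x)"
    and "f \<in> Arr K \<Longrightarrow> MapA (insertion M m K) f = enc (Id M m, f)"
    and "small_fun (insertion M m K)"
  unfolding insertion_def using assms by simp_all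

end

section \<open>Slices of a product with a fixed category\<close>

text \<open>Let \<open>A\<close> be the slice of \<open>u\<close> over \<open>k\<close>, and let \<open>B\<close> be the slice of \<open>id \<times> u\<close> over \<open>(m, k)\<close>. The section
  \<open>A \<rightarrow> B\<close> sends \<open>(j, h)\<close> to \<open>((m, j), (id, h))\<close>, and the projection \<open>B \<rightarrow> A\<close> forgets the components in
  \<open>M\<close>. They make \<open>A\<close> a reflective subcategory of \<open>B\<close>: the unit at \<open>((m', j), (f, h))\<close> is the arrow with
  components \<open>f : m' \<rightarrow> m\<close> and \<open>id\<close> (\<open>slice_leg\<close>). The same formulas make the slice of \<open>u\<close> under
  \<open>k\<close> a coreflective subcategory of the slice of \<open>id \<times> u\<close> under \<open>(m, k)\<close>. This is why source and target
  are parameters of the two functors.\<close>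

definition sec_obj :: "'u small_category \<Rightarrow> 'u \<Rightarrow> 'u \<times> 'u \<Rightarrow> 'u \<times> 'u" where
  "sec_obj M m x = (enc (m, fst x), enc (Id M m, snd x))"

definition proj_obj :: "'u \<times> 'u \<Rightarrow> 'u \<times> 'u" where
  "proj_obj x = (snd (inv enc (fst x) :: 'u \<times> 'u), snd (inv enc (snd x) :: 'u \<times> 'u))"

definition slice_section ::
    "'u small_category \<Rightarrow> 'u \<Rightarrow> 'u small_category \<Rightarrow> 'u small_category \<Rightarrow> 'u small_functor" where
  "slice_section M m A B = mk_functor A B
    (\<lambda>z. enc (sec_obj M m (inv enc z)))
    (\<lambda>a. case inv enc a of (x, g, y) \<Rightarrow> enc (sec_obj M m x, enc (Id M m, g :: 'u) :: 'u, sec_obj M m y))"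

definition slice_proj :: "'u small_category \<Rightarrow> 'u small_category \<Rightarrow> 'u small_functor" where
  "slice_proj B A = mk_functor B A
    (\<lambda>z. enc (proj_obj (inv enc z :: 'u \<times> 'u)))
    (\<lambda>a. case inv enc a of (x, g, y) \<Rightarrow>
      enc (proj_obj (x :: 'u \<times> 'u), snd (inv enc (g :: 'u) :: 'u \<times> 'u), proj_obj (y :: 'u \<times> 'u)))"

abbreviation over_section :: "'u small_category \<Rightarrow> 'u \<Rightarrow> 'u small_functor \<Rightarrow> 'u \<Rightarrow> 'u small_functor" where
  "over_section M m u k \<equiv> slice_section M m (over u k) (over (idF M \<otimes>\<^sub>F u) (enc (m, k)))"

abbreviation over_proj :: "'u small_category \<Rightarrow> 'u \<Rightarrow> 'u small_functor \<Rightarrow> 'u \<Rightarrow> 'u small_functor" where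
  "over_proj M m u k \<equiv> slice_proj (over (idF M \<otimes>\<^sub>F u) (enc (m, k))) (over u k)"

abbreviation under_section :: "'u small_category \<Rightarrow> 'u \<Rightarrow> 'u small_functor \<Rightarrow> 'u \<Rightarrow> 'u small_functor" where
  "under_section M m u k \<equiv> slice_section M m (under u k) (under (idF M \<otimes>\<^sub>F u) (enc (m, k)))"

abbreviation under_proj :: "'u small_category \<Rightarrow> 'u \<Rightarrow> 'u small_functor \<Rightarrow> 'u \<Rightarrow> 'u small_functor" where
  "under_proj M m u k \<equiv> slice_proj (under (idF M \<otimes>\<^sub>F u) (enc (m, k))) (under u k)"

definition slice_leg :: "'u small_functor \<Rightarrow> 'u \<times> 'u \<Rightarrow> 'u" where
  "slice_leg u x = enc (fst (inv enc (snd x) :: 'u \<times> 'u), Id (Src u) (snd (inv enc (fst x) :: 'u \<times> 'u)))"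

definition over_unit :: "'u small_category \<Rightarrow> 'u \<Rightarrow> 'u small_functor \<Rightarrow> 'u \<Rightarrow> 'u small_nat_transf" where
  "over_unit M m u k =
    mk_nat (idF (over (idF M \<otimes>\<^sub>F u) (enc (m, k)))) (over_section M m u k \<odot> over_proj M m u k)
      (\<lambda>z. let x = inv enc z in enc (x, slice_leg u x, sec_obj M m (proj_obj x)))"

definition under_counit :: "'u small_category \<Rightarrow> 'u \<Rightarrow> 'u small_functor \<Rightarrow> 'u \<Rightarrow> 'u small_nat_transf" where
  "under_counit M m u k =
    mk_nat (under_section M m u k \<odot> under_proj M m u k) (idF (under (idF M \<otimes>\<^sub>F u) (enc (m, k))))
      (\<lambda>z. let x = inv enc z in enc (sec_obj M m (proj_obj x), slice_leg u x, x))"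

context universe
begin

lemma proj_obj_simp [simp]:
  fixes m j f h :: 'u shows "proj_obj (enc (m, j), enc (f, h)) = (j, h)"
  by (simp add: proj_obj_def)

lemma sec_obj_simps [simp]: "fst (sec_obj M m x) = enc (m, fst x)" "snd (sec_obj M m x) = enc (Id M m, snd x)"
  by (simp_all add: sec_obj_def)

lemma sec_obj_pair [simp]: "sec_obj M m (j, h) = (enc (m, j), enc (Id M m, h))"
  by (simp add: sec_obj_def)

lemma over_obj_pair [simp]:
  "(j, h) \<in> over_obj u k \<longleftrightarrow> j \<in> Obj (Src u) \<and> h \<in> Arr (Tgt u) \<and> Dom (Tgt u) h = MapO u j \<and> Cod (Tgt u) h = k"
  by (simp add: over_obj_def)

lemma under_obj_pair [simp]:
  "(j, h) \<in> under_obj u k \<longleftrightarrow> j \<in> Obj (Src u) \<and> h \<in> Arr (Tgt u) \<and> Dom (Tgt u) h = k \<and> Cod (Tgt u) h = MapO u j"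
  by (simp add: under_obj_def)

lemma over_obj_timesE:
  fixes u :: "'u small_functor"
  assumes "x \<in> over_obj (idF M \<otimes>\<^sub>F u) (enc (m, k))" "small_cat M" "small_fun u"
  obtains m' j f h where "x = (enc (m', j), enc (f, h))" "m' \<in> Obj M" "j \<in> Obj (Src u)"
    "f \<in> Arr M" "h \<in> Arr (Tgt u)" "Dom M f = m'" "Cod M f = m" "Dom (Tgt u) h = MapO u j" "Cod (Tgt u) h = k"
  using assms by (auto simp: over_obj_def elim!: Obj_timesE Arr_timesE)

lemma under_obj_timesE:
  fixes u :: "'u small_functor"
  assumes "x \<in> under_obj (idF M \<otimes>\<^sub>F u) (enc (m, k))" "small_cat M" "small_fun u"
  obtains m' j f h where "x = (enc (m', j), enc (f, h))" "m' \<in> Obj M" "j \<in> Obj (Src u)"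
    "f \<in> Arr M" "h \<in> Arr (Tgt u)" "Cod M f = m'" "Dom M f = m" "Cod (Tgt u) h = MapO u j" "Dom (Tgt u) h = k"
  using assms by (auto simp: under_obj_def elim!: Obj_timesE Arr_timesE)

lemma insertion_point:
  fixes M K :: "'u small_category"
  assumes "small_cat M" "small_cat K" "m \<in> Obj M" "k \<in> Obj K"
  shows "insertion M m K \<odot> point K k = point (M \<otimes> K) (enc (m, k))"
  by (rule functor_eqI) (use assms in auto)

lemma insertion_natural:
  fixes u :: "'u small_functor"
  assumes "small_cat M" "small_fun u" "m \<in> Obj M"
  shows "(idF M \<otimes>\<^sub>F u) \<odot> insertion M m (Src u) = insertion M m (Tgt u) \<odot> u"
  by (rule functor_eqI) (use assms in auto)

lemma proj_sec_obj [simp]: "proj_obj (sec_obj M m x) = (x :: 'u \<times> 'u)"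
  by (cases x) simp

lemma slice_leg_simp [simp]:
  fixes m j f h :: 'u shows "slice_leg u (enc (m, j), enc (f, h)) = enc (f, Id (Src u) j)"
  by (simp add: slice_leg_def)

context
  fixes M :: "'u small_category" and m k :: 'u and u :: "'u small_functor"
  assumes M [simp]: "small_cat M" and m [simp]: "m \<in> Obj M" and u [simp]: "small_fun u"
    and k [simp]: "k \<in> Obj (Tgt u)"
begin

lemma sec_over_obj [simp]: "x \<in> over_obj u k \<Longrightarrow> sec_obj M m x \<in> over_obj (idF M \<otimes>\<^sub>F u) (enc (m, k))"
  by (cases x) simp

lemma proj_over_obj [simp]: "x \<in> over_obj (idF M \<otimes>\<^sub>F u) (enc (m, k)) \<Longrightarrow> proj_obj x \<in> over_obj u k"
  by (erule over_obj_timesE) simp_all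

lemma over_section_simps [simp]:
  fixes x y :: "'u \<times> 'u" and g :: 'u
  shows "x \<in> over_obj u k \<Longrightarrow> MapO (over_section M m u k) (enc x) = enc (sec_obj M m x)"
    "enc (x, g, y) \<in> Arr (over u k) \<Longrightarrow>
      MapA (over_section M m u k) (enc (x, g, y)) = enc (sec_obj M m x, enc (Id M m, g) :: 'u, sec_obj M m y)"
    "Src (over_section M m u k) = over u k"
    "Tgt (over_section M m u k) = over (idF M \<otimes>\<^sub>F u) (enc (m, k))"
    "small_fun (over_section M m u k)"
proof -
  show "x \<in> over_obj u k \<Longrightarrow> MapO (over_section M m u k) (enc x) = enc (sec_obj M m x)"
    "enc (x, g, y) \<in> Arr (over u k) \<Longrightarrow>
      MapA (over_section M m u k) (enc (x, g, y)) = enc (sec_obj M m x, enc (Id M m, g) :: 'u, sec_obj M m y)"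
    "Src (over_section M m u k) = over u k"
    "Tgt (over_section M m u k) = over (idF M \<otimes>\<^sub>F u) (enc (m, k))"
    unfolding slice_section_def by (simp_all del: over_simps(2))
  show "small_fun (over_section M m u k)"
    unfolding slice_section_def
  proof (rule small_funI[OF is_functor_mk], goal_cases)
    case (3 z)
    then show ?case by (elim Obj_overE) simp
  next
    case (4 a)
    then obtain x y :: "'u \<times> 'u" and g :: 'u where a: "a = enc (x, g, y)" "enc (x, g, y) \<in> Arr (over u k)"
      by (auto elim: Arr_overE)
    then show ?case using over_objD[of x u k] over_objD[of y u k] by simp
  next
    case (5 z)
    then obtain x where x: "z = enc x" "x \<in> over_obj u k" by (auto elim: Obj_overE)
    then show ?case using over_objD[OF x(2)] by simp
  next
    case (6 b a)
    then obtain x y :: "'u \<times> 'u" and g :: 'u where a: "a = enc (x, g, y)" "enc (x, g, y) \<in> Arr (over u k)"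
      by (auto elim: Arr_overE)
    from 6 obtain x' y' :: "'u \<times> 'u" and g' :: 'u where b: "b = enc (x', g', y')" "enc (x', g', y') \<in> Arr (over u k)"
      by (auto elim: Arr_overE)
    have [simp]: "x' = y" using 6 a b by (simp del: over_simps(2))
    \<comment> \<open>values on the composite can be evaluated once the composite is known to be an arrow of the slice\<close>
    have "enc (x, Comp (Src u) g' g, y') \<in> Arr (over u k)"
      using category_simps(6)[OF _ 6(1,2,3)] a b by (simp del: over_simps(2))
    with a b show ?case using over_objD[of x u k] over_objD[of y u k] over_objD[of y' u k]
      by simp
  qed simp_all
qed

lemma over_timesE:
  fixes x y :: "'u \<times> 'u" and g :: 'u
  assumes "enc (x, g, y) \<in> Arr (over (idF M \<otimes>\<^sub>F u) (enc (m, k)))"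
  obtains m1 j1 f1 h1 m2 j2 f2 h2 g1 g2 :: 'u where
    "x = (enc (m1, j1), enc (f1, h1))" "y = (enc (m2, j2), enc (f2, h2))" "g = enc (g1, g2)"
    "m1 \<in> Obj M" "j1 \<in> Obj (Src u)" "f1 \<in> Arr M" "h1 \<in> Arr (Tgt u)"
    "Dom M f1 = m1" "Cod M f1 = m" "Dom (Tgt u) h1 = MapO u j1" "Cod (Tgt u) h1 = k"
    "m2 \<in> Obj M" "j2 \<in> Obj (Src u)" "f2 \<in> Arr M" "h2 \<in> Arr (Tgt u)"
    "Dom M f2 = m2" "Cod M f2 = m" "Dom (Tgt u) h2 = MapO u j2" "Cod (Tgt u) h2 = k"
    "g1 \<in> Arr M" "g2 \<in> Arr (Src u)" "Dom M g1 = m1" "Dom (Src u) g2 = j1" "Cod M g1 = m2" "Cod (Src u) g2 = j2"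
    "Comp M f2 g1 = f1" "Comp (Tgt u) h2 (MapA u g2) = h1"
proof -
  have x: "x \<in> over_obj (idF M \<otimes>\<^sub>F u) (enc (m, k))" and y: "y \<in> over_obj (idF M \<otimes>\<^sub>F u) (enc (m, k))"
    and "g \<in> Arr (M \<otimes> Src u)"
    using assms by simp_all
  then obtain g1 g2 where g: "g = enc (g1, g2)" "g1 \<in> Arr M" "g2 \<in> Arr (Src u)" by (auto elim: Arr_timesE)
  show ?thesis
    by (rule over_obj_timesE[OF x M u], rule over_obj_timesE[OF y M u], rule that, assumption+)
      (use assms g in simp_all)
qed

lemma over_proj_simps [simp]:
  fixes x y :: "'u \<times> 'u" and g1 g2 :: 'u
  shows "x \<in> over_obj (idF M \<otimes>\<^sub>F u) (enc (m, k)) \<Longrightarrow> MapO (over_proj M m u k) (enc x) = enc (proj_obj x)"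
    "enc (x, enc (g1, g2) :: 'u, y) \<in> Arr (over (idF M \<otimes>\<^sub>F u) (enc (m, k))) \<Longrightarrow>
      MapA (over_proj M m u k) (enc (x, enc (g1, g2) :: 'u, y)) = enc (proj_obj x, g2, proj_obj y)"
    "Src (over_proj M m u k) = over (idF M \<otimes>\<^sub>F u) (enc (m, k))"
    "Tgt (over_proj M m u k) = over u k"
    "small_fun (over_proj M m u k)"
proof -
  show "x \<in> over_obj (idF M \<otimes>\<^sub>F u) (enc (m, k)) \<Longrightarrow> MapO (over_proj M m u k) (enc x) = enc (proj_obj x)"
    "enc (x, enc (g1, g2) :: 'u, y) \<in> Arr (over (idF M \<otimes>\<^sub>F u) (enc (m, k))) \<Longrightarrow>
      MapA (over_proj M m u k) (enc (x, enc (g1, g2) :: 'u, y)) = enc (proj_obj x, g2, proj_obj y)"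
    "Src (over_proj M m u k) = over (idF M \<otimes>\<^sub>F u) (enc (m, k))"
    "Tgt (over_proj M m u k) = over u k"
    unfolding slice_proj_def by (simp_all del: over_simps(2))
  show "small_fun (over_proj M m u k)"
    unfolding slice_proj_def
  proof (rule small_funI[OF is_functor_mk], goal_cases)
    case (3 z)
    then show ?case by (elim Obj_overE) simp
  next
    case (4 a)
    then obtain x y :: "'u \<times> 'u" and g :: 'u
      where a: "a = enc (x, g, y)" "enc (x, g, y) \<in> Arr (over (idF M \<otimes>\<^sub>F u) (enc (m, k)))"
      by (auto elim: Arr_overE)
    from a(2) show ?case by (rule over_timesE) (use a in simp)
  next
    case (5 z)
    then obtain x where x: "z = enc x" "x \<in> over_obj (idF M \<otimes>\<^sub>F u) (enc (m, k))" by (auto elim: Obj_overE)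
    from x(2) M u show ?case by (rule over_obj_timesE) (use x in simp)
  next
    case (6 b a)
    then obtain x y :: "'u \<times> 'u" and g :: 'u
      where a: "a = enc (x, g, y)" "enc (x, g, y) \<in> Arr (over (idF M \<otimes>\<^sub>F u) (enc (m, k)))"
      by (auto elim: Arr_overE)
    from 6 obtain x' y' :: "'u \<times> 'u" and g' :: 'u
      where b: "b = enc (x', g', y')" "enc (x', g', y') \<in> Arr (over (idF M \<otimes>\<^sub>F u) (enc (m, k)))"
      by (auto elim: Arr_overE)
    have xy: "x' = y" using 6 a b by (simp del: over_simps(2))
    from a(2) show ?case
    proof (rule over_timesE, goal_cases)
      case a': 1
      from b(2) show ?case
      proof (rule over_timesE, goal_cases)
        case b': 1
        \<comment> \<open>values on the composite can be evaluated once the composite is known to be an arrow of the slice\<close>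
        have "enc (x, Comp (M \<otimes> Src u) g' g, y') \<in> Arr (over (idF M \<otimes>\<^sub>F u) (enc (m, k)))"
          using category_simps(6)[OF _ 6(1,2,3)] a b xy by (simp del: over_simps(2))
        then show ?case using a b xy a' b' by (simp add: comp_assoc)
      qed
    qed
  qed simp_all
qed

lemma over_proj_section: "over_proj M m u k \<odot> over_section M m u k = idF (over u k)"
proof (rule functor_eqI)
  show "MapO (over_proj M m u k \<odot> over_section M m u k) z = MapO (idF (over u k)) z"
    if "z \<in> Obj (Src (idF (over u k)))" for z
    using that by (auto elim!: Obj_overE)
  show "MapA (over_proj M m u k \<odot> over_section M m u k) a = MapA (idF (over u k)) a"
    if a: "a \<in> Arr (Src (idF (over u k)))" for a
  proof -
    from a obtain x y :: "'u \<times> 'u" and g :: 'u where x: "a = enc (x, g, y)" "enc (x, g, y) \<in> Arr (over u k)"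
      by (auto elim: Arr_overE)
    have "MapA (over_section M m u k) a \<in> Arr (over (idF M \<otimes>\<^sub>F u) (enc (m, k)))"
      using a by (simp del: over_simps)
    with x show ?thesis by (simp del: over_simps(2))
  qed
qed simp_all

lemma over_pr_section: "over_pr (idF M \<otimes>\<^sub>F u) (enc (m, k)) \<odot> over_section M m u k =
    insertion M m (Src u) \<odot> over_pr u k"
proof (rule functor_eqI)
  show "MapO (over_pr (idF M \<otimes>\<^sub>F u) (enc (m, k)) \<odot> over_section M m u k) z =
      MapO (insertion M m (Src u) \<odot> over_pr u k) z"
    if "z \<in> Obj (Src (insertion M m (Src u) \<odot> over_pr u k))" for z
    using that by (auto elim!: Obj_overE dest: over_objD)
  show "MapA (over_pr (idF M \<otimes>\<^sub>F u) (enc (m, k)) \<odot> over_section M m u k) a =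
      MapA (insertion M m (Src u) \<odot> over_pr u k) a"
    if a: "a \<in> Arr (Src (insertion M m (Src u) \<odot> over_pr u k))" for a
  proof -
    from a obtain x y :: "'u \<times> 'u" and g :: 'u where x: "a = enc (x, g, y)" "enc (x, g, y) \<in> Arr (over u k)"
      by (auto elim: Arr_overE)
    have "MapA (over_section M m u k) a \<in> Arr (over (idF M \<otimes>\<^sub>F u) (enc (m, k)))"
      using a by (simp del: over_simps)
    moreover have "g \<in> Arr (Src u)" using x by simp
    ultimately show ?thesis using x by (simp del: over_simps(2))
  qed
qed simp_all

lemma over_unit_simps [simp]:
  "DomF (over_unit M m u k) = idF (over (idF M \<otimes>\<^sub>F u) (enc (m, k)))"
  "CodF (over_unit M m u k) = over_section M m u k \<odot> over_proj M m u k"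
  "x \<in> over_obj (idF M \<otimes>\<^sub>F u) (enc (m, k)) \<Longrightarrow> At (over_unit M m u k) (enc x) =
    enc (x, slice_leg u x, sec_obj M m (proj_obj x))"
  "small_nat (over_unit M m u k)"
proof -
  show "DomF (over_unit M m u k) = idF (over (idF M \<otimes>\<^sub>F u) (enc (m, k)))"
    "CodF (over_unit M m u k) = over_section M m u k \<odot> over_proj M m u k"
    "x \<in> over_obj (idF M \<otimes>\<^sub>F u) (enc (m, k)) \<Longrightarrow> At (over_unit M m u k) (enc x) =
      enc (x, slice_leg u x, sec_obj M m (proj_obj x))"
    by (simp_all add: over_unit_def Let_def)
  show "small_nat (over_unit M m u k)"
    unfolding over_unit_def
  proof (rule small_natI[OF nat_trans_mk], goal_cases)
    case (5 z)
    then obtain x where x: "z = enc x" "x \<in> over_obj (idF M \<otimes>\<^sub>F u) (enc (m, k))" by (auto elim: Obj_overE)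
    from x(2) M u show ?case by (rule over_obj_timesE) (use x in simp)
  next
    case (6 a)
    then obtain x y :: "'u \<times> 'u" and g :: 'u
      where a: "a = enc (x, g, y)" "enc (x, g, y) \<in> Arr (over (idF M \<otimes>\<^sub>F u) (enc (m, k)))"
      by (auto elim: Arr_overE)
    from a(2) show ?case by (rule over_timesE) (use a in simp)
  qed simp_all
qed

lemma over_proj_unit: "idN (over_proj M m u k) \<star> over_unit M m u k = idN (over_proj M m u k)"
proof (rule nat_eqI)
  show "At (idN (over_proj M m u k) \<star> over_unit M m u k) z = At (idN (over_proj M m u k)) z"
    if "z \<in> Obj (Src (DomF (idN (over_proj M m u k))))" for z
  proof -
    from that obtain x where x: "z = enc x" "x \<in> over_obj (idF M \<otimes>\<^sub>F u) (enc (m, k))" by (auto elim: Obj_overE)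
    from x(2) M u show ?thesis by (rule over_obj_timesE) (use x in simp)
  qed
qed (simp_all add: over_proj_section flip: compF_assoc)

lemma over_unit_section: "over_unit M m u k \<star> idN (over_section M m u k) = idN (over_section M m u k)"
proof (rule nat_eqI)
  show "At (over_unit M m u k \<star> idN (over_section M m u k)) z = At (idN (over_section M m u k)) z"
    if "z \<in> Obj (Src (DomF (idN (over_section M m u k))))" for z
  proof -
    from that obtain j h :: 'u where x: "z = enc (j, h)" "(j, h) \<in> over_obj u k" by (auto elim: Obj_overE)
    then show ?thesis by simp
  qed
qed (simp_all add: over_proj_section compF_assoc)

text \<open>Restricting the comma square of \<open>id \<times> u\<close> along the section leaves the comma square of \<open>u\<close>, followed by
  the inclusion of \<open>Tgt u\<close> into the product, because the section only inserts identities of \<open>M\<close>.\<close>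

lemma over_cell_section:
  "over_cell (idF M \<otimes>\<^sub>F u) (enc (m, k)) \<star> idN (over_section M m u k) = idN (insertion M m (Tgt u)) \<star> over_cell u k"
proof (rule nat_eqI)
  have 1: "(idF M \<otimes>\<^sub>F u) \<odot> over_pr (idF M \<otimes>\<^sub>F u) (enc (m, k)) \<odot> over_section M m u k =
      insertion M m (Tgt u) \<odot> (u \<odot> over_pr u k)"
    by (simp add: compF_assoc over_pr_section) (simp add: insertion_natural flip: compF_assoc)
  have 2: "point (M \<otimes> Tgt u) (enc (m, k)) \<odot> to_terminal (over (idF M \<otimes>\<^sub>F u) (enc (m, k))) \<odot> over_section M m u k =
      insertion M m (Tgt u) \<odot> (point (Tgt u) k \<odot> to_terminal (over u k))"
    by (simp add: compF_assoc to_terminal_compF) (simp add: insertion_point flip: compF_assoc)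
  show "DomF (over_cell (idF M \<otimes>\<^sub>F u) (enc (m, k)) \<star> idN (over_section M m u k)) =
      DomF (idN (insertion M m (Tgt u)) \<star> over_cell u k)"
    "CodF (over_cell (idF M \<otimes>\<^sub>F u) (enc (m, k)) \<star> idN (over_section M m u k)) =
        CodF (idN (insertion M m (Tgt u)) \<star> over_cell u k)"
    using 1 2 by simp_all
  show "At (over_cell (idF M \<otimes>\<^sub>F u) (enc (m, k)) \<star> idN (over_section M m u k)) z =
      At (idN (insertion M m (Tgt u)) \<star> over_cell u k) z"
    if "z \<in> Obj (Src (DomF (idN (insertion M m (Tgt u)) \<star> over_cell u k)))" for z
  proof -
    from that obtain j h :: 'u where x: "z = enc (j, h)" "(j, h) \<in> over_obj u k" by (auto elim: Obj_overE)
    then show ?thesis by simp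
  qed
qed simp_all

end

context
  fixes M :: "'u small_category" and m k :: 'u and u :: "'u small_functor"
  assumes M [simp]: "small_cat M" and m [simp]: "m \<in> Obj M" and u [simp]: "small_fun u"
    and k [simp]: "k \<in> Obj (Tgt u)"
begin

lemma sec_under_obj [simp]: "x \<in> under_obj u k \<Longrightarrow> sec_obj M m x \<in> under_obj (idF M \<otimes>\<^sub>F u) (enc (m, k))"
  by (cases x) simp

lemma proj_under_obj [simp]: "x \<in> under_obj (idF M \<otimes>\<^sub>F u) (enc (m, k)) \<Longrightarrow> proj_obj x \<in> under_obj u k"
  by (erule under_obj_timesE) simp_all

lemma under_section_simps [simp]:
  fixes x y :: "'u \<times> 'u" and g :: 'u
  shows "x \<in> under_obj u k \<Longrightarrow> MapO (under_section M m u k) (enc x) = enc (sec_obj M m x)"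
    "enc (x, g, y) \<in> Arr (under u k) \<Longrightarrow>
      MapA (under_section M m u k) (enc (x, g, y)) = enc (sec_obj M m x, enc (Id M m, g) :: 'u, sec_obj M m y)"
    "Src (under_section M m u k) = under u k"
    "Tgt (under_section M m u k) = under (idF M \<otimes>\<^sub>F u) (enc (m, k))"
    "small_fun (under_section M m u k)"
proof -
  show "x \<in> under_obj u k \<Longrightarrow> MapO (under_section M m u k) (enc x) = enc (sec_obj M m x)"
    "enc (x, g, y) \<in> Arr (under u k) \<Longrightarrow>
      MapA (under_section M m u k) (enc (x, g, y)) = enc (sec_obj M m x, enc (Id M m, g) :: 'u, sec_obj M m y)"
    "Src (under_section M m u k) = under u k"
    "Tgt (under_section M m u k) = under (idF M \<otimes>\<^sub>F u) (enc (m, k))"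
    unfolding slice_section_def by (simp_all del: under_simps(2))
  show "small_fun (under_section M m u k)"
    unfolding slice_section_def
  proof (rule small_funI[OF is_functor_mk], goal_cases)
    case (3 z)
    then show ?case by (elim Obj_underE) simp
  next
    case (4 a)
    then obtain x y :: "'u \<times> 'u" and g :: 'u where a: "a = enc (x, g, y)" "enc (x, g, y) \<in> Arr (under u k)"
      by (auto elim: Arr_underE)
    then show ?case using under_objD[of x u k] under_objD[of y u k] by simp
  next
    case (5 z)
    then obtain x where x: "z = enc x" "x \<in> under_obj u k" by (auto elim: Obj_underE)
    then show ?case using under_objD[OF x(2)] by simp
  next
    case (6 b a)
    then obtain x y :: "'u \<times> 'u" and g :: 'u where a: "a = enc (x, g, y)" "enc (x, g, y) \<in> Arr (under u k)"
      by (auto elim: Arr_underE)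
    from 6 obtain x' y' :: "'u \<times> 'u" and g' :: 'u where b: "b = enc (x', g', y')" "enc (x', g', y') \<in> Arr (under u k)"
      by (auto elim: Arr_underE)
    have [simp]: "x' = y" using 6 a b by (simp del: under_simps(2))
    \<comment> \<open>values on the composite can be evaluated once the composite is known to be an arrow of the slice\<close>
    have "enc (x, Comp (Src u) g' g, y') \<in> Arr (under u k)"
      using category_simps(6)[OF _ 6(1,2,3)] a b by (simp del: under_simps(2))
    with a b show ?case using under_objD[of x u k] under_objD[of y u k] under_objD[of y' u k]
      by simp
  qed simp_all
qed

lemma under_timesE:
  fixes x y :: "'u \<times> 'u" and g :: 'u
  assumes "enc (x, g, y) \<in> Arr (under (idF M \<otimes>\<^sub>F u) (enc (m, k)))"
  obtains m1 j1 f1 h1 m2 j2 f2 h2 g1 g2 :: 'u where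
    "x = (enc (m1, j1), enc (f1, h1))" "y = (enc (m2, j2), enc (f2, h2))" "g = enc (g1, g2)"
    "m1 \<in> Obj M" "j1 \<in> Obj (Src u)" "f1 \<in> Arr M" "h1 \<in> Arr (Tgt u)"
    "Cod M f1 = m1" "Dom M f1 = m" "Cod (Tgt u) h1 = MapO u j1" "Dom (Tgt u) h1 = k"
    "m2 \<in> Obj M" "j2 \<in> Obj (Src u)" "f2 \<in> Arr M" "h2 \<in> Arr (Tgt u)"
    "Cod M f2 = m2" "Dom M f2 = m" "Cod (Tgt u) h2 = MapO u j2" "Dom (Tgt u) h2 = k"
    "g1 \<in> Arr M" "g2 \<in> Arr (Src u)" "Dom M g1 = m1" "Dom (Src u) g2 = j1" "Cod M g1 = m2" "Cod (Src u) g2 = j2"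
    "Comp M g1 f1 = f2" "Comp (Tgt u) (MapA u g2) h1 = h2"
proof -
  have x: "x \<in> under_obj (idF M \<otimes>\<^sub>F u) (enc (m, k))" and y: "y \<in> under_obj (idF M \<otimes>\<^sub>F u) (enc (m, k))"
    and "g \<in> Arr (M \<otimes> Src u)"
    using assms by simp_all
  then obtain g1 g2 where g: "g = enc (g1, g2)" "g1 \<in> Arr M" "g2 \<in> Arr (Src u)" by (auto elim: Arr_timesE)
  show ?thesis
    by (rule under_obj_timesE[OF x M u], rule under_obj_timesE[OF y M u], rule that, assumption+)
      (use assms g in simp_all)
qed

lemma under_proj_simps [simp]:
  fixes x y :: "'u \<times> 'u" and g1 g2 :: 'u
  shows "x \<in> under_obj (idF M \<otimes>\<^sub>F u) (enc (m, k)) \<Longrightarrow> MapO (under_proj M m u k) (enc x) = enc (proj_obj x)"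
    "enc (x, enc (g1, g2) :: 'u, y) \<in> Arr (under (idF M \<otimes>\<^sub>F u) (enc (m, k))) \<Longrightarrow>
      MapA (under_proj M m u k) (enc (x, enc (g1, g2) :: 'u, y)) = enc (proj_obj x, g2, proj_obj y)"
    "Src (under_proj M m u k) = under (idF M \<otimes>\<^sub>F u) (enc (m, k))"
    "Tgt (under_proj M m u k) = under u k"
    "small_fun (under_proj M m u k)"
proof -
  show "x \<in> under_obj (idF M \<otimes>\<^sub>F u) (enc (m, k)) \<Longrightarrow> MapO (under_proj M m u k) (enc x) = enc (proj_obj x)"
    "enc (x, enc (g1, g2) :: 'u, y) \<in> Arr (under (idF M \<otimes>\<^sub>F u) (enc (m, k))) \<Longrightarrow>
      MapA (under_proj M m u k) (enc (x, enc (g1, g2) :: 'u, y)) = enc (proj_obj x, g2, proj_obj y)"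
    "Src (under_proj M m u k) = under (idF M \<otimes>\<^sub>F u) (enc (m, k))"
    "Tgt (under_proj M m u k) = under u k"
    unfolding slice_proj_def by (simp_all del: under_simps(2))
  show "small_fun (under_proj M m u k)"
    unfolding slice_proj_def
  proof (rule small_funI[OF is_functor_mk], goal_cases)
    case (3 z)
    then show ?case by (elim Obj_underE) simp
  next
    case (4 a)
    then obtain x y :: "'u \<times> 'u" and g :: 'u
      where a: "a = enc (x, g, y)" "enc (x, g, y) \<in> Arr (under (idF M \<otimes>\<^sub>F u) (enc (m, k)))"
      by (auto elim: Arr_underE)
    from a(2) show ?case by (rule under_timesE) (use a in simp)
  next
    case (5 z)
    then obtain x where x: "z = enc x" "x \<in> under_obj (idF M \<otimes>\<^sub>F u) (enc (m, k))" by (auto elim: Obj_underE)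
    from x(2) M u show ?case by (rule under_obj_timesE) (use x in simp)
  next
    case (6 b a)
    then obtain x y :: "'u \<times> 'u" and g :: 'u
      where a: "a = enc (x, g, y)" "enc (x, g, y) \<in> Arr (under (idF M \<otimes>\<^sub>F u) (enc (m, k)))"
      by (auto elim: Arr_underE)
    from 6 obtain x' y' :: "'u \<times> 'u" and g' :: 'u
      where b: "b = enc (x', g', y')" "enc (x', g', y') \<in> Arr (under (idF M \<otimes>\<^sub>F u) (enc (m, k)))"
      by (auto elim: Arr_underE)
    have xy: "x' = y" using 6 a b by (simp del: under_simps(2))
    from a(2) show ?case
    proof (rule under_timesE, goal_cases)
      case a': 1
      from b(2) show ?case
      proof (rule under_timesE, goal_cases)
        case b': 1
        \<comment> \<open>values on the composite can be evaluated once the composite is known to be an arrow of the slice\<close>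
        have "enc (x, Comp (M \<otimes> Src u) g' g, y') \<in> Arr (under (idF M \<otimes>\<^sub>F u) (enc (m, k)))"
          using category_simps(6)[OF _ 6(1,2,3)] a b xy by (simp del: under_simps(2))
        then show ?case using a b xy a' b' by (simp add: comp_assoc)
      qed
    qed
  qed simp_all
qed

lemma under_proj_section: "under_proj M m u k \<odot> under_section M m u k = idF (under u k)"
proof (rule functor_eqI)
  show "MapO (under_proj M m u k \<odot> under_section M m u k) z = MapO (idF (under u k)) z"
    if "z \<in> Obj (Src (idF (under u k)))" for z
    using that by (auto elim!: Obj_underE)
  show "MapA (under_proj M m u k \<odot> under_section M m u k) a = MapA (idF (under u k)) a"
    if a: "a \<in> Arr (Src (idF (under u k)))" for a
  proof -
    from a obtain x y :: "'u \<times> 'u" and g :: 'u where x: "a = enc (x, g, y)" "enc (x, g, y) \<in> Arr (under u k)"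
      by (auto elim: Arr_underE)
    have "MapA (under_section M m u k) a \<in> Arr (under (idF M \<otimes>\<^sub>F u) (enc (m, k)))"
      using a by (simp del: under_simps)
    with x show ?thesis by (simp del: under_simps(2))
  qed
qed simp_all

lemma under_pr_section: "under_pr (idF M \<otimes>\<^sub>F u) (enc (m, k)) \<odot> under_section M m u k =
    insertion M m (Src u) \<odot> under_pr u k"
proof (rule functor_eqI)
  show "MapO (under_pr (idF M \<otimes>\<^sub>F u) (enc (m, k)) \<odot> under_section M m u k) z =
      MapO (insertion M m (Src u) \<odot> under_pr u k) z"
    if "z \<in> Obj (Src (insertion M m (Src u) \<odot> under_pr u k))" for z
    using that by (auto elim!: Obj_underE dest: under_objD)
  show "MapA (under_pr (idF M \<otimes>\<^sub>F u) (enc (m, k)) \<odot> under_section M m u k) a =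
      MapA (insertion M m (Src u) \<odot> under_pr u k) a"
    if a: "a \<in> Arr (Src (insertion M m (Src u) \<odot> under_pr u k))" for a
  proof -
    from a obtain x y :: "'u \<times> 'u" and g :: 'u where x: "a = enc (x, g, y)" "enc (x, g, y) \<in> Arr (under u k)"
      by (auto elim: Arr_underE)
    have "MapA (under_section M m u k) a \<in> Arr (under (idF M \<otimes>\<^sub>F u) (enc (m, k)))"
      using a by (simp del: under_simps)
    moreover have "g \<in> Arr (Src u)" using x by simp
    ultimately show ?thesis using x by (simp del: under_simps(2))
  qed
qed simp_all

lemma under_counit_simps [simp]:
  "CodF (under_counit M m u k) = idF (under (idF M \<otimes>\<^sub>F u) (enc (m, k)))"
  "DomF (under_counit M m u k) = under_section M m u k \<odot> under_proj M m u k"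
  "x \<in> under_obj (idF M \<otimes>\<^sub>F u) (enc (m, k)) \<Longrightarrow> At (under_counit M m u k) (enc x) =
    enc (sec_obj M m (proj_obj x), slice_leg u x, x)"
  "small_nat (under_counit M m u k)"
proof -
  show "CodF (under_counit M m u k) = idF (under (idF M \<otimes>\<^sub>F u) (enc (m, k)))"
    "DomF (under_counit M m u k) = under_section M m u k \<odot> under_proj M m u k"
    "x \<in> under_obj (idF M \<otimes>\<^sub>F u) (enc (m, k)) \<Longrightarrow> At (under_counit M m u k) (enc x) =
      enc (sec_obj M m (proj_obj x), slice_leg u x, x)"
    by (simp_all add: under_counit_def Let_def)
  show "small_nat (under_counit M m u k)"
    unfolding under_counit_def
  proof (rule small_natI[OF nat_trans_mk], goal_cases)
    case (5 z)
    then obtain x where x: "z = enc x" "x \<in> under_obj (idF M \<otimes>\<^sub>F u) (enc (m, k))" by (auto elim: Obj_underE)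
    from x(2) M u show ?case by (rule under_obj_timesE) (use x in simp)
  next
    case (6 a)
    then obtain x y :: "'u \<times> 'u" and g :: 'u
      where a: "a = enc (x, g, y)" "enc (x, g, y) \<in> Arr (under (idF M \<otimes>\<^sub>F u) (enc (m, k)))"
      by (auto elim: Arr_underE)
    from a(2) show ?case by (rule under_timesE) (use a in simp)
  qed simp_all
qed

lemma under_proj_counit: "idN (under_proj M m u k) \<star> under_counit M m u k = idN (under_proj M m u k)"
proof (rule nat_eqI)
  show "At (idN (under_proj M m u k) \<star> under_counit M m u k) z = At (idN (under_proj M m u k)) z"
    if "z \<in> Obj (Src (DomF (idN (under_proj M m u k))))" for z
  proof -
    from that obtain x where x: "z = enc x" "x \<in> under_obj (idF M \<otimes>\<^sub>F u) (enc (m, k))" by (auto elim: Obj_underE)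
    from x(2) M u show ?thesis by (rule under_obj_timesE) (use x in simp)
  qed
qed (simp_all add: under_proj_section flip: compF_assoc)

lemma under_counit_section: "under_counit M m u k \<star> idN (under_section M m u k) = idN (under_section M m u k)"
proof (rule nat_eqI)
  show "At (under_counit M m u k \<star> idN (under_section M m u k)) z = At (idN (under_section M m u k)) z"
    if "z \<in> Obj (Src (DomF (idN (under_section M m u k))))" for z
  proof -
    from that obtain j h :: 'u where x: "z = enc (j, h)" "(j, h) \<in> under_obj u k" by (auto elim: Obj_underE)
    then show ?thesis by simp
  qed
qed (simp_all add: under_proj_section compF_assoc)

lemma under_cell_section:
  "under_cell (idF M \<otimes>\<^sub>F u) (enc (m, k)) \<star> idN (under_section M m u k) = idN (insertion M m (Tgt u)) \<star> under_cell u k"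
proof (rule nat_eqI)
  have 1: "(idF M \<otimes>\<^sub>F u) \<odot> under_pr (idF M \<otimes>\<^sub>F u) (enc (m, k)) \<odot> under_section M m u k =
      insertion M m (Tgt u) \<odot> (u \<odot> under_pr u k)"
    by (simp add: compF_assoc under_pr_section) (simp add: insertion_natural flip: compF_assoc)
  have 2: "point (M \<otimes> Tgt u) (enc (m, k)) \<odot> to_terminal (under (idF M \<otimes>\<^sub>F u) (enc (m, k))) \<odot> under_section M m u k =
      insertion M m (Tgt u) \<odot> (point (Tgt u) k \<odot> to_terminal (under u k))"
    by (simp add: compF_assoc to_terminal_compF) (simp add: insertion_point flip: compF_assoc)
  show "DomF (under_cell (idF M \<otimes>\<^sub>F u) (enc (m, k)) \<star> idN (under_section M m u k)) =
      DomF (idN (insertion M m (Tgt u)) \<star> under_cell u k)"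
    "CodF (under_cell (idF M \<otimes>\<^sub>F u) (enc (m, k)) \<star> idN (under_section M m u k)) =
        CodF (idN (insertion M m (Tgt u)) \<star> under_cell u k)"
    using 1 2 by simp_all
  show "At (under_cell (idF M \<otimes>\<^sub>F u) (enc (m, k)) \<star> idN (under_section M m u k)) z =
      At (idN (insertion M m (Tgt u)) \<star> under_cell u k) z"
    if "z \<in> Obj (Src (DomF (idN (insertion M m (Tgt u)) \<star> under_cell u k)))" for z
  proof -
    from that obtain j h :: 'u where x: "z = enc (j, h)" "(j, h) \<in> under_obj u k" by (auto elim: Obj_underE)
    then show ?thesis by simp
  qed
qed simp_all

end

end

section \<open>Derivators\<close>

locale derivator_in_universe = prederivator_in_universe U D + derivator D
  for U :: "'u itself" and D :: "('u, 'o, 'a) prederivator"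
begin

text \<open>The base change map of (Der4) at \<open>X\<close> is the transpose of this arrow.\<close>

lemma over_universal_arrow:
  assumes u: "small_fun u" and k: "k \<in> Obj (Tgt u)" and adj: "adjunction l (D1 D u) \<eta> \<epsilon>"
    and X: "X \<in> Obj (D0 D (Src u))"
  shows "universal_arrow (D1 D (to_terminal (over u k))) (MapO (D1 D (over_pr u k)) X)
    (MapO (D1 D (point (Tgt u) k)) (MapO l X))
    (Comp (D0 D (over u k)) (At (D2 D (over_cell u k)) (MapO l X)) (MapA (D1 D (over_pr u k)) (At \<eta> X)))"
proof -
  note a = adjunction_simps[OF adj]
  note [simp] = u k X
  have [simp]: "Src l = D0 D (Src u)" "Tgt l = D0 D (Tgt u)" using a(3,4) by auto
  note [simp] = a(1,5-)
  obtain p \<eta>' \<epsilon>' where adj': "adjunction p (D1 D (to_terminal (over u k))) \<eta>' \<epsilon>'"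
    using Der3_left[of "to_terminal (over u k)"] unfolding has_left_adjoint_def by auto
  note b = adjunction_simps[OF adj']
  have [simp]: "Src p = D0 D (over u k)" "Tgt p = D0 D terminal" using b(3,4) by auto
  note [simp] = b(1,5-)
  have "iso_arr (D0 D terminal) (At (base_change_left D u k l \<eta> p \<epsilon>') X)"
    using Der4_left[OF u k adj adj'] by (simp add: nat_iso_def)
  then have "iso_arr (Tgt p) (Comp (Tgt p) (At \<epsilon>' (MapO (D1 D (point (Tgt u) k)) (MapO l X)))
      (MapA p (Comp (D0 D (over u k)) (At (D2 D (over_cell u k)) (MapO l X))
        (MapA (D1 D (over_pr u k)) (At \<eta> X)))))"
    by (simp add: base_change_left_def D1_compF comp_assoc)
  then show ?thesis
    by (subst universal_arrow_iff_iso_transpose[OF adj']) (auto simp: arrow_def D1_compF)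
qed

lemma under_universal_arrow:
  assumes u: "small_fun u" and k: "k \<in> Obj (Tgt u)" and adj: "adjunction (D1 D u) r \<eta> \<epsilon>"
    and X: "X \<in> Obj (D0 D (Src u))"
  shows "universal_arrow (op_functor (D1 D (to_terminal (under u k)))) (MapO (D1 D (under_pr u k)) X)
    (MapO (D1 D (point (Tgt u) k)) (MapO r X))
    (Comp (D0 D (under u k)) (MapA (D1 D (under_pr u k)) (At \<epsilon> X)) (At (D2 D (under_cell u k)) (MapO r X)))"
proof -
  note a = adjunction_simps[OF adj]
  note [simp] = u k X
  have [simp]: "Src r = D0 D (Src u)" "Tgt r = D0 D (Tgt u)" using a(3,4) by auto
  note [simp] = a(2,5-)
  obtain p \<eta>' \<epsilon>' where adj': "adjunction (D1 D (to_terminal (under u k))) p \<eta>' \<epsilon>'"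
    using Der3_right[of "to_terminal (under u k)"] unfolding has_right_adjoint_def by auto
  note b = adjunction_simps[OF adj']
  have [simp]: "Src p = D0 D (under u k)" "Tgt p = D0 D terminal" using b(3,4) by auto
  note [simp] = b(2,5-)
  have "iso_arr (D0 D terminal) (At (base_change_right D u k r \<epsilon> p \<eta>') X)"
    using Der4_right[OF u k adj adj'] by (simp add: nat_iso_def)
  then have "iso_arr (Tgt p) (Comp (Tgt p)
      (MapA p (Comp (D0 D (under u k)) (MapA (D1 D (under_pr u k)) (At \<epsilon> X))
        (At (D2 D (under_cell u k)) (MapO r X))))
      (At \<eta>' (MapO (D1 D (point (Tgt u) k)) (MapO r X))))"
    by (simp add: base_change_right_def D1_compF comp_assoc)
  then show ?thesis
    by (subst universal_arrow_iff_iso_transpose[OF adjunction_op[OF adj']]) (auto simp: arrow_def D1_compF)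
qed

context
  fixes M :: "'u small_category" and m :: 'u and u :: "'u small_functor"
  assumes M [simp]: "small_cat M" and m [simp]: "m \<in> Obj M" and u [simp]: "small_fun u"
begin

text \<open>The detecting family consists of the restrictions to all objects \<open>k\<close>, pasted with the comma
  squares of \<open>u\<close>. For the arrow \<open>insertion\<^sup>* (\<eta> X)\<close>, the pasted arrow is the restriction along the
  section of the arrow that (Der4) provides for \<open>id \<times> u\<close> at \<open>(m, k)\<close>.
  In terms of mates, evaluation at \<open>m\<close> preserves left Kan extensions.\<close>

lemma insertion_universal_arrow:
  assumes adj: "adjunction l (D1 D (idF M \<otimes>\<^sub>F u)) \<eta> \<epsilon>" and X [simp]: "X \<in> Obj (D0 D (M \<otimes> Src u))"
  shows "universal_arrow (D1 D u) (MapO (D1 D (insertion M m (Src u))) X)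
    (MapO (D1 D (insertion M m (Tgt u))) (MapO l X)) (MapA (D1 D (insertion M m (Src u))) (At \<eta> X))"
proof -
  note a = adjunction_simps[OF adj]
  have [simp]: "Src l = D0 D (M \<otimes> Src u)" "Tgt l = D0 D (M \<otimes> Tgt u)" using a(3,4) by auto
  note [simp] = a(1,5-)
  obtain l0 \<eta>0 \<epsilon>0 where adj0: "adjunction l0 (D1 D u) \<eta>0 \<epsilon>0"
    using Der3_left[OF u] unfolding has_left_adjoint_def by auto
  have [simp]: "Src l0 = D0 D (Src u)" using adjunction_simps(4)[OF adj0] by simp
  have comm: "MapO (D1 D (insertion M m (Src u))) (MapO (D1 D (idF M \<otimes>\<^sub>F u)) Y) =
      MapO (D1 D u) (MapO (D1 D (insertion M m (Tgt u))) Y)" if "Y \<in> Obj (D0 D (M \<otimes> Tgt u))" for Y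
    using that by (simp add: D1_comp_simps insertion_natural)
  show ?thesis
  proof (rule universal_arrow_pointwise[where I = "Obj (Tgt u)" and k = "\<lambda>k. D1 D (point (Tgt u) k)"
        and r = "\<lambda>k. D1 D (over_pr u k)" and p = "\<lambda>k. D1 D (to_terminal (over u k))"
        and a = "\<lambda>k. D2 D (over_cell u k)"])
    show "universal_arrow (D1 D u) (MapO (D1 D (insertion M m (Src u))) X)
        (MapO l0 (MapO (D1 D (insertion M m (Src u))) X)) (At \<eta>0 (MapO (D1 D (insertion M m (Src u))) X))"
      by (rule adjunction_universal_arrow[OF adj0]) simp
    fix k assume k [simp]: "k \<in> Obj (Tgt u)"
    show "universal_arrow (D1 D (to_terminal (over u k)))
        (MapO (D1 D (over_pr u k)) (MapO (D1 D (insertion M m (Src u))) X))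
        (MapO (D1 D (point (Tgt u) k)) (MapO l0 (MapO (D1 D (insertion M m (Src u))) X)))
        (Comp (Tgt (D1 D (over_pr u k)))
          (At (D2 D (over_cell u k)) (MapO l0 (MapO (D1 D (insertion M m (Src u))) X)))
          (MapA (D1 D (over_pr u k)) (At \<eta>0 (MapO (D1 D (insertion M m (Src u))) X))))"
      using over_universal_arrow[OF u k adj0, of "MapO (D1 D (insertion M m (Src u))) X"] by simp
    let ?S = "over_section M m u k" and ?T = "over_proj M m u k" and ?U = "idF M \<otimes>\<^sub>F u" and ?k = "enc (m, k)"
    \<comment> \<open>the projection to the point factors through \<open>?T\<close>, so \<open>?T\<^sup>*\<close> sends constant diagrams to constant diagrams\<close>
    have to_T: "D1 D (to_terminal (over ?U ?k)) = D1 D ?T \<odot> D1 D (to_terminal (over u k))"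
      by (simp add: to_terminal_compF flip: D1_compF)
    have "universal_arrow (D1 D (to_terminal (over u k)))
        (MapO (D1 D ?S) (MapO (D1 D (over_pr ?U ?k)) X))
        (MapO (D1 D (point (Tgt ?U) ?k)) (MapO l X))
        (MapA (D1 D ?S) (Comp (D0 D (over ?U ?k)) (At (D2 D (over_cell ?U ?k)) (MapO l X))
          (MapA (D1 D (over_pr ?U ?k)) (At \<eta> X))))"
    proof (rule universal_arrow_section[where T = "D1 D ?T" and \<eta> = "D2 D (over_unit M m u k)"])
      show "universal_arrow (D1 D ?T \<odot> D1 D (to_terminal (over u k))) (MapO (D1 D (over_pr ?U ?k)) X)
          (MapO (D1 D (point (Tgt ?U) ?k)) (MapO l X))
          (Comp (D0 D (over ?U ?k)) (At (D2 D (over_cell ?U ?k)) (MapO l X))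
            (MapA (D1 D (over_pr ?U ?k)) (At \<eta> X)))"
        unfolding to_T[symmetric] by (rule over_universal_arrow[OF _ _ adj]) simp_all
      show "nat_trans (D2 D (over_unit M m u k)) (idF (Src (D1 D ?S))) (D1 D ?T \<odot> D1 D ?S)"
        by (simp add: nat_trans_def D1_compF)
      show "D1 D ?S \<odot> D1 D ?T = idF (Src (D1 D ?T))"
        by (simp add: over_proj_section flip: D1_compF)
      show "MapA (D1 D ?S) (At (D2 D (over_unit M m u k)) Y) = Id (Tgt (D1 D ?S)) (MapO (D1 D ?S) Y)"
        if "Y \<in> Obj (Src (D1 D ?S))" for Y
        using that At_D2_whisker_right[of "over_unit M m u k" ?S Y]
        by (simp add: over_unit_section)
      show "At (D2 D (over_unit M m u k)) (MapO (D1 D ?T) Y) = Id (Src (D1 D ?S)) (MapO (D1 D ?T) Y)"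
        if "Y \<in> Obj (Src (D1 D ?T))" for Y
        using that At_D2_whisker_left[of "over_unit M m u k" ?T Y]
        by (simp add: over_proj_unit)
    qed simp_all
    \<comment> \<open>the restricted arrow is the one that belongs to the comma square of \<open>u\<close>\<close>
    moreover have "MapA (D1 D ?S) (At (D2 D (over_cell ?U ?k)) (MapO l X)) =
        At (D2 D (over_cell u k)) (MapO (D1 D (insertion M m (Tgt u))) (MapO l X))"
      using At_D2_whisker_right[of "over_cell ?U ?k" ?S "MapO l X"]
        At_D2_whisker_left[of "over_cell u k" "insertion M m (Tgt u)" "MapO l X"]
      by (simp add: over_cell_section)
    moreover have "MapA (D1 D ?S) (MapA (D1 D (over_pr ?U ?k)) (At \<eta> X)) =
        MapA (D1 D (over_pr u k)) (MapA (D1 D (insertion M m (Src u))) (At \<eta> X))"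
      by (simp add: D1_comp_simps over_pr_section)
    moreover have "MapO (D1 D ?S) (MapO (D1 D (over_pr ?U ?k)) X) =
        MapO (D1 D (over_pr u k)) (MapO (D1 D (insertion M m (Src u))) X)"
      by (simp add: D1_comp_simps over_pr_section)
    moreover have "MapO (D1 D (point (M \<otimes> Tgt u) ?k)) (MapO l X) =
        MapO (D1 D (point (Tgt u) k)) (MapO (D1 D (insertion M m (Tgt u))) (MapO l X))"
      by (simp add: D1_comp_simps insertion_point)
    ultimately show "universal_arrow (D1 D (to_terminal (over u k)))
        (MapO (D1 D (over_pr u k)) (MapO (D1 D (insertion M m (Src u))) X))
        (MapO (D1 D (point (Tgt u) k)) (MapO (D1 D (insertion M m (Tgt u))) (MapO l X)))
        (Comp (Tgt (D1 D (over_pr u k)))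
          (At (D2 D (over_cell u k)) (MapO (D1 D (insertion M m (Tgt u))) (MapO l X)))
          (MapA (D1 D (over_pr u k)) (MapA (D1 D (insertion M m (Src u))) (At \<eta> X))))"
      by (simp add: D1_compF)
    show "nat_trans (D2 D (over_cell u k)) (D1 D (over_pr u k) \<odot> D1 D u)
        (D1 D (to_terminal (over u k)) \<odot> D1 D (point (Tgt u) k))"
      by (simp add: nat_trans_def D1_compF)
  next
    fix g assume g: "g \<in> Arr (Src (D1 D u))"
      and iso: "\<And>k. k \<in> Obj (Tgt u) \<Longrightarrow> iso_arr (Tgt (D1 D (point (Tgt u) k))) (MapA (D1 D (point (Tgt u) k)) g)"
    have "iso_arr (D0 D (Tgt u)) g"
      by (subst Der2) (use g iso in auto)
    then show "iso_arr (Src (D1 D u)) g" by simp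
  qed (simp_all add: arrow_def comm)
qed

text \<open>The dual argument. Restriction is contravariant on functors but covariant on transformations, so the
  counit of the coreflection of slices under \<open>k\<close> gives the unit that \<open>universal_arrow_section\<close> needs in the
  opposite categories.\<close>

lemma insertion_couniversal_arrow:
  assumes adj: "adjunction (D1 D (idF M \<otimes>\<^sub>F u)) r \<eta> \<epsilon>" and X [simp]: "X \<in> Obj (D0 D (M \<otimes> Src u))"
  shows "universal_arrow (op_functor (D1 D u)) (MapO (D1 D (insertion M m (Src u))) X)
    (MapO (D1 D (insertion M m (Tgt u))) (MapO r X)) (MapA (D1 D (insertion M m (Src u))) (At \<epsilon> X))"
proof -
  note a = adjunction_simps[OF adj]
  have [simp]: "Src r = D0 D (M \<otimes> Src u)" "Tgt r = D0 D (M \<otimes> Tgt u)" using a(3,4) by auto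
  note [simp] = a(2,5-)
  obtain r0 \<eta>0 \<epsilon>0 where adj0: "adjunction (D1 D u) r0 \<eta>0 \<epsilon>0"
    using Der3_right[OF u] unfolding has_right_adjoint_def by auto
  have [simp]: "Src r0 = D0 D (Src u)" using adjunction_simps(3)[OF adj0] by simp
  have comm: "MapO (D1 D (insertion M m (Src u))) (MapO (D1 D (idF M \<otimes>\<^sub>F u)) Y) =
      MapO (D1 D u) (MapO (D1 D (insertion M m (Tgt u))) Y)" if "Y \<in> Obj (D0 D (M \<otimes> Tgt u))" for Y
    using that by (simp add: D1_comp_simps insertion_natural)
  show ?thesis
  proof (rule universal_arrow_pointwise[where I = "Obj (Tgt u)"
        and k = "\<lambda>k. op_functor (D1 D (point (Tgt u) k))"
        and r = "\<lambda>k. op_functor (D1 D (under_pr u k))"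
        and p = "\<lambda>k. op_functor (D1 D (to_terminal (under u k)))"
        and a = "\<lambda>k. op_nat (D2 D (under_cell u k))"])
    show "universal_arrow (op_functor (D1 D u)) (MapO (D1 D (insertion M m (Src u))) X)
        (MapO r0 (MapO (D1 D (insertion M m (Src u))) X)) (At \<epsilon>0 (MapO (D1 D (insertion M m (Src u))) X))"
      using adjunction_universal_arrow[OF adjunction_op[OF adj0], of "MapO (D1 D (insertion M m (Src u))) X"]
      by simp
    fix k assume k [simp]: "k \<in> Obj (Tgt u)"
    show "universal_arrow (op_functor (D1 D (to_terminal (under u k))))
        (MapO (op_functor (D1 D (under_pr u k))) (MapO (D1 D (insertion M m (Src u))) X))
        (MapO (op_functor (D1 D (point (Tgt u) k))) (MapO r0 (MapO (D1 D (insertion M m (Src u))) X)))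
        (Comp (Tgt (op_functor (D1 D (under_pr u k))))
          (At (op_nat (D2 D (under_cell u k))) (MapO r0 (MapO (D1 D (insertion M m (Src u))) X)))
          (MapA (op_functor (D1 D (under_pr u k))) (At \<epsilon>0 (MapO (D1 D (insertion M m (Src u))) X))))"
      using under_universal_arrow[OF u k adj0, of "MapO (D1 D (insertion M m (Src u))) X"] by simp
    let ?S = "under_section M m u k" and ?T = "under_proj M m u k" and ?U = "idF M \<otimes>\<^sub>F u" and ?k = "enc (m, k)"
    \<comment> \<open>the projection to the point factors through \<open>?T\<close>, so \<open>?T\<^sup>*\<close> sends constant diagrams to constant diagrams\<close>
    have to_T: "D1 D (to_terminal (under ?U ?k)) = D1 D ?T \<odot> D1 D (to_terminal (under u k))"
      by (simp add: to_terminal_compF flip: D1_compF)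
    have "universal_arrow (op_functor (D1 D (to_terminal (under u k))))
        (MapO (op_functor (D1 D ?S)) (MapO (D1 D (under_pr ?U ?k)) X))
        (MapO (D1 D (point (Tgt ?U) ?k)) (MapO r X))
        (MapA (op_functor (D1 D ?S)) (Comp (D0 D (under ?U ?k))
          (MapA (D1 D (under_pr ?U ?k)) (At \<epsilon> X)) (At (D2 D (under_cell ?U ?k)) (MapO r X))))"
    proof (rule universal_arrow_section[where T = "op_functor (D1 D ?T)"
        and \<eta> = "op_nat (D2 D (under_counit M m u k))"])
      show "universal_arrow (op_functor (D1 D ?T) \<odot> op_functor (D1 D (to_terminal (under u k))))
          (MapO (D1 D (under_pr ?U ?k)) X) (MapO (D1 D (point (Tgt ?U) ?k)) (MapO r X))
          (Comp (D0 D (under ?U ?k)) (MapA (D1 D (under_pr ?U ?k)) (At \<epsilon> X))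
            (At (D2 D (under_cell ?U ?k)) (MapO r X)))"
        unfolding op_compF[symmetric] to_T[symmetric] by (rule under_universal_arrow[OF _ _ adj]) simp_all
      show "nat_trans (op_nat (D2 D (under_counit M m u k))) (idF (Src (op_functor (D1 D ?S))))
          (op_functor (D1 D ?T) \<odot> op_functor (D1 D ?S))"
        by (simp add: nat_trans_def D1_compF op_idF op_compF)
      show "op_functor (D1 D ?S) \<odot> op_functor (D1 D ?T) = idF (Src (op_functor (D1 D ?T)))"
        by (simp add: under_proj_section op_idF flip: D1_compF op_compF)
      show "MapA (op_functor (D1 D ?S)) (At (op_nat (D2 D (under_counit M m u k))) Y) =
          Id (Tgt (op_functor (D1 D ?S))) (MapO (op_functor (D1 D ?S)) Y)"
        if "Y \<in> Obj (Src (op_functor (D1 D ?S)))" for Y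
        using that At_D2_whisker_right[of "under_counit M m u k" ?S Y]
        by (simp add: under_counit_section)
      show "At (op_nat (D2 D (under_counit M m u k))) (MapO (op_functor (D1 D ?T)) Y) =
          Id (Src (op_functor (D1 D ?S))) (MapO (op_functor (D1 D ?T)) Y)"
        if "Y \<in> Obj (Src (op_functor (D1 D ?T)))" for Y
        using that At_D2_whisker_left[of "under_counit M m u k" ?T Y]
        by (simp add: under_proj_counit)
    qed simp_all
    \<comment> \<open>the restricted arrow is the one that belongs to the comma square of \<open>u\<close>\<close>
    moreover have "MapA (D1 D ?S) (At (D2 D (under_cell ?U ?k)) (MapO r X)) =
        At (D2 D (under_cell u k)) (MapO (D1 D (insertion M m (Tgt u))) (MapO r X))"
      using At_D2_whisker_right[of "under_cell ?U ?k" ?S "MapO r X"]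
        At_D2_whisker_left[of "under_cell u k" "insertion M m (Tgt u)" "MapO r X"]
      by (simp add: under_cell_section)
    moreover have "MapA (D1 D ?S) (MapA (D1 D (under_pr ?U ?k)) (At \<epsilon> X)) =
        MapA (D1 D (under_pr u k)) (MapA (D1 D (insertion M m (Src u))) (At \<epsilon> X))"
      by (simp add: D1_comp_simps under_pr_section)
    moreover have "MapO (D1 D ?S) (MapO (D1 D (under_pr ?U ?k)) X) =
        MapO (D1 D (under_pr u k)) (MapO (D1 D (insertion M m (Src u))) X)"
      by (simp add: D1_comp_simps under_pr_section)
    moreover have "MapO (D1 D (point (M \<otimes> Tgt u) ?k)) (MapO r X) =
        MapO (D1 D (point (Tgt u) k)) (MapO (D1 D (insertion M m (Tgt u))) (MapO r X))"
      by (simp add: D1_comp_simps insertion_point)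
    ultimately show "universal_arrow (op_functor (D1 D (to_terminal (under u k))))
        (MapO (op_functor (D1 D (under_pr u k))) (MapO (D1 D (insertion M m (Src u))) X))
        (MapO (op_functor (D1 D (point (Tgt u) k))) (MapO (D1 D (insertion M m (Tgt u))) (MapO r X)))
        (Comp (Tgt (op_functor (D1 D (under_pr u k))))
          (At (op_nat (D2 D (under_cell u k))) (MapO (D1 D (insertion M m (Tgt u))) (MapO r X)))
          (MapA (op_functor (D1 D (under_pr u k))) (MapA (D1 D (insertion M m (Src u))) (At \<epsilon> X))))"
      by (simp add: D1_compF)
    show "nat_trans (op_nat (D2 D (under_cell u k))) (op_functor (D1 D (under_pr u k)) \<odot> op_functor (D1 D u))
        (op_functor (D1 D (to_terminal (under u k))) \<odot> op_functor (D1 D (point (Tgt u) k)))"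
      by (simp add: nat_trans_def D1_compF op_compF)
  next
    fix g assume g: "g \<in> Arr (Src (op_functor (D1 D u)))"
      and iso: "\<And>k. k \<in> Obj (Tgt u) \<Longrightarrow> iso_arr (Tgt (op_functor (D1 D (point (Tgt u) k))))
        (MapA (op_functor (D1 D (point (Tgt u) k))) g)"
    have "iso_arr (D0 D (Tgt u)) g"
      by (subst Der2) (use g iso in auto)
    then show "iso_arr (Src (op_functor (D1 D u))) g" by simp
  qed (simp_all add: arrow_def comm)
qed

end

text \<open>Every point of \<open>L \<times> K\<close> factors through one of the inclusions of \<open>K\<close>, so this follows from (Der2).\<close>

lemma iso_arr_if_insertion:
  assumes L: "small_cat L" and K: "small_cat K" and g: "g \<in> Arr (D0 D (L \<otimes> K))"
    and iso: "\<And>x. x \<in> Obj L \<Longrightarrow> iso_arr (D0 D K) (MapA (D1 D (insertion L x K)) g)"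
  shows "iso_arr (D0 D (L \<otimes> K)) g"
proof (subst Der2)
  show "\<forall>z\<in>Obj (L \<otimes> K). iso_arr (D0 D terminal) (MapA (D1 D (point (L \<otimes> K) z)) g)"
  proof
    fix z assume "z \<in> Obj (L \<otimes> K)"
    then obtain x k where z: "z = enc (x, k)" "x \<in> Obj L" "k \<in> Obj K" by (rule Obj_timesE)
    have "iso_arr (D0 D terminal) (MapA (D1 D (point K k)) (MapA (D1 D (insertion L x K)) g))"
      using Der2[of K "MapA (D1 D (insertion L x K)) g"] iso[OF z(2)] z L K g by auto
    then show "iso_arr (D0 D terminal) (MapA (D1 D (point (L \<otimes> K) z)) g)"
      using z L K g by (simp add: D1_comp_simps insertion_point)
  qed
qed (use assms in simp_all)

context
  fixes L M :: "'u small_category" and v u :: "'u small_functor"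
  assumes v [simp]: "small_fun v" and vL [simp]: "Src v = L" and vM [simp]: "Tgt v = M" and u [simp]: "small_fun u"
begin

lemma small_cats [simp]: "small_cat L" "small_cat M"
  using small_fun_simps(2,3)[OF v] by simp_all

lemma times_insertion:
  assumes "x \<in> Obj L" "small_cat K"
  shows "(v \<otimes>\<^sub>F idF K) \<odot> insertion L x K = insertion M (MapO v x) K"
proof -
  have "MapA v (Id L x) = Id M (MapO v x)" using functor_simps(7)[of v L x] assms by simp
  then show ?thesis by (intro functor_eqI) (use assms in auto)
qed

lemma times_interchange: "(idF M \<otimes>\<^sub>F u) \<odot> (v \<otimes>\<^sub>F idF (Src u)) = (v \<otimes>\<^sub>F idF (Tgt u)) \<odot> (idF L \<otimes>\<^sub>F u)"
  by (rule times_functor_eqI) auto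

text \<open>Here the detecting family consists of the evaluations at the objects \<open>x\<close> of \<open>L\<close>, with identity squares.
  One of the two pasted arrows is an evaluation at \<open>x\<close> for \<open>D\<^sup>L\<close>, the other one is an evaluation at \<open>v x\<close>
  for \<open>D\<^sup>M\<close>.\<close>

lemma pullback_universal_arrow:
  assumes adj: "adjunction l (D1 D (idF M \<otimes>\<^sub>F u)) \<eta> \<epsilon>" and X [simp]: "X \<in> Obj (D0 D (M \<otimes> Src u))"
  shows "universal_arrow (D1 D (idF L \<otimes>\<^sub>F u)) (MapO (D1 D (v \<otimes>\<^sub>F idF (Src u))) X)
    (MapO (D1 D (v \<otimes>\<^sub>F idF (Tgt u))) (MapO l X)) (MapA (D1 D (v \<otimes>\<^sub>F idF (Src u))) (At \<eta> X))"
proof -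
  note a = adjunction_simps[OF adj]
  have [simp]: "Src l = D0 D (M \<otimes> Src u)" "Tgt l = D0 D (M \<otimes> Tgt u)" using a(3,4) by auto
  note [simp] = a(1,5-)
  let ?X = "MapO (D1 D (v \<otimes>\<^sub>F idF (Src u))) X"
  obtain l0 \<eta>0 \<epsilon>0 where adj0: "adjunction l0 (D1 D (idF L \<otimes>\<^sub>F u)) \<eta>0 \<epsilon>0"
    using Der3_left[of "idF L \<otimes>\<^sub>F u"] unfolding has_left_adjoint_def by auto
  note a0 = adjunction_simps[OF adj0]
  have [simp]: "Src l0 = D0 D (L \<otimes> Src u)" "Tgt l0 = D0 D (L \<otimes> Tgt u)" using a0(3,4) by auto
  note [simp] = a0(1,5-)
  have comm: "MapO (D1 D (v \<otimes>\<^sub>F idF (Src u))) (MapO (D1 D (idF M \<otimes>\<^sub>F u)) Y) =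
      MapO (D1 D (idF L \<otimes>\<^sub>F u)) (MapO (D1 D (v \<otimes>\<^sub>F idF (Tgt u))) Y)" if "Y \<in> Obj (D0 D (M \<otimes> Tgt u))" for Y
    using that by (simp add: D1_comp_simps times_interchange)
  have comm_insertion: "D1 D (insertion L x (Src u)) \<odot> D1 D (idF L \<otimes>\<^sub>F u) = D1 D u \<odot> D1 D (insertion L x (Tgt u))"
    if "x \<in> Obj L" for x
    using that by (simp add: insertion_natural flip: D1_compF)
  have comm_insertionO: "MapO (D1 D (insertion L x (Src u))) (MapO (D1 D (idF L \<otimes>\<^sub>F u)) Y) =
      MapO (D1 D u) (MapO (D1 D (insertion L x (Tgt u))) Y)" if "x \<in> Obj L" "Y \<in> Obj (D0 D (L \<otimes> Tgt u))" for x Y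
    using that by (simp add: D1_comp_simps insertion_natural)
  show ?thesis
  proof (rule universal_arrow_pointwise[where I = "Obj L" and k = "\<lambda>x. D1 D (insertion L x (Tgt u))"
        and r = "\<lambda>x. D1 D (insertion L x (Src u))" and p = "\<lambda>x. D1 D u"
        and a = "\<lambda>x. idN (D1 D (insertion L x (Src u)) \<odot> D1 D (idF L \<otimes>\<^sub>F u))"])
    show "universal_arrow (D1 D (idF L \<otimes>\<^sub>F u)) ?X (MapO l0 ?X) (At \<eta>0 ?X)"
      by (rule adjunction_universal_arrow[OF adj0]) simp
    fix x assume x [simp]: "x \<in> Obj L"
    have x' [simp]: "MapO v x \<in> Obj M" using functor_simps(3)[of v M x] by simp
    show "nat_trans (idN (D1 D (insertion L x (Src u)) \<odot> D1 D (idF L \<otimes>\<^sub>F u)))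
        (D1 D (insertion L x (Src u)) \<odot> D1 D (idF L \<otimes>\<^sub>F u)) (D1 D u \<odot> D1 D (insertion L x (Tgt u)))"
      by (simp add: nat_trans_def comm_insertion)
    show "universal_arrow (D1 D u) (MapO (D1 D (insertion L x (Src u))) ?X)
        (MapO (D1 D (insertion L x (Tgt u))) (MapO l0 ?X))
        (Comp (Tgt (D1 D (insertion L x (Src u))))
            (At (idN (D1 D (insertion L x (Src u)) \<odot> D1 D (idF L \<otimes>\<^sub>F u))) (MapO l0 ?X))
          (MapA (D1 D (insertion L x (Src u))) (At \<eta>0 ?X)))"
      using insertion_universal_arrow[OF _ x u adj0, of ?X] by (simp add: comm_insertionO)
    show "universal_arrow (D1 D u) (MapO (D1 D (insertion L x (Src u))) ?X)
        (MapO (D1 D (insertion L x (Tgt u))) (MapO (D1 D (v \<otimes>\<^sub>F idF (Tgt u))) (MapO l X)))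
        (Comp (Tgt (D1 D (insertion L x (Src u))))
          (At (idN (D1 D (insertion L x (Src u)) \<odot> D1 D (idF L \<otimes>\<^sub>F u))) (MapO (D1 D (v \<otimes>\<^sub>F idF (Tgt u))) (MapO l X)))
          (MapA (D1 D (insertion L x (Src u))) (MapA (D1 D (v \<otimes>\<^sub>F idF (Src u))) (At \<eta> X))))"
      using insertion_universal_arrow[OF _ x' u adj X] by (simp add: comm flip: times_insertion) (simp add: D1_compF)
  next
    fix g assume g: "g \<in> Arr (Src (D1 D (idF L \<otimes>\<^sub>F u)))"
      and iso: "\<And>x. x \<in> Obj L \<Longrightarrow> iso_arr (Tgt (D1 D (insertion L x (Tgt u)))) (MapA (D1 D (insertion L x (Tgt u))) g)"
    then show "iso_arr (Src (D1 D (idF L \<otimes>\<^sub>F u))) g"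
      using iso_arr_if_insertion[of L "Tgt u" g] by simp
  qed (simp_all add: arrow_def comm)
qed

lemma pullback_couniversal_arrow:
  assumes adj: "adjunction (D1 D (idF M \<otimes>\<^sub>F u)) r \<eta> \<epsilon>" and X [simp]: "X \<in> Obj (D0 D (M \<otimes> Src u))"
  shows "universal_arrow (op_functor (D1 D (idF L \<otimes>\<^sub>F u))) (MapO (D1 D (v \<otimes>\<^sub>F idF (Src u))) X)
    (MapO (D1 D (v \<otimes>\<^sub>F idF (Tgt u))) (MapO r X)) (MapA (D1 D (v \<otimes>\<^sub>F idF (Src u))) (At \<epsilon> X))"
proof -
  note a = adjunction_simps[OF adj]
  have [simp]: "Src r = D0 D (M \<otimes> Src u)" "Tgt r = D0 D (M \<otimes> Tgt u)" using a(3,4) by auto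
  note [simp] = a(2,5-)
  let ?X = "MapO (D1 D (v \<otimes>\<^sub>F idF (Src u))) X"
  obtain r0 \<eta>0 \<epsilon>0 where adj0: "adjunction (D1 D (idF L \<otimes>\<^sub>F u)) r0 \<eta>0 \<epsilon>0"
    using Der3_right[of "idF L \<otimes>\<^sub>F u"] unfolding has_right_adjoint_def by auto
  note a0 = adjunction_simps[OF adj0]
  have [simp]: "Src r0 = D0 D (L \<otimes> Src u)" "Tgt r0 = D0 D (L \<otimes> Tgt u)" using a0(3,4) by auto
  note [simp] = a0(2,5-)
  have comm: "MapO (D1 D (v \<otimes>\<^sub>F idF (Src u))) (MapO (D1 D (idF M \<otimes>\<^sub>F u)) Y) =
      MapO (D1 D (idF L \<otimes>\<^sub>F u)) (MapO (D1 D (v \<otimes>\<^sub>F idF (Tgt u))) Y)" if "Y \<in> Obj (D0 D (M \<otimes> Tgt u))" for Y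
    using that by (simp add: D1_comp_simps times_interchange)
  have comm_insertion: "D1 D (insertion L x (Src u)) \<odot> D1 D (idF L \<otimes>\<^sub>F u) = D1 D u \<odot> D1 D (insertion L x (Tgt u))"
    if "x \<in> Obj L" for x
    using that by (simp add: insertion_natural flip: D1_compF)
  have comm_insertionO: "MapO (D1 D (insertion L x (Src u))) (MapO (D1 D (idF L \<otimes>\<^sub>F u)) Y) =
      MapO (D1 D u) (MapO (D1 D (insertion L x (Tgt u))) Y)" if "x \<in> Obj L" "Y \<in> Obj (D0 D (L \<otimes> Tgt u))" for x Y
    using that by (simp add: D1_comp_simps insertion_natural)
  show ?thesis
  proof (rule universal_arrow_pointwise[where I = "Obj L" and k = "\<lambda>x. op_functor (D1 D (insertion L x (Tgt u)))"
        and r = "\<lambda>x. op_functor (D1 D (insertion L x (Src u)))" and p = "\<lambda>x. op_functor (D1 D u)"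
        and a = "\<lambda>x. op_nat (idN (D1 D (insertion L x (Src u)) \<odot> D1 D (idF L \<otimes>\<^sub>F u)))"])
    show "universal_arrow (op_functor (D1 D (idF L \<otimes>\<^sub>F u))) ?X (MapO r0 ?X) (At \<epsilon>0 ?X)"
      using adjunction_universal_arrow[OF adjunction_op[OF adj0], of ?X] by simp
    fix x assume x [simp]: "x \<in> Obj L"
    have x' [simp]: "MapO v x \<in> Obj M" using functor_simps(3)[of v M x] by simp
    show "nat_trans (op_nat (idN (D1 D (insertion L x (Src u)) \<odot> D1 D (idF L \<otimes>\<^sub>F u))))
        (op_functor (D1 D (insertion L x (Src u))) \<odot> op_functor (D1 D (idF L \<otimes>\<^sub>F u)))
        (op_functor (D1 D u) \<odot> op_functor (D1 D (insertion L x (Tgt u))))"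
      by (simp add: nat_trans_def comm_insertion flip: op_compF)
    show "universal_arrow (op_functor (D1 D u)) (MapO (op_functor (D1 D (insertion L x (Src u)))) ?X)
        (MapO (op_functor (D1 D (insertion L x (Tgt u)))) (MapO r0 ?X))
        (Comp (Tgt (op_functor (D1 D (insertion L x (Src u)))))
          (At (op_nat (idN (D1 D (insertion L x (Src u)) \<odot> D1 D (idF L \<otimes>\<^sub>F u)))) (MapO r0 ?X))
          (MapA (op_functor (D1 D (insertion L x (Src u)))) (At \<epsilon>0 ?X)))"
      using insertion_couniversal_arrow[OF _ x u adj0, of ?X] by (simp add: comm_insertionO)
    show "universal_arrow (op_functor (D1 D u)) (MapO (op_functor (D1 D (insertion L x (Src u)))) ?X)
        (MapO (op_functor (D1 D (insertion L x (Tgt u)))) (MapO (D1 D (v \<otimes>\<^sub>F idF (Tgt u))) (MapO r X)))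
        (Comp (Tgt (op_functor (D1 D (insertion L x (Src u)))))
          (At (op_nat (idN (D1 D (insertion L x (Src u)) \<odot> D1 D (idF L \<otimes>\<^sub>F u)))) (MapO (D1 D (v \<otimes>\<^sub>F idF (Tgt u))) (MapO r X)))
          (MapA (op_functor (D1 D (insertion L x (Src u)))) (MapA (D1 D (v \<otimes>\<^sub>F idF (Src u))) (At \<epsilon> X))))"
      using insertion_couniversal_arrow[OF _ x' u adj X] by (simp add: comm flip: times_insertion) (simp add: D1_compF)
  next
    fix g assume g: "g \<in> Arr (Src (op_functor (D1 D (idF L \<otimes>\<^sub>F u))))"
      and iso: "\<And>x. x \<in> Obj L \<Longrightarrow> iso_arr (Tgt (op_functor (D1 D (insertion L x (Tgt u)))))
        (MapA (op_functor (D1 D (insertion L x (Tgt u)))) g)"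
    then show "iso_arr (Src (op_functor (D1 D (idF L \<otimes>\<^sub>F u)))) g"
      using iso_arr_if_insertion[of L "Tgt u" g] by simp
  qed (simp_all add: arrow_def comm)
qed

end

end

section \<open>Pullback and evaluation\<close>

lemma shift_simps [simp]:
  "D0 (shift D M) K = D0 D (M \<otimes> K)" "D1 (shift D M) u = D1 D (idF M \<otimes>\<^sub>F u)"
  "D2 (shift D M) \<alpha> = D2 D (idN (idF M) \<otimes>\<^sub>N \<alpha>)"
  by (simp_all add: shift_def)

context derivator_in_universe
begin

lemma prederivator_shift: "small_cat M \<Longrightarrow> prederivator_in_universe (shift D M)"
  by (intro prederivator_in_universe.intro is_prederivator_shift universe_axioms)

lemma strict_transformation_pullback:
  assumes v: "small_fun v"
  shows "strict_transformation (shift D (Tgt v)) (shift D (Src v)) (\<lambda>K. D1 D (v \<otimes>\<^sub>F idF K))"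
proof (intro strict_transformation.intro strict_transformation_axioms.intro prederivator_shift universe_axioms)
  note [simp] = v
  fix \<alpha> X assume \<alpha> [simp]: "small_nat \<alpha>" and X: "X \<in> Obj (D0 (shift D (Tgt v)) (Tgt (DomF \<alpha>)))"
  have "(idN (idF (Tgt v)) \<otimes>\<^sub>N \<alpha>) \<star> idN (v \<otimes>\<^sub>F idF (Src (DomF \<alpha>))) =
      idN (v \<otimes>\<^sub>F idF (Tgt (DomF \<alpha>))) \<star> (idN (idF (Src v)) \<otimes>\<^sub>N \<alpha>)"
    by (rule times_nat_eqI)
      (use times_interchange[OF v refl refl, of "DomF \<alpha>"] times_interchange[OF v refl refl, of "CodF \<alpha>"] in auto)
  then show "MapA (D1 D (v \<otimes>\<^sub>F idF (Src (DomF \<alpha>)))) (At (D2 (shift D (Tgt v)) \<alpha>) X) =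
      At (D2 (shift D (Src v)) \<alpha>) (MapO (D1 D (v \<otimes>\<^sub>F idF (Tgt (DomF \<alpha>)))) X)"
    using At_D2_whisker_right[of "idN (idF (Tgt v)) \<otimes>\<^sub>N \<alpha>" "v \<otimes>\<^sub>F idF (Src (DomF \<alpha>))" X]
      At_D2_whisker_left[of "idN (idF (Src v)) \<otimes>\<^sub>N \<alpha>" "v \<otimes>\<^sub>F idF (Tgt (DomF \<alpha>))" X] X
    by simp
qed (use v in \<open>simp_all add: times_interchange flip: D1_compF\<close>)

lemma strict_transformation_evaluation:
  assumes M: "small_cat M" and m: "m \<in> Obj M"
  shows "strict_transformation (shift D M) D (\<lambda>K. D1 D (left_unitor K) \<odot> D1 D (point M m \<otimes>\<^sub>F idF K))"
proof -
  note [simp] = M m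
  have insertion: "D1 D (left_unitor K) \<odot> D1 D (point M m \<otimes>\<^sub>F idF K) = D1 D (insertion M m K)" if "small_cat K" for K
    using that by (simp add: insertion_def D1_compF)
  have comm: "D1 D u \<odot> D1 D (insertion M m (Tgt u)) = D1 D (insertion M m (Src u)) \<odot> D1 D (idF M \<otimes>\<^sub>F u)"
    if "small_fun u" for u
    using that by (simp add: insertion_natural flip: D1_compF)
  show ?thesis
  proof (intro strict_transformation.intro strict_transformation_axioms.intro prederivator_shift universe_axioms)
    show "prederivator_in_universe D" by (rule prederivator_in_universe_axioms)
    fix \<alpha> X assume \<alpha> [simp]: "small_nat \<alpha>" and X: "X \<in> Obj (D0 (shift D M) (Tgt (DomF \<alpha>)))"
    have "(idN (idF M) \<otimes>\<^sub>N \<alpha>) \<star> idN (insertion M m (Src (DomF \<alpha>))) = idN (insertion M m (Tgt (DomF \<alpha>))) \<star> \<alpha>"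
      by (rule nat_eqI) (use insertion_natural[of M "DomF \<alpha>" m] insertion_natural[of M "CodF \<alpha>" m] in auto)
    then show "MapA (D1 D (left_unitor (Src (DomF \<alpha>))) \<odot> D1 D (point M m \<otimes>\<^sub>F idF (Src (DomF \<alpha>))))
          (At (D2 (shift D M) \<alpha>) X) =
        At (D2 D \<alpha>) (MapO (D1 D (left_unitor (Tgt (DomF \<alpha>))) \<odot> D1 D (point M m \<otimes>\<^sub>F idF (Tgt (DomF \<alpha>)))) X)"
      using At_D2_whisker_right[of "idN (idF M) \<otimes>\<^sub>N \<alpha>" "insertion M m (Src (DomF \<alpha>))" X]
        At_D2_whisker_left[of \<alpha> "insertion M m (Tgt (DomF \<alpha>))" X] X
      by (simp add: insertion del: compF_simps)
  qed (simp_all add: insertion comm del: compF_simps)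
qed

end

theorem proposition2p6:
  fixes D :: "('u, 'o, 'a) prederivator" and L M :: "'u small_category" and v :: "'u small_functor"
  assumes "infinite (UNIV :: 'u set)"
    and "derivator D"
    and "small_cat L" and "small_cat M"
    and "is_functor v" and "Src v = L" and "Tgt v = M"
  shows "pseudonatural (shift D M) (shift D L) (pullback D v) \<and>
         (\<forall>u. small_fun u \<longrightarrow>
            preserves_left_Kan (shift D M) (shift D L) (pullback D v) u \<and>
            preserves_right_Kan (shift D M) (shift D L) (pullback D v) u) \<and>
         (\<forall>m\<in>Obj M.
            pseudonatural (shift D M) D (evaluation D M m) \<and>
            (\<forall>u. small_fun u \<longrightarrow>
               preserves_left_Kan (shift D M) D (evaluation D M m) u \<and>
               preserves_right_Kan (shift D M) D (evaluation D M m) u))"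
proof -
  interpret derivator D by fact
  interpret derivator_in_universe "TYPE('u)" D
    by unfold_locales (rule assms(1))
  note [simp] = assms(3,4)
  have v [simp]: "small_fun v" using assms by (simp add: small_funI)
  interpret V: strict_transformation "TYPE('u)" "shift D M" "shift D L" "\<lambda>K. D1 D (v \<otimes>\<^sub>F idF K)"
    using strict_transformation_pullback[OF v] assms by simp
  have pullback_eq: "pullback D v = strict_morphism (shift D L) (\<lambda>K. D1 D (v \<otimes>\<^sub>F idF K))"
    using assms by (simp add: pullback_def)
  have adjoints: "has_left_adjoint (D1 D (idF K \<otimes>\<^sub>F u))" "has_right_adjoint (D1 D (idF K \<otimes>\<^sub>F u))"
    if "small_fun u" "small_cat K" for u K
    using that by (auto intro: Der3_left Der3_right)
  have left: "preserves_left_Kan (shift D M) (shift D L) (pullback D v) u" if u: "small_fun u" for u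
    unfolding pullback_eq
    by (rule V.preserves_left_Kan[OF u])
      (use u assms adjoints pullback_universal_arrow[OF v _ _ u] in auto)
  have right: "preserves_right_Kan (shift D M) (shift D L) (pullback D v) u" if u: "small_fun u" for u
    unfolding pullback_eq
    by (rule V.preserves_right_Kan[OF u])
      (use u assms adjoints pullback_couniversal_arrow[OF v _ _ u] in auto)
  have eval: "pseudonatural (shift D M) D (evaluation D M m) \<and>
      (small_fun u \<longrightarrow> preserves_left_Kan (shift D M) D (evaluation D M m) u \<and>
         preserves_right_Kan (shift D M) D (evaluation D M m) u)" if m: "m \<in> Obj M" for m u
  proof -
    let ?G = "\<lambda>K. D1 D (left_unitor K) \<odot> D1 D (point M m \<otimes>\<^sub>F idF K)"
    interpret E: strict_transformation "TYPE('u)" "shift D M" D ?G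
      using strict_transformation_evaluation[OF _ m] by simp
    have eq: "evaluation D M m = strict_morphism D ?G"
      by (simp add: evaluation_def pullback_def)
    have insertion: "D1 D (left_unitor K) \<odot> D1 D (point M m \<otimes>\<^sub>F idF K) = D1 D (insertion M m K)"
        if "small_cat K" for K
      using that m by (simp add: insertion_def D1_compF)
    have "preserves_left_Kan (shift D M) D (strict_morphism D ?G) u" if u: "small_fun u"
      by (rule E.preserves_left_Kan[OF u])
        (use u adjoints Der3_left insertion_universal_arrow[OF _ m u] in \<open>auto simp: insertion simp del: compF_simps\<close>)
    moreover have "preserves_right_Kan (shift D M) D (strict_morphism D ?G) u" if u: "small_fun u"
      by (rule E.preserves_right_Kan[OF u])
        (use u adjoints Der3_right insertion_couniversal_arrow[OF _ m u]
            in \<open>auto simp: insertion simp del: compF_simps\<close>)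
    ultimately show ?thesis using E.pseudonatural by (simp add: eq)
  qed
  show ?thesis
    using V.pseudonatural left right eval by (simp add: pullback_eq)
qed

end
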